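(* Let $G$ be a finite group. Then there is a ring isomorphism $A(G)\cong\mathrm{G}_0(G_+)$ induced by the functor $P$ that sends a finite $G$-set $S$ to the pointed $G$-set $S_+$.
   Context: $A(G)$ is the Burnside ring of $G$, i.e. the Grothendieck ring of finite $G$-sets under disjoint union, with product induced by the cartesian product with diagonal action. $S_+=S\sqcup\{\star\}$ denotes $S$ with a disjoint basepoint added. An $\mathbb{F}_1$-algebra is a pointed monoid $M$ (a unital monoid with an absorbing element $0$); $G_+=G\sqcup\{0\}$ is the $\mathbb{F}_1$-algebra obtained from $G$ by adjoining a disjoint absorbing element. A (right, unital) $M$-module is a pointed set $(S,0_S)$ with a right unital $M$-action by pointed maps such that $0\in M$ acts as the constant map to $0_S$; homomorphisms are $M$-equivariant pointed maps. $\mathtt{FG}(M)$ is the category of finitely generated $M$-modules (those of the form $\bigcup_{s\in S'}sM$ with $S'$ finite), regarded as a Waldhausen category: cofibrations are the split monomorphisms of $M$-modules $S_1\to S_2$ (having an $M$-module retraction) with $S_2/S_1$ in $\mathtt{FG}(M)$; weak equivalences are isomorphisms. $\mathbf{G}(M)$ is the Waldhausen $\mathrm{K}$-theory spectrum of $\mathtt{FG}(M)$ and $\mathrm{G}_0(M)=\pi_0(\mathbf{G}(M))$. For $G$ finite, the category $\mathtt{FG}(G_+)$ is the category of finite pointed $G$-sets, and the ring structure on $\mathrm{G}_0(G_+)$ is induced by $(S,S')\mapsto S\wedge S'$, the smash product of pointed sets with the diagonal $G$-action. *)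

theory Defs
  imports "HOL-Analysis.Analysis" "HOL-Homology.Simplices" "HOL-Algebra.QuotRing"
    "HOL-Library.Nat_Bijection"
begin

section \<open>The Grothendieck ring of a semiring\<close>

definition diff_class :: "('a, 'r) ring_scheme \<Rightarrow> 'a \<Rightarrow> 'a \<Rightarrow> ('a \<times> 'a) set" where
  "diff_class R a b =
     {(c, d). c \<in> carrier R \<and> d \<in> carrier R \<and>
        (\<exists>k \<in> carrier R. a \<oplus>\<^bsub>R\<^esub> d \<oplus>\<^bsub>R\<^esub> k = c \<oplus>\<^bsub>R\<^esub> b \<oplus>\<^bsub>R\<^esub> k)}"

definition grothendieck_ring :: "('a, 'r) ring_scheme \<Rightarrow> ('a \<times> 'a) set ring" where
  "grothendieck_ring R =
     \<lparr> carrier = {diff_class R a b | a b. a \<in> carrier R \<and> b \<in> carrier R},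
       mult = (\<lambda>X Y. \<Union>(a, b) \<in> X. \<Union>(c, d) \<in> Y.
                 diff_class R (a \<otimes>\<^bsub>R\<^esub> c \<oplus>\<^bsub>R\<^esub> b \<otimes>\<^bsub>R\<^esub> d) (a \<otimes>\<^bsub>R\<^esub> d \<oplus>\<^bsub>R\<^esub> b \<otimes>\<^bsub>R\<^esub> c)),
       one = diff_class R \<one>\<^bsub>R\<^esub> \<zero>\<^bsub>R\<^esub>,
       zero = diff_class R \<zero>\<^bsub>R\<^esub> \<zero>\<^bsub>R\<^esub>,
       add = (\<lambda>X Y. \<Union>(a, b) \<in> X. \<Union>(c, d) \<in> Y. diff_class R (a \<oplus>\<^bsub>R\<^esub> c) (b \<oplus>\<^bsub>R\<^esub> d)) \<rparr>"

section \<open>Finite \<open>G\<close>-sets and the Burnside ring\<close>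

text \<open>
  \<open>G\<close> acts from the right, as monoids do on their modules below. To have a set of isomorphism
  classes, the underlying sets are taken to be finite sets of natural numbers; every finite
  \<open>G\<close>-set has an isomorphic copy of this form. Values of an action outside the underlying set
  carry no meaning.
\<close>

record ('g, 'x) gset =
  gpts :: "'x set"
  gact :: "'x \<Rightarrow> 'g \<Rightarrow> 'x"

definition finite_gsets :: "('g, 'b) monoid_scheme \<Rightarrow> ('g, nat) gset set" where
  "finite_gsets G = {S. finite (gpts S) \<and>
     (\<forall>x \<in> gpts S. \<forall>g \<in> carrier G. gact S x g \<in> gpts S) \<and>
     (\<forall>x \<in> gpts S. gact S x \<one>\<^bsub>G\<^esub> = x) \<and>
     (\<forall>x \<in> gpts S. \<forall>g \<in> carrier G. \<forall>h \<in> carrier G.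
        gact S x (g \<otimes>\<^bsub>G\<^esub> h) = gact S (gact S x g) h)}"

definition gset_iso :: "('g, 'b) monoid_scheme \<Rightarrow> ('g, 'x) gset \<Rightarrow> ('g, 'y) gset \<Rightarrow> bool" where
  "gset_iso G S T \<longleftrightarrow> (\<exists>f. bij_betw f (gpts S) (gpts T) \<and>
     (\<forall>x \<in> gpts S. \<forall>g \<in> carrier G. f (gact S x g) = gact T (f x) g))"

definition gset_class :: "('g, 'b) monoid_scheme \<Rightarrow> ('g, nat) gset \<Rightarrow> ('g, nat) gset set" where
  "gset_class G S = {T \<in> finite_gsets G. gset_iso G S T}"

definition gset_union :: "('g, nat) gset \<Rightarrow> ('g, nat) gset \<Rightarrow> ('g, nat) gset" where
  "gset_union S T =
     \<lparr> gpts = sum_encode ` (gpts S <+> gpts T),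
       gact = (\<lambda>z g. case sum_decode z of Inl x \<Rightarrow> sum_encode (Inl (gact S x g))
                                        | Inr y \<Rightarrow> sum_encode (Inr (gact T y g))) \<rparr>"

definition gset_prod :: "('g, nat) gset \<Rightarrow> ('g, nat) gset \<Rightarrow> ('g, nat) gset" where
  "gset_prod S T =
     \<lparr> gpts = prod_encode ` (gpts S \<times> gpts T),
       gact = (\<lambda>z g. case prod_decode z of (x, y) \<Rightarrow> prod_encode (gact S x g, gact T y g)) \<rparr>"

definition gset_empty :: "('g, nat) gset" where
  "gset_empty = \<lparr> gpts = {}, gact = (\<lambda>x g. x) \<rparr>"

definition gset_point :: "('g, nat) gset" where
  "gset_point = \<lparr> gpts = {0}, gact = (\<lambda>x g. x) \<rparr>"

definition gset_semiring :: "('g, 'b) monoid_scheme \<Rightarrow> ('g, nat) gset set ring" where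
  "gset_semiring G =
     \<lparr> carrier = gset_class G ` finite_gsets G,
       mult = (\<lambda>X Y. \<Union>S \<in> X. \<Union>T \<in> Y. gset_class G (gset_prod S T)),
       one = gset_class G gset_point,
       zero = gset_class G gset_empty,
       add = (\<lambda>X Y. \<Union>S \<in> X. \<Union>T \<in> Y. gset_class G (gset_union S T)) \<rparr>"

definition burnside_ring ::
    "('g, 'b) monoid_scheme \<Rightarrow> (('g, nat) gset set \<times> ('g, nat) gset set) set ring" where
  "burnside_ring G = grothendieck_ring (gset_semiring G)"

definition burnside_class ::
    "('g, 'b) monoid_scheme \<Rightarrow> ('g, nat) gset \<Rightarrow> (('g, nat) gset set \<times> ('g, nat) gset set) set" where
  "burnside_class G S =
     diff_class (gset_semiring G) (gset_class G S) \<zero>\<^bsub>gset_semiring G\<^esub>"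

section \<open>Simplicial sets and the fundamental group of the geometric realization\<close>

text \<open>
  \<open>oper X k n \<theta>\<close> is the map from \<open>n\<close>-simplices to \<open>k\<close>-simplices given by a monotone map \<open>\<theta>\<close>
  from \<open>{0..k}\<close> to \<open>{0..n}\<close>.
\<close>

record 's sset =
  simp :: "nat \<Rightarrow> 's set"
  oper :: "nat \<Rightarrow> nat \<Rightarrow> (nat \<Rightarrow> nat) \<Rightarrow> 's \<Rightarrow> 's"

definition simplex_maps :: "nat \<Rightarrow> nat \<Rightarrow> (nat \<Rightarrow> nat) set" where
  "simplex_maps k n = {\<theta>. mono_on {..k} \<theta> \<and> \<theta> ` {..k} \<subseteq> {..n}}"

definition simplex_push :: "nat \<Rightarrow> (nat \<Rightarrow> nat) \<Rightarrow> (nat \<Rightarrow> real) \<Rightarrow> nat \<Rightarrow> real" where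
  "simplex_push k \<theta> t = (\<lambda>j. \<Sum>i | i \<le> k \<and> \<theta> i = j. t i)"

type_synonym 's cell_point = "(nat \<times> 's) \<times> (nat \<Rightarrow> real)"

definition cells :: "'s sset \<Rightarrow> 's cell_point topology" where
  "cells X = sum_topology (\<lambda>(n, x). subtopology (powertop_real UNIV) (standard_simplex n))
     (Sigma UNIV (simp X))"

definition glue :: "'s sset \<Rightarrow> 's cell_point rel" where
  "glue X = {(((k, oper X k n \<theta> x), t), ((n, x), simplex_push k \<theta> t)) | k n \<theta> x t.
     \<theta> \<in> simplex_maps k n \<and> x \<in> simp X n \<and> t \<in> standard_simplex k}"

definition real_point :: "'s sset \<Rightarrow> 's cell_point \<Rightarrow> 's cell_point set" where
  "real_point X p = {q. (p, q) \<in> (glue X \<union> (glue X)\<inverse>)\<^sup>*}"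

definition realization :: "'s sset \<Rightarrow> 's cell_point set topology" where
  "realization X = topology (\<lambda>U. U \<subseteq> real_point X ` topspace (cells X) \<and>
     openin (cells X) {p \<in> topspace (cells X). real_point X p \<in> U})"

definition real_vertex :: "'s sset \<Rightarrow> 's \<Rightarrow> 's cell_point set" where
  "real_vertex X v = real_point X ((0, v), (\<lambda>i. if i = 0 then 1 else 0))"

definition real_edge :: "'s sset \<Rightarrow> 's \<Rightarrow> real \<Rightarrow> 's cell_point set" where
  "real_edge X e = (\<lambda>u. real_point X ((1, e), (\<lambda>i. if i = 0 then 1 - u else if i = 1 then u else 0)))"

definition loops :: "'a topology \<Rightarrow> 'a \<Rightarrow> (real \<Rightarrow> 'a) set" where
  "loops T b = {f. pathin T f \<and> f 0 = b \<and> f 1 = b}"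

definition loop_class :: "'a topology \<Rightarrow> 'a \<Rightarrow> (real \<Rightarrow> 'a) \<Rightarrow> (real \<Rightarrow> 'a) set" where
  "loop_class T b f =
     {h \<in> loops T b. homotopic_with (\<lambda>l. l 0 = b \<and> l 1 = b) (top_of_set {0..1}) T f h}"

definition loop_join :: "(real \<Rightarrow> 'a) \<Rightarrow> (real \<Rightarrow> 'a) \<Rightarrow> real \<Rightarrow> 'a" where
  "loop_join f h = (\<lambda>u. if u \<le> 1/2 then f (2 * u) else h (2 * u - 1))"

definition fundamental_group :: "'a topology \<Rightarrow> 'a \<Rightarrow> (real \<Rightarrow> 'a) set monoid" where
  "fundamental_group T b =
     \<lparr> carrier = loop_class T b ` loops T b,
       mult = (\<lambda>X Y. \<Union>f \<in> X. \<Union>h \<in> Y. loop_class T b (loop_join f h)),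
       one = loop_class T b (\<lambda>u. b) \<rparr>"

section \<open>Waldhausen's \<open>S\<close>-construction and \<open>K\<^sub>0\<close>\<close>

record ('o, 'a) wald =
  Obj :: "'o set"
  Arr :: "'a set"
  Dom :: "'a \<Rightarrow> 'o"
  Cod :: "'a \<Rightarrow> 'o"
  Idn :: "'o \<Rightarrow> 'a"
  Cmp :: "'a \<Rightarrow> 'a \<Rightarrow> 'a"  \<comment> \<open>\<open>Cmp C g f\<close> is \<open>g\<close> after \<open>f\<close>\<close>
  Zer :: 'o
  Cof :: "'a set"
  Weq :: "'a set"

definition is_pushout :: "('o, 'a) wald \<Rightarrow> 'a \<Rightarrow> 'a \<Rightarrow> 'a \<Rightarrow> 'a \<Rightarrow> bool" where
  "is_pushout C f g h k \<longleftrightarrow>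
     f \<in> Arr C \<and> g \<in> Arr C \<and> h \<in> Arr C \<and> k \<in> Arr C \<and>
     Dom C f = Dom C g \<and> Cod C f = Dom C h \<and> Cod C g = Dom C k \<and> Cod C h = Cod C k \<and>
     Cmp C h f = Cmp C k g \<and>
     (\<forall>h' \<in> Arr C. \<forall>k' \<in> Arr C.
        Dom C h' = Cod C f \<and> Dom C k' = Cod C g \<and> Cod C h' = Cod C k' \<and>
        Cmp C h' f = Cmp C k' g \<longrightarrow>
        (\<exists>!u. u \<in> Arr C \<and> Dom C u = Cod C h \<and> Cod C u = Cod C h' \<and>
              Cmp C u h = h' \<and> Cmp C u k = k'))"

text \<open>
  An \<open>m\<close>-simplex of the nerve of the category \<open>wS\<^sub>n\<close> is a functor from the product of the poset
  \<open>Ar[n]\<close> of pairs \<open>i \<le> j \<le> n\<close> with \<open>[m]\<close>. The diagonal of this bisimplicial set, whose realization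
  is that of the simplicial category \<open>wS\<close>, has \<open>m = n\<close>; below, \<open>(i, j, p)\<close> is the
  object \<open>(i, j)\<close> of \<open>Ar[n]\<close> at stage \<open>p\<close> of the nerve. A functor is given by its values \<open>F x y\<close>
  on the arrows \<open>x \<le> y\<close>, and is undefined elsewhere.
\<close>

type_synonym index = "nat \<times> nat \<times> nat"

definition indices :: "nat \<Rightarrow> index set" where
  "indices n = {(i, j, p). i \<le> j \<and> j \<le> n \<and> p \<le> n}"

definition index_arrows :: "nat \<Rightarrow> (index \<times> index) set" where
  "index_arrows n = {((i, j, p), (i', j', p')). (i, j, p) \<in> indices n \<and> (i', j', p') \<in> indices n \<and>
     i \<le> i' \<and> j \<le> j' \<and> p \<le> p'}"

definition wS_simplices :: "('o, 'a) wald \<Rightarrow> nat \<Rightarrow> (index \<Rightarrow> index \<Rightarrow> 'a) set" where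
  "wS_simplices C n = {F.
     (\<forall>x y. (x, y) \<notin> index_arrows n \<longrightarrow> F x y = undefined) \<and>
     (\<forall>x \<in> indices n. Dom C (F x x) \<in> Obj C \<and> F x x = Idn C (Dom C (F x x))) \<and>
     (\<forall>(x, y) \<in> index_arrows n.
        F x y \<in> Arr C \<and> Dom C (F x y) = Dom C (F x x) \<and> Cod C (F x y) = Dom C (F y y)) \<and>
     (\<forall>x y z. (x, y) \<in> index_arrows n \<and> (y, z) \<in> index_arrows n \<longrightarrow>
        F x z = Cmp C (F y z) (F x y)) \<and>
     (\<forall>j \<le> n. \<forall>p \<le> n. Dom C (F (j, j, p) (j, j, p)) = Zer C) \<and>
     (\<forall>i j k p. i \<le> j \<and> j \<le> k \<and> k \<le> n \<and> p \<le> n \<longrightarrow>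
        F (i, j, p) (i, k, p) \<in> Cof C \<and>
        is_pushout C (F (i, j, p) (i, k, p)) (F (i, j, p) (j, j, p))
                     (F (i, k, p) (j, k, p)) (F (j, j, p) (j, k, p))) \<and>
     (\<forall>i j p q. i \<le> j \<and> j \<le> n \<and> p \<le> q \<and> q \<le> n \<longrightarrow> F (i, j, p) (i, j, q) \<in> Weq C)}"

definition index_map :: "(nat \<Rightarrow> nat) \<Rightarrow> index \<Rightarrow> index" where
  "index_map \<theta> = (\<lambda>(i, j, p). (\<theta> i, \<theta> j, \<theta> p))"

definition wS :: "('o, 'a) wald \<Rightarrow> (index \<Rightarrow> index \<Rightarrow> 'a) sset" where
  "wS C = \<lparr> simp = wS_simplices C,
            oper = (\<lambda>k n \<theta> F x y. if (x, y) \<in> index_arrows k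
                                  then F (index_map \<theta> x) (index_map \<theta> y) else undefined) \<rparr>"

definition wS_space :: "('o, 'a) wald \<Rightarrow> (index \<Rightarrow> index \<Rightarrow> 'a) cell_point set topology" where
  "wS_space C = realization (wS C)"

definition wS_base :: "('o, 'a) wald \<Rightarrow> (index \<Rightarrow> index \<Rightarrow> 'a) cell_point set" where
  "wS_base C = real_vertex (wS C)
     (\<lambda>x y. if (x, y) \<in> index_arrows 0 then Idn C (Zer C) else undefined)"

text \<open>
  The K-theory spectrum of \<open>C\<close> is an \<open>\<Omega>\<close>-spectrum with zeroth space the loop space of \<open>wS_space C\<close>,
  so that its \<open>\<pi>\<^sub>0\<close> is the group of homotopy classes of loops. An object \<open>A\<close> gives the loop along
  the 1-simplex with value \<open>A\<close> at \<open>(0, 1)\<close> and identities as weak equivalences.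
\<close>

type_synonym 'a K0_elem = "(real \<Rightarrow> (index \<Rightarrow> index \<Rightarrow> 'a) cell_point set) set"

definition K0 :: "('o, 'a) wald \<Rightarrow> 'a K0_elem monoid" where
  "K0 C = fundamental_group (wS_space C) (wS_base C)"

definition object_simplex :: "('o, 'a) wald \<Rightarrow> 'o \<Rightarrow> index \<Rightarrow> index \<Rightarrow> 'a" where
  "object_simplex C A = (THE F. F \<in> wS_simplices C 1 \<and> F (0, 1, 0) (0, 1, 1) = Idn C A)"

definition K0_class :: "('o, 'a) wald \<Rightarrow> 'o \<Rightarrow> 'a K0_elem" where
  "K0_class C A = loop_class (wS_space C) (wS_base C) (real_edge (wS C) (object_simplex C A))"

section \<open>Modules over pointed monoids\<close>

record 'm pmonoid = "'m monoid" +
  absorb :: 'm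

locale pointed_monoid = monoid M for M :: "('m, 'b) pmonoid_scheme" (structure) +
  assumes absorb_closed: "absorb M \<in> carrier M"
    and absorb_left: "x \<in> carrier M \<Longrightarrow> absorb M \<otimes> x = absorb M"
    and absorb_right: "x \<in> carrier M \<Longrightarrow> x \<otimes> absorb M = absorb M"

definition adjoin_zero :: "('g, 'b) monoid_scheme \<Rightarrow> 'g option pmonoid" where
  "adjoin_zero G =
     \<lparr> carrier = insert None (Some ` carrier G),
       mult = (\<lambda>x y. case (x, y) of (Some g, Some h) \<Rightarrow> Some (g \<otimes>\<^bsub>G\<^esub> h) | _ \<Rightarrow> None),
       one = Some \<one>\<^bsub>G\<^esub>,
       absorb = None \<rparr>"

lemma pointed_monoid_adjoin_zero:
  assumes "group G"
  shows "pointed_monoid (adjoin_zero G)"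
proof -
  interpret group G by fact
  show ?thesis
    by unfold_locales (auto simp: adjoin_zero_def m_assoc split: option.splits)
qed

record ('m, 'x) pmod =
  mpts :: "'x set"
  mbase :: 'x
  mact :: "'x \<Rightarrow> 'm \<Rightarrow> 'x"

definition is_module :: "('m, 'b) pmonoid_scheme \<Rightarrow> ('m, 'x) pmod \<Rightarrow> bool" where
  "is_module M S \<longleftrightarrow>
     mbase S \<in> mpts S \<and>
     (\<forall>s \<in> mpts S. \<forall>m \<in> carrier M. mact S s m \<in> mpts S) \<and>
     (\<forall>m \<in> carrier M. mact S (mbase S) m = mbase S) \<and>
     (\<forall>s \<in> mpts S. mact S s \<one>\<^bsub>M\<^esub> = s) \<and>
     (\<forall>s \<in> mpts S. \<forall>m \<in> carrier M. \<forall>n \<in> carrier M.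
        mact S s (m \<otimes>\<^bsub>M\<^esub> n) = mact S (mact S s m) n) \<and>
     (\<forall>s \<in> mpts S. mact S s (absorb M) = mbase S)"

definition is_fg_module :: "('m, 'b) pmonoid_scheme \<Rightarrow> ('m, 'x) pmod \<Rightarrow> bool" where
  "is_fg_module M S \<longleftrightarrow> is_module M S \<and>
     (\<exists>S'. finite S' \<and> S' \<subseteq> mpts S \<and> mpts S = (\<Union>s \<in> S'. mact S s ` carrier M))"

type_synonym ('m, 'x) pmod_arrow = "('m, 'x) pmod \<times> ('x \<Rightarrow> 'x) \<times> ('m, 'x) pmod"

definition FG_arrows :: "('m, 'b) pmonoid_scheme \<Rightarrow> ('m, 'x) pmod_arrow set" where
  "FG_arrows M = {(S, f, T). is_fg_module M S \<and> is_fg_module M T \<and>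
     f \<in> mpts S \<rightarrow>\<^sub>E mpts T \<and> f (mbase S) = mbase T \<and>
     (\<forall>s \<in> mpts S. \<forall>m \<in> carrier M. f (mact S s m) = mact T (f s) m)}"

definition arrow_id :: "('m, 'x) pmod \<Rightarrow> ('m, 'x) pmod_arrow" where
  "arrow_id S = (S, restrict id (mpts S), S)"

definition arrow_comp ::
    "('m, 'x) pmod_arrow \<Rightarrow> ('m, 'x) pmod_arrow \<Rightarrow> ('m, 'x) pmod_arrow" where
  "arrow_comp = (\<lambda>(T, g, U) (S, f, T'). (S, compose (mpts S) g f, U))"

definition zero_module :: "('m, 'x::zero) pmod" where
  "zero_module = \<lparr> mpts = {0}, mbase = 0, mact = (\<lambda>s m. 0) \<rparr>"

text \<open>The quotient collapsing the submodule \<open>A\<close> to the base point.\<close>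

definition quotient_module :: "('m, 'x) pmod \<Rightarrow> 'x set \<Rightarrow> ('m, 'x) pmod" where
  "quotient_module T A =
     \<lparr> mpts = insert (mbase T) (mpts T - A),
       mbase = mbase T,
       mact = (\<lambda>t m. if mact T t m \<in> A then mbase T else mact T t m) \<rparr>"

definition FG_cofibrations :: "('m, 'b) pmonoid_scheme \<Rightarrow> ('m, 'x) pmod_arrow set" where
  "FG_cofibrations M = {(S, f, T). (S, f, T) \<in> FG_arrows M \<and>
     (\<exists>r. (T, r, S) \<in> FG_arrows M \<and> arrow_comp (T, r, S) (S, f, T) = arrow_id S) \<and>
     is_fg_module M (quotient_module T (f ` mpts S))}"

definition FG_isos :: "('m, 'b) pmonoid_scheme \<Rightarrow> ('m, 'x) pmod_arrow set" where
  "FG_isos M = {(S, f, T). (S, f, T) \<in> FG_arrows M \<and>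
     (\<exists>h. (T, h, S) \<in> FG_arrows M \<and> arrow_comp (T, h, S) (S, f, T) = arrow_id S \<and>
          arrow_comp (S, f, T) (T, h, S) = arrow_id T)}"

text \<open>
  The modules have elements in a fixed type \<open>'x\<close>, which makes \<open>FG M\<close> small. It is the category of
  all finitely generated modules, up to equivalence, when \<open>'x\<close> is infinite and at least as
  large as \<open>M\<close>.
\<close>

definition FG ::
    "('m, 'b) pmonoid_scheme \<Rightarrow> (('m, 'x::zero) pmod, ('m, 'x) pmod_arrow) wald" where
  "FG M = \<lparr> Obj = {S. is_fg_module M S},
            Arr = FG_arrows M,
            Dom = fst,
            Cod = snd \<circ> snd,
            Idn = arrow_id,
            Cmp = arrow_comp,
            Zer = zero_module,
            Cof = FG_cofibrations M,
            Weq = FG_isos M \<rparr>"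

section \<open>The ring \<open>G\<^sub>0(G\<^sub>+)\<close>\<close>

text \<open>
  For finite \<open>G\<close>, the finitely generated modules over \<open>adjoin_zero G\<close> are the finite pointed
  \<open>G\<close>-sets, so that natural numbers suffice as elements.
\<close>

type_synonym 'g G0_elem = "('g option, nat) pmod_arrow K0_elem"

definition G0_class ::
    "('g, 'b) monoid_scheme \<Rightarrow> ('g option, nat) pmod \<Rightarrow> 'g G0_elem" where
  "G0_class G S = K0_class (FG (adjoin_zero G)) S"

definition add_point :: "('g, nat) gset \<Rightarrow> ('g option, nat) pmod" where
  "add_point S =
     \<lparr> mpts = insert 0 (Suc ` gpts S),
       mbase = 0,
       mact = (\<lambda>y m. case (y, m) of (Suc x, Some g) \<Rightarrow> Suc (gact S x g) | _ \<Rightarrow> 0) \<rparr>"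

text \<open>The image in the smash product of the pair \<open>(x, y)\<close>.\<close>

definition smash_pair :: "('m, nat) pmod \<Rightarrow> ('m, nat) pmod \<Rightarrow> nat \<Rightarrow> nat \<Rightarrow> nat" where
  "smash_pair S T x y =
     (if x = mbase S \<or> y = mbase T then prod_encode (mbase S, mbase T) else prod_encode (x, y))"

definition smash :: "('m, nat) pmod \<Rightarrow> ('m, nat) pmod \<Rightarrow> ('m, nat) pmod" where
  "smash S T =
     \<lparr> mpts = {smash_pair S T x y | x y. x \<in> mpts S \<and> y \<in> mpts T},
       mbase = prod_encode (mbase S, mbase T),
       mact = (\<lambda>z m. case prod_decode z of (x, y) \<Rightarrow> smash_pair S T (mact S x m) (mact T y m)) \<rparr>"

definition induced_by_smash ::
    "('g, 'b) monoid_scheme \<Rightarrow> ('g G0_elem \<Rightarrow> 'g G0_elem \<Rightarrow> 'g G0_elem) \<Rightarrow> bool" where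
  "induced_by_smash G \<mu> \<longleftrightarrow>
     (let C = FG (adjoin_zero G); H = K0 C in
       (\<forall>x \<in> carrier H. \<forall>y \<in> carrier H. \<mu> x y \<in> carrier H) \<and>
       (\<forall>x y. x \<notin> carrier H \<or> y \<notin> carrier H \<longrightarrow> \<mu> x y = undefined) \<and>
       (\<forall>x \<in> carrier H. \<forall>y \<in> carrier H. \<forall>z \<in> carrier H.
          \<mu> (x \<otimes>\<^bsub>H\<^esub> y) z = \<mu> x z \<otimes>\<^bsub>H\<^esub> \<mu> y z \<and> \<mu> z (x \<otimes>\<^bsub>H\<^esub> y) = \<mu> z x \<otimes>\<^bsub>H\<^esub> \<mu> z y) \<and>
       (\<forall>S \<in> Obj C. \<forall>T \<in> Obj C. \<mu> (G0_class G S) (G0_class G T) = G0_class G (smash S T)))"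

text \<open>The unit of the smash product is the point with a disjoint base point.\<close>

definition G0_ring :: "('g, 'b) monoid_scheme \<Rightarrow> 'g G0_elem ring" where
  "G0_ring G = (let H = K0 (FG (adjoin_zero G)) in
     \<lparr> carrier = carrier H,
       mult = (THE \<mu>. induced_by_smash G \<mu>),
       one = G0_class G (add_point gset_point),
       zero = \<one>\<^bsub>H\<^esub>,
       add = mult H \<rparr>)"

end

theory Submission
  imports Defs "HOL-Complex_Analysis.Winding_Numbers"
begin

text \<open>
  Both rings embed into the ring of integer-valued functions on the subsets of \<open>G\<close> by marks, the
  numbers of fixed points. For \<open>A(G)\<close> this is Burnside's theorem that the marks determine a finite
  \<open>G\<close>-set, and it reduces every ring axiom to one for integers.

  For \<open>G\<^sub>0\<close> the number of points fixed by \<open>H\<close>, less the base point, is additive on cofibre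
  sequences, because the complement of a submodule is invariant under the group \<open>G\<close>. It is thus a
  1-cocycle \<open>h\<close> on the simplicial set \<open>wS\<close>, and \<open>exp (2 \<pi> i \<Sum> t\<^sub>i h\<^sub>i)\<close> is a continuous map from the
  realization to the circle; the winding number of a loop gives a homomorphism on \<open>\<pi>\<^sub>1\<close> whose value
  at the class of a module is the mark.

  That \<open>\<pi>\<^sub>1\<close> is generated by edges, hence by classes of \<open>G\<close>-sets, needs no cell structure.
  For \<open>H = {}\<close> the cocycle is positive on every edge that is not an edge of zero modules, so it cuts a
  simplex into blocks of vertices of equal height. For each real \<open>a\<close> the points whose quantile of
  order \<open>a\<close> is attained in the interior of a block form an open set. That set contracts to the
  vertex: move to the face spanned by this block, a simplex of zero modules, and then to the apex of
  a cone over it. These open sets cover the realization, so every loop is a product of straight paths.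
\<close>

section \<open>Homotopy of paths in abstract topological spaces\<close>

text \<open>The usual cover by open stars of vertices is useless here: there is only one vertex, and
  the gluing does not respect the numbering of the vertices of a simplex. What survives the gluing
  is the comparison of the heights of two vertices, since a simplicial operator shifts all heights
  by one constant. So the distribution of heights at a point is intrinsic up to translation, and a
  quantile selects the same block in every cell that represents the point. The open sets need to
  contract only inside the whole realization; the homotopies may leave them. A simplex of zero
  modules is not constant for free: one-point modules with different points are different objects,
  so such a simplex need not be degenerate. But all arrows between zero modules are forced, so any
  family of them is a simplex, and this is where the cones come from. It suffices that classes of
  \<open>G\<close>-sets commute with each other; every element is then a difference of two such
  classes.\<close>

definition path_homotopic :: "'a topology \<Rightarrow> (real \<Rightarrow> 'a) \<Rightarrow> (real \<Rightarrow> 'a) \<Rightarrow> bool" where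
  "path_homotopic T f g \<longleftrightarrow>
     homotopic_with (\<lambda>l. l 0 = f 0 \<and> l 1 = f 1) (top_of_set {0..1}) T f g"

lemma path_homotopic_ends:
  assumes "path_homotopic T f g"
  shows "g 0 = f 0" "g 1 = f 1"
  using homotopic_with_imp_property[OF assms[unfolded path_homotopic_def]] by auto

lemma path_homotopic_pathin:
  assumes "path_homotopic T f g"
  shows "pathin T f" "pathin T g"
  using homotopic_with_imp_continuous_maps[OF assms[unfolded path_homotopic_def]]
  by (auto simp: pathin_def)

lemma path_homotopic_refl: "pathin T f \<Longrightarrow> path_homotopic T f f"
  by (simp add: path_homotopic_def pathin_def)

lemma path_homotopic_sym: "path_homotopic T f g \<Longrightarrow> path_homotopic T g f"
  using path_homotopic_ends[of T f g] unfolding path_homotopic_def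
  by (simp add: homotopic_with_sym)

lemma path_homotopic_trans [trans]:
  "path_homotopic T f g \<Longrightarrow> path_homotopic T g h \<Longrightarrow> path_homotopic T f h"
  using path_homotopic_ends[of T f g] homotopic_with_trans unfolding path_homotopic_def by auto

lemma path_homotopic_eq:
  assumes "pathin T f" "\<And>u. u \<in> {0..1} \<Longrightarrow> f u = g u"
  shows "path_homotopic T f g"
  unfolding path_homotopic_def
  by (rule homotopic_with_equal) (use assms in \<open>auto simp: pathin_def\<close>)

text \<open>A homotopy in \<open>homotopic_with\<close> has to match its end maps on all reals. The
  condition on the ends reads only the values at 0 and 1, so agreement on the unit interval can be
  extended.\<close>

lemma path_homotopicI:
  assumes "continuous_map (top_of_set ({0..1::real} \<times> {0..1::real})) T h"
    and "\<And>u. u \<in> {0..1} \<Longrightarrow> h (0, u) = f u" "\<And>u. u \<in> {0..1} \<Longrightarrow> h (1, u) = g u"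
    and "\<And>t. t \<in> {0..1} \<Longrightarrow> h (t, 0) = f 0" "\<And>t. t \<in> {0..1} \<Longrightarrow> h (t, 1) = f 1"
  shows "path_homotopic T f g"
proof -
  have "\<exists>h. continuous_map (top_of_set ({0..1::real} \<times> {0..1::real})) T h \<and> (\<forall>u\<in>{0..1}. h (0, u) = f u) \<and>
      (\<forall>u\<in>{0..1}. h (1, u) = g u) \<and> (\<forall>t\<in>{0..1}. h (t, 0) = f 0 \<and> h (t, 1) = f 1)"
    by (intro exI[of _ h] conjI ballI assms)
  then show ?thesis
    unfolding path_homotopic_def by (subst homotopic_with) auto
qed

lemma path_homotopicE:
  assumes "path_homotopic T f g"
  obtains h where "continuous_map (top_of_set ({0..1::real} \<times> {0..1::real})) T h"
    "\<And>u. h (0, u) = f u" "\<And>u. h (1, u) = g u"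
    "\<And>t. t \<in> {0..1} \<Longrightarrow> h (t, 0) = f 0" "\<And>t. t \<in> {0..1} \<Longrightarrow> h (t, 1) = f 1"
proof -
  from assms obtain h where "continuous_map (top_of_set ({0..1::real} \<times> {0..1::real})) T h"
    "\<forall>u. h (0, u) = f u" "\<forall>u. h (1, u) = g u" "\<forall>t \<in> {0..1}. h (t, 0) = f 0 \<and> h (t, 1) = f 1"
    unfolding path_homotopic_def homotopic_with_def by auto
  then show thesis by (intro that[of h]) blast+
qed

lemma path_homotopic_compose:
  assumes "path_homotopic Z f g" and "continuous_map Z T K"
  shows "path_homotopic T (K \<circ> f) (K \<circ> g)"
  using assms unfolding path_homotopic_def
  by (auto intro!: homotopic_with_compose_continuous_map_left[where p = "\<lambda>l. l 0 = f 0 \<and> l 1 = f 1"])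

text \<open>The linear homotopy in \<open>S\<close>, pushed forward by \<open>K\<close>. With the
  unit interval for \<open>S\<close> it gives all reparametrizations, with the unit square the
  deformation of one half of the boundary into the other.\<close>

lemma path_homotopic_convex:
  fixes S :: "'b::real_normed_vector set"
  assumes "convex S" "path f" "path g" "f 0 = g 0" "f 1 = g 1"
    and "f ` {0..1} \<subseteq> S" "g ` {0..1} \<subseteq> S" and K: "continuous_map (top_of_set S) T K"
  shows "path_homotopic T (K \<circ> f) (K \<circ> g)"
proof -
  have "homotopic_paths S f g"
    by (rule homotopic_paths_linear)
       (use assms in \<open>auto simp: pathstart_def pathfinish_def convex_contains_segment image_subset_iff\<close>)
  then have "path_homotopic (top_of_set S) f g"
    unfolding homotopic_paths_def path_homotopic_def pathstart_def pathfinish_def .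
  from path_homotopic_compose[OF this K] show ?thesis .
qed

lemma path_homotopic_reparam:
  assumes "pathin T K" "path a" "path b" "a 0 = b 0" "a 1 = b 1"
    and "a ` {0..1} \<subseteq> {0..1}" "b ` {0..1} \<subseteq> {0..1}"
  shows "path_homotopic T (K \<circ> a) (K \<circ> b)"
  using path_homotopic_convex[of "{0..1::real}" a b T K] assms by (simp add: pathin_def)

lemma pathin_compose_path:
  assumes "continuous_map (top_of_set S) T K" "path a" "a ` {0..1} \<subseteq> S"
  shows "pathin T (K \<circ> a)"
  unfolding pathin_def
  by (rule continuous_map_compose[OF _ assms(1)]) (use assms in \<open>auto simp: path_def\<close>)

subsection \<open>Concatenation\<close>

lemma half_unique: "1 \<le> 2 * u \<Longrightarrow> u * 2 \<le> 1 \<Longrightarrow> u = (1/2::real)"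
  by simp

lemma loop_join_0 [simp]: "loop_join f g 0 = f 0"
  and loop_join_1 [simp]: "loop_join f g 1 = g 1"
  by (simp_all add: loop_join_def)

lemma continuous_map_join:
  fixes p :: "'b \<Rightarrow> real"
  assumes p: "continuous_map X euclideanreal p"
    and "continuous_map (subtopology X {x. p x \<le> c}) T f"
    and "continuous_map (subtopology X {x. p x \<ge> c}) T g"
    and "\<And>x. x \<in> topspace X \<Longrightarrow> p x = c \<Longrightarrow> f x = g x"
  shows "continuous_map X T (\<lambda>x. if p x \<le> c then f x else g x)"
proof (rule continuous_map_cases_le[OF p])
  have "subtopology X {x \<in> topspace X. p x \<le> c} = subtopology X {x. p x \<le> c}"
    "subtopology X {x \<in> topspace X. c \<le> p x} = subtopology X {x. p x \<ge> c}"
    using subtopology_restrict[of X "{x. p x \<le> c}"] subtopology_restrict[of X "{x. p x \<ge> c}"]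
    by (simp_all add: Int_def)
  with assms show "continuous_map (subtopology X {x \<in> topspace X. p x \<le> c}) T f"
    "continuous_map (subtopology X {x \<in> topspace X. c \<le> p x}) T g" by auto
qed (use assms in auto)

lemma pathin_join:
  assumes "pathin T f" "pathin T g" "f 1 = g 0"
  shows "pathin T (loop_join f g)"
  unfolding pathin_def loop_join_def
proof (rule continuous_map_join)
  show "continuous_map (subtopology (top_of_set {0..1}) {x. x \<le> 1/2}) T (\<lambda>u. f (2 * u))"
    by (rule continuous_map_compose[OF _ assms(1)[unfolded pathin_def], unfolded o_def])
      (auto simp: subtopology_subtopology intro!: continuous_intros)
  show "continuous_map (subtopology (top_of_set {0..1}) {x. 1/2 \<le> x}) T (\<lambda>u. g (2 * u - 1))"
    by (rule continuous_map_compose[OF _ assms(2)[unfolded pathin_def], unfolded o_def])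
      (auto simp: subtopology_subtopology intro!: continuous_intros)
next
  fix u :: real assume "u = 1/2"
  then have "2 * u = 1" by simp
  then show "f (2 * u) = g (2 * u - 1)" using assms by simp
qed auto

lemma path_homotopic_join:
  assumes "path_homotopic T f f'" "path_homotopic T g g'" "f 1 = g 0"
  shows "path_homotopic T (loop_join f g) (loop_join f' g')"
proof -
  obtain h where h: "continuous_map (top_of_set ({0..1::real} \<times> {0..1::real})) T h"
    "\<And>u. h (0, u) = f u" "\<And>u. h (1, u) = f' u"
    "\<And>t. t \<in> {0..1} \<Longrightarrow> h (t, 0) = f 0" "\<And>t. t \<in> {0..1} \<Longrightarrow> h (t, 1) = f 1"
    using path_homotopicE[OF assms(1)] by metis
  obtain k where k: "continuous_map (top_of_set ({0..1::real} \<times> {0..1::real})) T k"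
    "\<And>u. k (0, u) = g u" "\<And>u. k (1, u) = g' u"
    "\<And>t. t \<in> {0..1} \<Longrightarrow> k (t, 0) = g 0" "\<And>t. t \<in> {0..1} \<Longrightarrow> k (t, 1) = g 1"
    using path_homotopicE[OF assms(2)] by metis
  let ?II = "top_of_set ({0..1::real} \<times> {0..1::real})"
  let ?l = "\<lambda>x::real \<times> real. if snd x \<le> 1/2 then h (fst x, 2 * snd x) else k (fst x, 2 * snd x - 1)"
  have "continuous_map ?II T ?l"
  proof (rule continuous_map_join)
    show "continuous_map (subtopology ?II {x. snd x \<le> 1/2}) T (\<lambda>x. h (fst x, 2 * snd x))"
      by (rule continuous_map_compose[OF _ h(1), unfolded o_def])
        (auto simp: subtopology_subtopology intro!: continuous_intros)
    show "continuous_map (subtopology ?II {x. 1/2 \<le> snd x}) T (\<lambda>x. k (fst x, 2 * snd x - 1))"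
      by (rule continuous_map_compose[OF _ k(1), unfolded o_def])
        (auto simp: subtopology_subtopology intro!: continuous_intros)
    show "continuous_map ?II euclideanreal snd"
      by (auto intro!: continuous_intros)
    fix x assume x: "x \<in> topspace ?II" "snd x = 1/2"
    from x(2) have "2 * snd x = 1" by simp
    with x(1) show "h (fst x, 2 * snd x) = k (fst x, 2 * snd x - 1)"
      using h k assms by auto
  qed
  then show ?thesis
    by (rule path_homotopicI) (use h k in \<open>auto simp: loop_join_def\<close>)
qed

lemma path_homotopic_join_assoc:
  assumes "pathin T f" "pathin T g" "pathin T h" "f 1 = g 0" "g 1 = h 0"
  shows "path_homotopic T (loop_join (loop_join f g) h) (loop_join f (loop_join g h))"
proof -
  let ?K = "loop_join (loop_join f g) h"
  \<comment> \<open>The paths \<open>f\<close>, \<open>g\<close>, \<open>h\<close> meet at 1/4 and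
    1/2 on one side and at 1/2 and 3/4 on the other. \<open>r\<close> is the piecewise linear map
    from the second subdivision to the first; it is convex, hence the maximum of its linear pieces,
    which makes its continuity immediate.\<close>
  define r where "r = (\<lambda>u::real. max (u / 2) (max (u - 1/4) (2 * u - 1)))"
  have K: "pathin T ?K" using assms by (intro pathin_join) auto
  have "path r" unfolding path_def r_def by (intro continuous_intros) auto
  then have "path_homotopic T (?K \<circ> (\<lambda>u. u)) (?K \<circ> r)"
    by (intro path_homotopic_reparam[OF K]) (auto simp: r_def path_def le_max_iff_disj)
  moreover have "path_homotopic T (?K \<circ> r) (loop_join f (loop_join g h))"
  proof (rule path_homotopic_eq)
    show "pathin T (?K \<circ> r)"
      using calculation path_homotopic_pathin by blast
    fix u :: real assume u: "u \<in> {0..1}"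
    consider "u \<le> 1/2" | "u > 1/2" "u \<le> 3/4" | "u > 3/4" by linarith
    then show "(?K \<circ> r) u = loop_join f (loop_join g h) u"
    proof cases
      case 1
      then have "r u = u / 2" by (auto simp: r_def)
      show ?thesis unfolding o_def \<open>r u = u / 2\<close> using 1 u by (auto simp: loop_join_def)
    next
      case 2
      then have "r u = u - 1/4" by (auto simp: r_def)
      show ?thesis unfolding o_def \<open>r u = u - 1/4\<close> using 2 u by (auto simp: loop_join_def algebra_simps)
    next
      case 3
      then have "r u = 2 * u - 1" by (auto simp: r_def max_def)
      show ?thesis unfolding o_def \<open>r u = 2 * u - 1\<close> using 3 u by (auto simp: loop_join_def algebra_simps)
    qed
  qed
  ultimately show ?thesis
    using path_homotopic_trans by (simp add: o_def) blast
qed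

lemma path_homotopic_join_const_left:
  assumes "pathin T f" "f 0 = b"
  shows "path_homotopic T (loop_join (\<lambda>u. b) f) f"
proof -
  have "path (\<lambda>u::real. max 0 (2 * u - 1))" unfolding path_def by (intro continuous_intros)
  then have "path_homotopic T (f \<circ> (\<lambda>u. max 0 (2 * u - 1))) (f \<circ> (\<lambda>u. u))"
    by (intro path_homotopic_reparam[OF assms(1)]) (auto simp: path_def)
  moreover have "path_homotopic T (f \<circ> (\<lambda>u. max 0 (2 * u - 1))) (loop_join (\<lambda>u. b) f)"
    using path_homotopic_pathin(1)[OF calculation] assms
    by (intro path_homotopic_eq) (auto simp: loop_join_def max_def dest!: half_unique)
  ultimately show ?thesis
    using path_homotopic_trans path_homotopic_sym by (simp add: o_def) blast
qed

lemma path_homotopic_join_const_right: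
  assumes "pathin T f" "f 1 = b"
  shows "path_homotopic T (loop_join f (\<lambda>u. b)) f"
proof -
  have "path (\<lambda>u::real. min 1 (2 * u))" unfolding path_def by (intro continuous_intros)
  then have "path_homotopic T (f \<circ> (\<lambda>u. min 1 (2 * u))) (f \<circ> (\<lambda>u. u))"
    by (intro path_homotopic_reparam[OF assms(1)]) (auto simp: path_def)
  moreover have "path_homotopic T (f \<circ> (\<lambda>u. min 1 (2 * u))) (loop_join f (\<lambda>u. b))"
    using path_homotopic_pathin(1)[OF calculation] assms
    by (intro path_homotopic_eq) (auto simp: loop_join_def min_def dest!: half_unique)
  ultimately show ?thesis
    using path_homotopic_trans path_homotopic_sym by (simp add: o_def) blast
qed

section \<open>Reversal, deformation over a square, pieces of a path\<close>

definition path_rev :: "(real \<Rightarrow> 'a) \<Rightarrow> real \<Rightarrow> 'a" where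
  "path_rev f = (\<lambda>u. f (1 - u))"

lemma path_rev_0 [simp]: "path_rev f 0 = f 1"
  and path_rev_1 [simp]: "path_rev f 1 = f 0"
  and path_rev_rev [simp]: "path_rev (path_rev f) = f"
  by (simp_all add: path_rev_def)

lemma pathin_rev: "pathin T f \<Longrightarrow> pathin T (path_rev f)"
  using pathin_compose_path[of "{0..1}" T f "\<lambda>u. 1 - u"]
  by (simp add: path_rev_def pathin_def path_def o_def continuous_intros)

lemma path_homotopic_rev:
  assumes "path_homotopic T f g"
  shows "path_homotopic T (path_rev f) (path_rev g)"
proof -
  obtain h where h: "continuous_map (top_of_set ({0..1::real} \<times> {0..1::real})) T h"
    "\<And>u. h (0, u) = f u" "\<And>u. h (1, u) = g u"
    "\<And>t. t \<in> {0..1} \<Longrightarrow> h (t, 0) = f 0" "\<And>t. t \<in> {0..1} \<Longrightarrow> h (t, 1) = f 1"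
    using path_homotopicE[OF assms(1)] by metis
  have "continuous_map (top_of_set ({0..1::real} \<times> {0..1::real})) T
     (\<lambda>x. h (fst x, 1 - snd x))"
    by (rule continuous_map_compose[OF _ h(1), unfolded o_def])
      (auto intro!: continuous_intros)
  then show ?thesis
    by (rule path_homotopicI) (use h in \<open>auto simp: path_rev_def\<close>)
qed

lemma path_homotopic_join_rev:
  assumes "pathin T f"
  shows "path_homotopic T (loop_join f (path_rev f)) (\<lambda>u. f 0)"
proof -
  \<comment> \<open>Going along \<open>f\<close> and back is \<open>f\<close> after a tent map, and
    the tent map contracts to 0 inside the unit interval.\<close>
  let ?a = "\<lambda>u::real. if u \<le> 1/2 then 2 * u else 2 - 2 * u"
  have a: "?a = (\<lambda>u. min (2 * u) (2 - 2 * u))" by (auto simp: min_def)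
  have "path ?a" unfolding path_def a by (intro continuous_intros)
  then have "path_homotopic T (f \<circ> ?a) (f \<circ> (\<lambda>u. 0))"
    by (intro path_homotopic_reparam[OF assms]) (auto simp: path_def)
  moreover have "f \<circ> ?a = loop_join f (path_rev f)"
    by (auto simp: loop_join_def path_rev_def fun_eq_iff algebra_simps)
  ultimately show ?thesis by (simp add: o_def)
qed

text \<open>This turns a homotopy with moving ends into a relation between paths: \<open>s\<close>
  is the parameter of the path, \<open>u\<close> that of the deformation, and both ways from one
  corner of the square to the opposite one are homotopic.\<close>

lemma path_homotopic_square:
  assumes K: "continuous_map (top_of_set ({0..1::real} \<times> {0..1::real})) T K"
  shows "path_homotopic T (loop_join (\<lambda>s. K (s, 0)) (\<lambda>u. K (1, u)))
                          (loop_join (\<lambda>u. K (0, u)) (\<lambda>s. K (s, 1)))"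
proof -
  let ?S = "{0..1::real} \<times> {0..1::real}"
  define a b where "a = (\<lambda>u::real. (min 1 (2 * u), max 0 (2 * u - 1)))"
    and "b = (\<lambda>u::real. (max 0 (2 * u - 1), min 1 (2 * u)))"
  have "path a" "path b" unfolding path_def a_def b_def by (intro continuous_intros)+
  then have *: "path_homotopic T (K \<circ> a) (K \<circ> b)"
    by (intro path_homotopic_convex[OF _ _ _ _ _ _ _ K]) (auto simp: a_def b_def convex_Times)
  have "path_homotopic T (K \<circ> a) (loop_join (\<lambda>s. K (s, 0)) (\<lambda>u. K (1, u)))"
    by (rule path_homotopic_eq[OF path_homotopic_pathin(1)[OF *]])
      (auto simp: loop_join_def a_def min_def max_def dest!: half_unique)
  moreover have "path_homotopic T (K \<circ> b) (loop_join (\<lambda>u. K (0, u)) (\<lambda>s. K (s, 1)))"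
    by (rule path_homotopic_eq[OF path_homotopic_pathin(2)[OF *]])
      (auto simp: loop_join_def b_def min_def max_def dest!: half_unique)
  ultimately show ?thesis
    using * path_homotopic_trans path_homotopic_sym by blast
qed

definition subpath_on :: "real \<Rightarrow> real \<Rightarrow> (real \<Rightarrow> 'a) \<Rightarrow> real \<Rightarrow> 'a" where
  "subpath_on r s f = (\<lambda>u. f (r + (s - r) * u))"

lemma subpath_on_ends [simp]: "subpath_on r s f 0 = f r" "subpath_on r s f 1 = f s"
  by (simp_all add: subpath_on_def)

lemma affine_in_unit:
  fixes r s u :: real
  assumes "r \<in> {0..1}" "s \<in> {0..1}" "u \<in> {0..1}"
  shows "r + (s - r) * u \<in> {0..1}"
  using convexD_alt[of "{0..1}" r s u] assms by (simp add: algebra_simps)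

lemma pathin_subpath_on:
  assumes "pathin T f" "r \<in> {0..1}" "s \<in> {0..1}"
  shows "pathin T (subpath_on r s f)"
proof -
  have "pathin T (f \<circ> (\<lambda>u. r + (s - r) * u))"
    by (rule pathin_compose_path[of "{0..1}"])
      (use assms affine_in_unit in \<open>auto simp: pathin_def path_def intro!: continuous_intros\<close>)
  then show ?thesis by (simp add: subpath_on_def o_def)
qed

lemma path_homotopic_subpath_join:
  assumes "pathin T f" "r \<in> {0..1}" "s \<in> {0..1}" "t \<in> {0..1}"
  shows "path_homotopic T (loop_join (subpath_on r s f) (subpath_on s t f)) (subpath_on r t f)"
proof -
  have *: "path_homotopic T (f \<circ> (linepath r s +++ linepath s t)) (f \<circ> linepath r t)"
  proof (rule path_homotopic_reparam[OF assms(1)])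
    have "linepath x y ` {0..1} \<subseteq> {0..1}" if "x \<in> {0..1}" "y \<in> {0..1}" for x y :: real
      using path_image_linepath[of x y] closed_segment_subset[of x "{0..1}" y] that
      by (auto simp: path_image_def)
    note * = this[OF assms(2,3)] this[OF assms(3,4)] this[OF assms(2,4)]
    show "linepath r t ` {0..1} \<subseteq> {0..1}" by (rule *)
    have "path_image (linepath r s +++ linepath s t) \<subseteq> {0..1}"
      by (rule subset_path_image_join) (simp_all only: path_image_def *)
    then show "(linepath r s +++ linepath s t) ` {0..1} \<subseteq> {0..1}" by (simp only: path_image_def)
    show "path (linepath r s +++ linepath s t)" "path (linepath r t)" by simp_all
  qed (auto simp: joinpaths_def linepath_def)
  have "f \<circ> (linepath r s +++ linepath s t) = loop_join (subpath_on r s f) (subpath_on s t f)"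
    "f \<circ> linepath r t = subpath_on r t f"
    by (auto simp: fun_eq_iff joinpaths_def linepath_def loop_join_def subpath_on_def algebra_simps)
  with * show ?thesis by simp
qed

subsection \<open>The fundamental group\<close>

lemma loop_class_eq:
  assumes "f \<in> loops T b"
  shows "loop_class T b f = {h. path_homotopic T f h}"
proof -
  have f: "f 0 = b" "f 1 = b" using assms by (auto simp: loops_def)
  have "h \<in> loops T b" if "path_homotopic T f h" for h
    using path_homotopic_pathin(2)[OF that] path_homotopic_ends[OF that] f by (simp add: loops_def)
  with f show ?thesis
    unfolding loop_class_def path_homotopic_def by auto
qed

lemma loop_class_eq_iff:
  assumes "f \<in> loops T b" "g \<in> loops T b"
  shows "loop_class T b f = loop_class T b g \<longleftrightarrow> path_homotopic T f g"
proof -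
  have "pathin T g" using assms by (simp add: loops_def)
  then show ?thesis
    unfolding loop_class_eq[OF assms(1)] loop_class_eq[OF assms(2)]
    by (metis (no_types, lifting) Collect_cong mem_Collect_eq path_homotopic_refl path_homotopic_sym
        path_homotopic_trans)
qed

lemma loops_join: "f \<in> loops T b \<Longrightarrow> g \<in> loops T b \<Longrightarrow> loop_join f g \<in> loops T b"
  by (auto simp: loops_def pathin_join)

lemma loops_rev: "f \<in> loops T b \<Longrightarrow> path_rev f \<in> loops T b"
  by (auto simp: loops_def pathin_rev)

lemma loops_const: "b \<in> topspace T \<Longrightarrow> (\<lambda>u. b) \<in> loops T b"
  by (auto simp: loops_def pathin_def)

text \<open>The product is defined as a union over all representatives. All of them contribute the
  same class, so the union collapses.\<close>

lemma fundamental_group_mult: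
  assumes "f \<in> loops T b" "g \<in> loops T b"
  shows "loop_class T b f \<otimes>\<^bsub>fundamental_group T b\<^esub> loop_class T b g = loop_class T b (loop_join f g)"
proof -
  have "loop_class T b (loop_join f' g') = loop_class T b (loop_join f g)"
    if "f' \<in> loop_class T b f" "g' \<in> loop_class T b g" for f' g'
  proof -
    have "path_homotopic T f f'" "path_homotopic T g g'"
      using that by (simp_all add: loop_class_eq assms)
    then have *: "path_homotopic T (loop_join f g) (loop_join f' g')"
      using assms by (intro path_homotopic_join) (auto simp: loops_def)
    have "f' \<in> loops T b" "g' \<in> loops T b"
      using that by (simp_all add: loop_class_def)
    then have "loop_class T b (loop_join f g) = loop_class T b (loop_join f' g')"
      using * by (simp add: loop_class_eq_iff loops_join assms)
    then show ?thesis ..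
  qed
  moreover have "f \<in> loop_class T b f" "g \<in> loop_class T b g"
    using assms by (simp_all add: loop_class_eq loops_def path_homotopic_refl)
  ultimately have "(\<Union>f' \<in> loop_class T b f. \<Union>g' \<in> loop_class T b g. loop_class T b (loop_join f' g'))
      = loop_class T b (loop_join f g)" by blast
  then show ?thesis by (simp add: fundamental_group_def)
qed

lemma fundamental_group_carrier: "carrier (fundamental_group T b) = loop_class T b ` loops T b"
  and fundamental_group_one: "\<one>\<^bsub>fundamental_group T b\<^esub> = loop_class T b (\<lambda>u. b)"
  by (simp_all add: fundamental_group_def)

lemma fundamental_group_rev:
  assumes "f \<in> loops T b"
  shows "loop_class T b (path_rev f) \<otimes>\<^bsub>fundamental_group T b\<^esub> loop_class T b f = \<one>\<^bsub>fundamental_group T b\<^esub>"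
proof -
  have f: "pathin T f" "f 0 = b" "f 1 = b" using assms by (auto simp: loops_def)
  have b: "b \<in> topspace T" using f path_start_in_topspace by blast
  have "path_homotopic T (loop_join (path_rev f) f) (\<lambda>u. b)"
    using path_homotopic_join_rev[OF pathin_rev[OF f(1)]] f by simp
  then show ?thesis
    using assms b by (simp add: fundamental_group_mult loops_rev fundamental_group_one
      loop_class_eq_iff loops_join loops_const)
qed

lemma fundamental_group_is_group:
  assumes b: "b \<in> topspace T"
  shows "group (fundamental_group T b)"
proof (rule groupI)
  let ?P = "fundamental_group T b"
  show "\<one>\<^bsub>?P\<^esub> \<in> carrier ?P"
    using loops_const[OF b] by (auto simp: fundamental_group_carrier fundamental_group_one)
  fix x y z assume "x \<in> carrier ?P" "y \<in> carrier ?P" "z \<in> carrier ?P"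
  then obtain f g h where f: "f \<in> loops T b" "x = loop_class T b f"
    and g: "g \<in> loops T b" "y = loop_class T b g" and h: "h \<in> loops T b" "z = loop_class T b h"
    by (auto simp: fundamental_group_carrier)
  show "x \<otimes>\<^bsub>?P\<^esub> y \<in> carrier ?P"
    using f g by (auto simp: fundamental_group_mult fundamental_group_carrier loops_join)
  have "path_homotopic T (loop_join (loop_join f g) h) (loop_join f (loop_join g h))"
    using f g h by (intro path_homotopic_join_assoc) (auto simp: loops_def)
  then show "x \<otimes>\<^bsub>?P\<^esub> y \<otimes>\<^bsub>?P\<^esub> z = x \<otimes>\<^bsub>?P\<^esub> (y \<otimes>\<^bsub>?P\<^esub> z)"
    using f g h by (simp add: fundamental_group_mult loops_join loop_class_eq_iff)
next
  let ?P = "fundamental_group T b"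
  fix x assume "x \<in> carrier ?P"
  then obtain f where f: "f \<in> loops T b" "x = loop_class T b f"
    by (auto simp: fundamental_group_carrier)
  have "path_homotopic T (loop_join (\<lambda>u. b) f) f"
    using f by (intro path_homotopic_join_const_left) (auto simp: loops_def)
  then show "\<one>\<^bsub>?P\<^esub> \<otimes>\<^bsub>?P\<^esub> x = x"
    using f b by (simp add: fundamental_group_mult fundamental_group_one loops_join loops_const
      loop_class_eq_iff)
  show "\<exists>y\<in>carrier ?P. y \<otimes>\<^bsub>?P\<^esub> x = \<one>\<^bsub>?P\<^esub>"
    using fundamental_group_rev[OF f(1)] f loops_rev[OF f(1)] by (auto simp: fundamental_group_carrier)
qed

section \<open>The realization of a simplicial set\<close>

text \<open>The summands are open, so their products with \<open>Z\<close> form an open cover to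
  which the pasting lemma applies. A homotopy on the disjoint union of all simplices can thus be
  checked on one simplex at a time.\<close>

lemma continuous_map_prod_sum:
  assumes "\<And>i. i \<in> J \<Longrightarrow> continuous_map (prod_topology Z (X i)) Y (\<lambda>(z, x). g (z, (i, x)))"
  shows "continuous_map (prod_topology Z (sum_topology X J)) Y g"
proof (rule pasting_lemma[where I = J and f = "\<lambda>i. g" and
      T = "\<lambda>i. topspace Z \<times> ({i} \<times> topspace (X i))"])
  fix i assume i: "i \<in> J"
  have open_summand: "openin (sum_topology X J) ({i} \<times> U)" if "openin (X i) U" for U
  proof -
    have "{x. (j, x) \<in> {i} \<times> U} = (if j = i then U else {})" for j by auto
    with i that openin_subset[OF that] show ?thesis by (auto simp: openin_sum_topology)
  qed
  then have *: "openin (sum_topology X J) ({i} \<times> topspace (X i))" by blast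
  show "openin (prod_topology Z (sum_topology X J)) (topspace Z \<times> ({i} \<times> topspace (X i)))"
    using * by (simp add: openin_prod_Times_iff)
  let ?S = "subtopology (prod_topology Z (sum_topology X J)) (topspace Z \<times> ({i} \<times> topspace (X i)))"
  have snd: "continuous_map (subtopology (sum_topology X J) ({i} \<times> topspace (X i))) (X i) snd"
    unfolding continuous_map_def
  proof (intro conjI allI impI)
    fix U assume U: "openin (X i) U"
    have "{p \<in> topspace (subtopology (sum_topology X J) ({i} \<times> topspace (X i))). snd p \<in> U}
        = ({i} \<times> U) \<inter> ({i} \<times> topspace (X i))"
      using i openin_subset[OF U] by auto
    with open_summand[OF U] show "openin (subtopology (sum_topology X J) ({i} \<times> topspace (X i)))
        {p \<in> topspace (subtopology (sum_topology X J) ({i} \<times> topspace (X i))). snd p \<in> U}"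
      by (simp add: openin_subtopology_Int)
  qed auto
  have "continuous_map ?S (prod_topology Z (X i)) (\<lambda>p. (fst p, snd (snd p)))"
  proof (rule continuous_map_pairedI)
    show "continuous_map ?S Z fst"
      by (intro continuous_map_from_subtopology continuous_map_fst)
    have "continuous_map ?S (subtopology (sum_topology X J) ({i} \<times> topspace (X i))) snd"
      by (simp add: continuous_map_in_subtopology continuous_map_from_subtopology continuous_map_snd)
        auto
    from continuous_map_compose[OF this snd] show "continuous_map ?S (X i) (\<lambda>p. snd (snd p))"
      by (simp add: o_def)
  qed
  from continuous_map_compose[OF this assms[OF i]]
  show "continuous_map ?S Y g"
    by (rule continuous_map_eq) auto
qed auto

abbreviation simplex_top :: "nat \<Rightarrow> (nat \<Rightarrow> real) topology" where
  "simplex_top n \<equiv> subtopology (powertop_real UNIV) (standard_simplex n)"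

subsection \<open>Monotone maps between standard simplices\<close>

lemma simplex_mapsD:
  assumes "\<theta> \<in> simplex_maps k n"
  shows "i \<le> k \<Longrightarrow> \<theta> i \<le> n" "i \<le> j \<Longrightarrow> j \<le> k \<Longrightarrow> \<theta> i \<le> \<theta> j"
  using assms by (auto simp: simplex_maps_def mono_on_def)

lemma simplex_maps_comp:
  "\<theta> \<in> simplex_maps k n \<Longrightarrow> \<eta> \<in> simplex_maps j k \<Longrightarrow> \<theta> \<circ> \<eta> \<in> simplex_maps j n"
  by (auto simp: simplex_maps_def mono_on_def image_subset_iff)

text \<open>Change of variables: \<open>simplex_push\<close> is the image of the measure
  \<open>t\<close> under \<theta>. Membership in the simplex, the masses of blocks and the exponent
  of the circle map are integrals of this form.\<close>

lemma sum_simplex_push: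
  assumes "\<And>i. i \<le> k \<Longrightarrow> \<theta> i \<le> n"
  shows "(\<Sum>j\<le>n. f j * simplex_push k \<theta> t j) = (\<Sum>i\<le>k. f (\<theta> i) * t i)"
proof -
  have "(\<Sum>j\<le>n. f j * simplex_push k \<theta> t j) = (\<Sum>j\<le>n. \<Sum>i | i \<in> {..k} \<and> \<theta> i = j. f (\<theta> i) * t i)"
    by (auto simp: simplex_push_def sum_distrib_left intro!: sum.cong)
  also have "\<dots> = (\<Sum>i\<le>k. f (\<theta> i) * t i)"
    by (rule sum.group) (use assms in auto)
  finally show ?thesis .
qed

lemma simplex_push_in:
  assumes "\<theta> \<in> simplex_maps k n" "t \<in> standard_simplex k"
  shows "simplex_push k \<theta> t \<in> standard_simplex n"
proof -
  have t: "\<And>i. 0 \<le> t i" "(\<Sum>i\<le>k. t i) = 1" using assms by (auto simp: standard_simplex_def)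
  have nonneg: "0 \<le> simplex_push k \<theta> t j" for j
    using t by (auto simp: simplex_push_def intro!: sum_nonneg)
  have 1: "(\<Sum>j\<le>n. simplex_push k \<theta> t j) = 1"
    using sum_simplex_push[of k \<theta> n "\<lambda>_. 1" t] simplex_mapsD[OF assms(1)] t by simp
  have 0: "simplex_push k \<theta> t j = 0" if "j > n" for j
    unfolding simplex_push_def
    by (rule sum.neutral) (use that simplex_mapsD(1)[OF assms(1)] in force)
  have "simplex_push k \<theta> t j \<le> 1" for j
    using member_le_sum[of j "{..n}" "simplex_push k \<theta> t"] nonneg 1 0[of j]
    by (cases "j \<le> n") auto
  with nonneg 0 1 show ?thesis by (auto simp: standard_simplex_def)
qed

lemma simplex_push_convex:
  "simplex_push k \<theta> (\<lambda>i. a * t i + b * t' i) = (\<lambda>j. a * simplex_push k \<theta> t j + b * simplex_push k \<theta> t' j)"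
  by (simp add: simplex_push_def sum.distrib sum_distrib_left)

definition vert :: "nat \<Rightarrow> nat \<Rightarrow> real" where
  "vert i = (\<lambda>j. if j = i then 1 else 0)"

lemma vert_in [simp]: "vert i \<in> standard_simplex n \<longleftrightarrow> i \<le> n"
  by (simp add: vert_def)

lemma simplex_push_vert:
  assumes "i \<le> k"
  shows "simplex_push k \<theta> (vert i) = vert (\<theta> i)"
proof
  fix j
  have "simplex_push k \<theta> (vert i) j = (\<Sum>l \<in> {l. l \<le> k \<and> \<theta> l = j}. if l = i then 1 else 0)"
    by (simp add: simplex_push_def vert_def)
  also have "\<dots> = vert (\<theta> i) j"
    using assms by (subst sum.delta) (auto simp: vert_def)
  finally show "simplex_push k \<theta> (vert i) j = vert (\<theta> i) j" .
qed

text \<open>A measure does not change under a map that fixes its support. This is applied to a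
  retraction onto a face that contains the point.\<close>

lemma simplex_push_supported:
  assumes "\<theta> \<in> simplex_maps k n" "t \<in> standard_simplex k"
    and "\<And>i. i \<le> k \<Longrightarrow> t i \<noteq> 0 \<Longrightarrow> \<theta> i = i"
  shows "simplex_push k \<theta> t = t"
proof
  fix j
  have "simplex_push k \<theta> t j = (\<Sum>i\<le>k. if \<theta> i = j then t i else 0)"
    by (simp add: simplex_push_def sum.inter_filter[symmetric])
  also have "\<dots> = (\<Sum>i\<le>k. if i = j then t i else 0)"
    by (rule sum.cong) (use assms(3) in force)+
  also have "\<dots> = t j"
    using assms(2) by (auto simp: sum.delta' standard_simplex_def)
  finally show "simplex_push k \<theta> t j = t j" .
qed

subsection \<open>Points\<close>

lemma real_point_self: "p \<in> real_point X p"
  by (simp add: real_point_def)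

lemma real_point_eq_iff: "real_point X p = real_point X q \<longleftrightarrow> (p, q) \<in> (glue X \<union> (glue X)\<inverse>)\<^sup>*"
proof
  assume "real_point X p = real_point X q"
  then show "(p, q) \<in> (glue X \<union> (glue X)\<inverse>)\<^sup>*" using real_point_self[of q X] by (auto simp: real_point_def)
next
  have sym: "sym ((glue X \<union> (glue X)\<inverse>)\<^sup>*)" by (rule sym_rtrancl) (auto simp: sym_def)
  assume *: "(p, q) \<in> (glue X \<union> (glue X)\<inverse>)\<^sup>*"
  then have "(q, p) \<in> (glue X \<union> (glue X)\<inverse>)\<^sup>*" using sym by (auto dest: symD)
  with * show "real_point X p = real_point X q"
    unfolding real_point_def by (auto intro: rtrancl_trans)
qed

lemma real_point_glue:
  assumes "\<theta> \<in> simplex_maps k n" "x \<in> simp X n" "t \<in> standard_simplex k"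
  shows "real_point X ((k, oper X k n \<theta> x), t) = real_point X ((n, x), simplex_push k \<theta> t)"
  unfolding real_point_eq_iff by (rule r_into_rtrancl) (use assms in \<open>auto simp: glue_def\<close>)

lemma real_point_induct:
  assumes "real_point X p = real_point X q"
    and "\<And>k n \<theta> x t. \<theta> \<in> simplex_maps k n \<Longrightarrow> x \<in> simp X n \<Longrightarrow> t \<in> standard_simplex k \<Longrightarrow>
      f ((k, oper X k n \<theta> x), t) = f ((n, x), simplex_push k \<theta> t)"
  shows "f p = f q"
  using assms(1) unfolding real_point_eq_iff
proof (induction rule: rtrancl_induct)
  case (step y z)
  then show ?case using assms(2) by (auto simp: glue_def)
qed simp

lemma topspace_cells: "topspace (cells X) = (SIGMA (n, x) : (SIGMA n : UNIV. simp X n). standard_simplex n)"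
  by (auto simp: cells_def split: prod.splits)

lemma in_topspace_cells [simp]:
  "((n, x), t) \<in> topspace (cells X) \<longleftrightarrow> x \<in> simp X n \<and> t \<in> standard_simplex n"
  by (auto simp: topspace_cells)

lemma openin_realization:
  "openin (realization X) U \<longleftrightarrow> U \<subseteq> real_point X ` topspace (cells X) \<and>
     openin (cells X) {p \<in> topspace (cells X). real_point X p \<in> U}"
proof -
  have "istopology (\<lambda>U. U \<subseteq> real_point X ` topspace (cells X) \<and>
     openin (cells X) {p \<in> topspace (cells X). real_point X p \<in> U})"
    unfolding istopology_def
  proof (intro conjI allI impI)
    fix S T assume "S \<subseteq> real_point X ` topspace (cells X) \<and>
       openin (cells X) {p \<in> topspace (cells X). real_point X p \<in> S}"
      "T \<subseteq> real_point X ` topspace (cells X) \<and>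
       openin (cells X) {p \<in> topspace (cells X). real_point X p \<in> T}"
    moreover have "{p \<in> topspace (cells X). real_point X p \<in> S \<inter> T} =
        {p \<in> topspace (cells X). real_point X p \<in> S} \<inter> {p \<in> topspace (cells X). real_point X p \<in> T}"
      by auto
    ultimately show "S \<inter> T \<subseteq> real_point X ` topspace (cells X)"
      "openin (cells X) {p \<in> topspace (cells X). real_point X p \<in> S \<inter> T}" by auto
  next
    fix K assume K: "\<forall>S\<in>K. S \<subseteq> real_point X ` topspace (cells X) \<and>
       openin (cells X) {p \<in> topspace (cells X). real_point X p \<in> S}"
    have "{p \<in> topspace (cells X). real_point X p \<in> \<Union> K} =
        \<Union> ((\<lambda>S. {p \<in> topspace (cells X). real_point X p \<in> S}) ` K)"
      by auto
    with K show "openin (cells X) {p \<in> topspace (cells X). real_point X p \<in> \<Union> K}" by auto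
    from K show "\<Union> K \<subseteq> real_point X ` topspace (cells X)" by auto
  qed
  then show ?thesis unfolding realization_def by simp
qed

lemma topspace_realization: "topspace (realization X) = real_point X ` topspace (cells X)"
proof
  show "topspace (realization X) \<subseteq> real_point X ` topspace (cells X)"
    using openin_topspace[of "realization X"] unfolding openin_realization by auto
  have "{p \<in> topspace (cells X). real_point X p \<in> real_point X ` topspace (cells X)} = topspace (cells X)"
    by auto
  then have "openin (realization X) (real_point X ` topspace (cells X))"
    unfolding openin_realization by simp
  then show "real_point X ` topspace (cells X) \<subseteq> topspace (realization X)"
    by (rule openin_subset)
qed

lemma quotient_map_real_point: "quotient_map (cells X) (realization X) (real_point X)"
  unfolding quotient_map_def by (auto simp: topspace_realization openin_realization)

lemma topspace_realizationE:
  assumes "P \<in> topspace (realization X)"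
  obtains n x t where "x \<in> simp X n" "t \<in> standard_simplex n" "P = real_point X ((n, x), t)"
  using assms by (auto simp: topspace_realization topspace_cells)

lemma continuous_map_cells:
  "continuous_map (cells X) Y f \<longleftrightarrow>
     (\<forall>n. \<forall>x \<in> simp X n. continuous_map (simplex_top n) Y (\<lambda>t. f ((n, x), t)))"
proof
  assume f: "continuous_map (cells X) Y f"
  show "\<forall>n. \<forall>x \<in> simp X n. continuous_map (simplex_top n) Y (\<lambda>t. f ((n, x), t))"
  proof (intro allI ballI)
    fix n x assume "x \<in> simp X n"
    then have "continuous_map (simplex_top n) (cells X) (Pair (n, x))"
      using continuous_map_component_injection[of "(n, x)" "Sigma UNIV (simp X)"
          "\<lambda>(n, x). simplex_top n"] by (simp add: cells_def)
    from continuous_map_compose[OF this f]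
    show "continuous_map (simplex_top n) Y (\<lambda>t. f ((n, x), t))" by (simp add: o_def)
  qed
next
  assume *: "\<forall>n. \<forall>x \<in> simp X n. continuous_map (simplex_top n) Y (\<lambda>t. f ((n, x), t))"
  show "continuous_map (cells X) Y f"
    unfolding continuous_map_def
  proof (intro conjI allI impI)
    show "f \<in> topspace (cells X) \<rightarrow> topspace Y"
      using * by (auto simp: topspace_cells continuous_map_def)
    fix U assume U: "openin Y U"
    show "openin (cells X) {p \<in> topspace (cells X). f p \<in> U}"
      unfolding cells_def openin_sum_topology
    proof (intro conjI ballI)
      fix i assume "i \<in> Sigma UNIV (simp X)"
      then obtain n x where i: "i = (n, x)" "x \<in> simp X n" by auto
      then have "openin (simplex_top n) {t \<in> topspace (simplex_top n). f ((n, x), t) \<in> U}"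
        using * U by (auto simp: continuous_map_def)
      also have "{t \<in> topspace (simplex_top n). f ((n, x), t) \<in> U} =
         {t. (i, t) \<in> {p \<in> topspace (cells X). f p \<in> U}}"
        using i by auto
      finally show "openin (case i of (n, x) \<Rightarrow> simplex_top n) {t. (i, t) \<in>
          {p \<in> topspace (sum_topology (\<lambda>(n, x). simplex_top n) (Sigma UNIV (simp X))). f p \<in> U}}"
        using i by (simp add: cells_def)
    qed auto
  qed
qed

lemma continuous_map_realization:
  assumes "\<And>n x. x \<in> simp X n \<Longrightarrow> continuous_map (simplex_top n) Y (\<lambda>t. g (real_point X ((n, x), t)))"
  shows "continuous_map (realization X) Y g"
  by (rule continuous_compose_quotient_map[OF quotient_map_real_point])
    (use assms in \<open>simp add: continuous_map_cells\<close>)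

lemma continuous_map_real_point:
  assumes "x \<in> simp X n"
  shows "continuous_map (simplex_top n) (realization X) (\<lambda>t. real_point X ((n, x), t))"
  using quotient_imp_continuous_map[OF quotient_map_real_point[of X]] assms
  unfolding continuous_map_cells by auto

text \<open>A product of quotient maps need not be a quotient map, but the product with the compact
  Hausdorff space [0,1] is one. Restricting to the saturated open set over \<open>U\<close> also
  preserves quotient maps. So continuity can be tested on the cells.\<close>

lemma continuous_map_realization_homotopy:
  assumes U: "openin (realization X) U"
    and g: "\<And>n x. x \<in> simp X n \<Longrightarrow>
      continuous_map (prod_topology (top_of_set {0..1::real})
          (subtopology (simplex_top n) {t. real_point X ((n, x), t) \<in> U})) Y
        (\<lambda>(u, t). g (u, real_point X ((n, x), t)))"
  shows "continuous_map (prod_topology (top_of_set {0..1}) (subtopology (realization X) U)) Y g"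
proof -
  define V where "V = {p \<in> topspace (cells X). real_point X p \<in> U}"
  define J where "J = Sigma UNIV (simp X)"
  define S where "S = (\<lambda>(n, x). {t. t \<in> standard_simplex n \<and> real_point X ((n, x), t) \<in> U})"
  have V: "V = Sigma J S"
    by (auto simp: V_def J_def S_def topspace_cells)
  have "quotient_map (subtopology (cells X) V) (subtopology (realization X) U) (real_point X)"
    unfolding V_def
    by (rule quotient_map_restriction[OF quotient_map_real_point refl]) (use U in auto)
  then have q: "quotient_map (prod_topology (top_of_set {0..1::real}) (subtopology (cells X) V))
      (prod_topology (top_of_set {0..1}) (subtopology (realization X) U))
      (\<lambda>(u, p). (u, real_point X p))"
    by (intro quotient_map_prod_right compact_imp_locally_compact_space)
      (auto simp: Hausdorff_space_subtopology compact_space_subtopology)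
  have "continuous_map (prod_topology (top_of_set {0..1::real}) (subtopology (cells X) V)) Y
     (g \<circ> (\<lambda>(u, p). (u, real_point X p)))"
    unfolding V cells_def J_def[symmetric] subtopology_sum_topology
  proof (rule continuous_map_prod_sum)
    fix i assume "i \<in> J"
    then obtain n x where i: "i = (n, x)" "x \<in> simp X n" by (auto simp: J_def)
    have "subtopology (simplex_top n) (S i) = subtopology (simplex_top n) {t. real_point X ((n, x), t) \<in> U}"
      using i subtopology_restrict[of "simplex_top n" "{t. real_point X ((n, x), t) \<in> U}"]
      by (simp add: S_def Int_def)
    then show "continuous_map (prod_topology (top_of_set {0..1})
       (subtopology (case i of (n, x) \<Rightarrow> simplex_top n) (S i))) Y
       (\<lambda>(z, x). (g \<circ> (\<lambda>(u, p). (u, real_point X p))) (z, i, x))"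
      using g[OF i(2)] i(1) by (simp add: case_prod_unfold)
  qed
  then show ?thesis by (rule continuous_compose_quotient_map[OF q])
qed

text \<open>The value type is arbitrary. Below, \<open>f\<close> has whole paths as values, so that
  a homotopy descends to the realization in one step.\<close>

lemma real_point_factor:
  assumes "\<And>k n \<theta> x t. \<theta> \<in> simplex_maps k n \<Longrightarrow> x \<in> simp X n \<Longrightarrow> t \<in> standard_simplex k \<Longrightarrow>
      f ((k, oper X k n \<theta> x), t) = f ((n, x), simplex_push k \<theta> t)"
  obtains g where "\<And>p. g (real_point X p) = f p"
proof
  fix p
  show "(\<lambda>P. f (SOME q. real_point X q = P)) (real_point X p) = f p"
    by (rule real_point_induct[where f = f and X = X]) (use someI[of "\<lambda>q. real_point X q = real_point X p" p] assms in auto)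
qed

subsection \<open>Straight paths\<close>

definition straight :: "(nat \<Rightarrow> real) \<Rightarrow> (nat \<Rightarrow> real) \<Rightarrow> real \<Rightarrow> nat \<Rightarrow> real" where
  "straight t t' u = (\<lambda>i. (1 - u) * t i + u * t' i)"

lemma straight_ends [simp]: "straight t t' 0 = t" "straight t t' 1 = t'"
  by (simp_all add: straight_def)

lemma straight_in:
  "t \<in> standard_simplex n \<Longrightarrow> t' \<in> standard_simplex n \<Longrightarrow> u \<in> {0..1} \<Longrightarrow> straight t t' u \<in> standard_simplex n"
  by (simp add: straight_def convex_standard_simplex)

lemma simplex_push_straight:
  "simplex_push k \<theta> (straight t t' u) = straight (simplex_push k \<theta> t) (simplex_push k \<theta> t') u"
  by (simp add: straight_def simplex_push_convex)

lemma continuous_map_simplex_coord: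
  "continuous_map (simplex_top n) euclideanreal (\<lambda>t. t i)"
  by (intro continuous_map_from_subtopology continuous_map_product_projection) simp

lemma continuous_map_into_simplex:
  assumes "\<And>i. continuous_map Z euclideanreal (\<lambda>z. f z i)" "\<And>z. z \<in> topspace Z \<Longrightarrow> f z \<in> standard_simplex n"
  shows "continuous_map Z (simplex_top n) f"
  using assms by (auto simp: continuous_map_in_subtopology continuous_map_componentwise_UNIV)

lemma continuous_map_straight:
  assumes "continuous_map Z (simplex_top n) f" "continuous_map Z (simplex_top n) g"
    and "continuous_map Z (top_of_set {0..1}) v"
  shows "continuous_map Z (simplex_top n) (\<lambda>z. straight (f z) (g z) (v z))"
proof (rule continuous_map_into_simplex)
  fix z assume "z \<in> topspace Z"
  then show "straight (f z) (g z) (v z) \<in> standard_simplex n"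
    using assms by (intro straight_in) (auto simp: continuous_map_def Pi_iff)
next
  fix i
  have "continuous_map Z euclideanreal (\<lambda>z. f z i)" "continuous_map Z euclideanreal (\<lambda>z. g z i)"
    using continuous_map_compose[OF assms(1) continuous_map_simplex_coord]
      continuous_map_compose[OF assms(2) continuous_map_simplex_coord] by (simp_all add: o_def)
  moreover have "continuous_map Z euclideanreal v"
    using assms(3) by (rule continuous_map_into_fulltopology)
  ultimately show "continuous_map Z euclideanreal (\<lambda>z. straight (f z) (g z) (v z) i)"
    unfolding straight_def by (intro continuous_intros)
qed

lemma pathin_straight:
  assumes "t \<in> standard_simplex n" "t' \<in> standard_simplex n"
  shows "pathin (simplex_top n) (straight t t')"
  using continuous_map_straight[of "top_of_set {0..1}" n "\<lambda>_. t" "\<lambda>_. t'" "\<lambda>u. u"] assms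
  unfolding pathin_def by simp

lemma path_homotopic_simplex:
  assumes "pathin (simplex_top n) a" "pathin (simplex_top n) b" "a 0 = b 0" "a 1 = b 1"
  shows "path_homotopic (simplex_top n) a b"
proof (rule path_homotopicI)
  have "continuous_map (top_of_set ({0..1::real} \<times> {0..1::real})) (simplex_top n) (\<lambda>p. c (snd p))"
    if "pathin (simplex_top n) c" for c
    by (rule continuous_map_compose[OF _ that[unfolded pathin_def], unfolded o_def])
      (auto intro!: continuous_intros)
  from continuous_map_straight[OF this[OF assms(1)] this[OF assms(2)], of fst]
  show "continuous_map (top_of_set ({0..1} \<times> {0..1})) (simplex_top n)
      (\<lambda>p. straight (a (snd p)) (b (snd p)) (fst p))"
    by (simp add: continuous_on_fst Pi_iff)
qed (use assms in \<open>auto simp: straight_def algebra_simps\<close>)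

definition seg :: "'s sset \<Rightarrow> nat \<Rightarrow> 's \<Rightarrow> (nat \<Rightarrow> real) \<Rightarrow> (nat \<Rightarrow> real) \<Rightarrow> real \<Rightarrow> 's cell_point set" where
  "seg X n x t t' = (\<lambda>u. real_point X ((n, x), straight t t' u))"

lemma seg_ends [simp]: "seg X n x t t' 0 = real_point X ((n, x), t)" "seg X n x t t' 1 = real_point X ((n, x), t')"
  by (simp_all add: seg_def)

lemma pathin_seg:
  assumes "x \<in> simp X n" "t \<in> standard_simplex n" "t' \<in> standard_simplex n"
  shows "pathin (realization X) (seg X n x t t')"
  using continuous_map_compose[OF pathin_straight[OF assms(2,3), unfolded pathin_def]
      continuous_map_real_point[OF assms(1)]] by (simp add: pathin_def seg_def o_def)

lemma seg_oper:
  assumes "\<theta> \<in> simplex_maps k n" "x \<in> simp X n" "t \<in> standard_simplex k" "t' \<in> standard_simplex k" "u \<in> {0..1}"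
  shows "seg X k (oper X k n \<theta> x) t t' u = seg X n x (simplex_push k \<theta> t) (simplex_push k \<theta> t') u"
  using assms by (simp add: seg_def real_point_glue straight_in simplex_push_straight)

lemma path_homotopic_seg_oper:
  assumes "\<theta> \<in> simplex_maps k n" "x \<in> simp X n" "oper X k n \<theta> x \<in> simp X k"
    "t \<in> standard_simplex k" "t' \<in> standard_simplex k"
  shows "path_homotopic (realization X) (seg X k (oper X k n \<theta> x) t t')
     (seg X n x (simplex_push k \<theta> t) (simplex_push k \<theta> t'))"
  using assms by (intro path_homotopic_eq pathin_seg seg_oper) auto

lemma path_homotopic_seg_join:
  assumes "x \<in> simp X n" "t \<in> standard_simplex n" "t' \<in> standard_simplex n" "t'' \<in> standard_simplex n"
  shows "path_homotopic (realization X) (loop_join (seg X n x t t') (seg X n x t' t'')) (seg X n x t t'')"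
proof -
  have "path_homotopic (simplex_top n) (loop_join (straight t t') (straight t' t'')) (straight t t'')"
    using assms by (intro path_homotopic_simplex pathin_join pathin_straight) auto
  from path_homotopic_compose[OF this continuous_map_real_point[OF assms(1)]]
  show ?thesis by (simp add: seg_def o_def loop_join_def if_distrib cong: if_cong)
qed

lemma path_rev_seg: "path_rev (seg X n x t t') = seg X n x t' t"
  by (auto simp: path_rev_def seg_def straight_def fun_eq_iff add.commute)

section \<open>Generation of the fundamental group by edges\<close>

lemma simplex_push_comp:
  assumes "\<And>i. i \<le> j \<Longrightarrow> \<eta> i \<le> k"
  shows "simplex_push k \<theta> (simplex_push j \<eta> t) = simplex_push j (\<theta> \<circ> \<eta>) t"
proof
  fix m
  have "simplex_push k \<theta> (simplex_push j \<eta> t) m = (\<Sum>i\<le>k. of_bool (\<theta> i = m) * simplex_push j \<eta> t i)"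
    unfolding simplex_push_def[of k]
    by (rule sum.mono_neutral_cong_left) auto
  also have "\<dots> = (\<Sum>i\<le>j. of_bool (\<theta> (\<eta> i) = m) * t i)"
    by (rule sum_simplex_push) (rule assms)
  also have "\<dots> = simplex_push j (\<theta> \<circ> \<eta>) t m"
    unfolding simplex_push_def[of j]
    by (rule sum.mono_neutral_cong_right) auto
  finally show "simplex_push k \<theta> (simplex_push j \<eta> t) m = simplex_push j (\<theta> \<circ> \<eta>) t m" .
qed

lemma path_homotopic_join_left:
  "path_homotopic T f f' \<Longrightarrow> pathin T g \<Longrightarrow> f 1 = g 0 \<Longrightarrow> path_homotopic T (loop_join f g) (loop_join f' g)"
  by (simp add: path_homotopic_join path_homotopic_refl)

lemma path_homotopic_join_right:
  "pathin T f \<Longrightarrow> path_homotopic T g g' \<Longrightarrow> f 1 = g 0 \<Longrightarrow> path_homotopic T (loop_join f g) (loop_join f g')"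
  by (simp add: path_homotopic_join path_homotopic_refl)

text \<open>Passing along \<open>g\<close> is traded for the detour through \<open>c\<close>,
  \<open>d\<close> and the reverse of \<open>c'\<close>: the square replaces \<open>c\<close>
  followed by \<open>d\<close>, and then \<open>c'\<close> cancels against its reverse.\<close>

lemma path_homotopic_square_transfer:
  assumes sq: "path_homotopic T (loop_join g c') (loop_join c d)"
    and paths: "pathin T f" "pathin T g" "pathin T c" "pathin T c'" "pathin T d"
    and ends: "f 1 = g 0" "g 1 = c' 0" "c 1 = d 0"
  shows "path_homotopic T (loop_join (loop_join (loop_join f c) d) (path_rev c')) (loop_join f g)"
proof -
  have c0: "c 0 = g 0" and d1: "d 1 = c' 1" using path_homotopic_ends[OF sq] by simp_all
  have "path_homotopic T (loop_join (loop_join f c) d) (loop_join f (loop_join c d))"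
    using paths ends c0 by (intro path_homotopic_join_assoc) auto
  also have "path_homotopic T (loop_join f (loop_join c d)) (loop_join f (loop_join g c'))"
    using paths ends c0 path_homotopic_sym[OF sq] by (intro path_homotopic_join_right) auto
  also have "path_homotopic T (loop_join f (loop_join g c')) (loop_join (loop_join f g) c')"
    using paths ends by (intro path_homotopic_sym[OF path_homotopic_join_assoc]) auto
  finally have "path_homotopic T (loop_join (loop_join (loop_join f c) d) (path_rev c'))
      (loop_join (loop_join (loop_join f g) c') (path_rev c'))"
    using paths d1 by (intro path_homotopic_join_left pathin_rev) auto
  also have "path_homotopic T \<dots> (loop_join (loop_join f g) (loop_join c' (path_rev c')))"
    using paths ends by (intro path_homotopic_join_assoc pathin_join pathin_rev) auto
  also have "path_homotopic T \<dots> (loop_join (loop_join f g) (\<lambda>u. c' 0))"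
    using paths ends by (intro path_homotopic_join_right pathin_join path_homotopic_join_rev) auto
  also have "path_homotopic T \<dots> (loop_join f g)"
    using paths ends by (intro path_homotopic_join_const_right pathin_join) auto
  finally show ?thesis .
qed

section \<open>Loops built from edges of a simplicial set with one vertex\<close>

inductive edge_loop :: "'s sset \<Rightarrow> 's \<Rightarrow> (real \<Rightarrow> 's cell_point set) \<Rightarrow> bool"
  for X :: "'s sset" and v :: 's where
  const: "edge_loop X v (\<lambda>u. real_vertex X v)"
| edge: "e \<in> simp X 1 \<Longrightarrow> edge_loop X v (real_edge X e)"
| edge_rev: "e \<in> simp X 1 \<Longrightarrow> edge_loop X v (path_rev (real_edge X e))"
| join: "edge_loop X v f \<Longrightarrow> edge_loop X v g \<Longrightarrow> edge_loop X v (loop_join f g)"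
| homotopic: "edge_loop X v f \<Longrightarrow> path_homotopic (realization X) f g \<Longrightarrow> edge_loop X v g"

lemma real_vertex_eq: "real_vertex X v = real_point X ((0, v), vert 0)"
  by (simp add: real_vertex_def vert_def)

lemma real_edge_eq: "real_edge X e = seg X 1 e (vert 0) (vert 1)"
  unfolding real_edge_def seg_def straight_def vert_def
  by (rule ext, rule arg_cong[where f = "real_point X"]) (auto simp: fun_eq_iff)

locale reduced_sset =
  fixes X :: "'s sset" and v :: 's
  assumes oper_closed: "\<theta> \<in> simplex_maps k n \<Longrightarrow> x \<in> simp X n \<Longrightarrow> oper X k n \<theta> x \<in> simp X k"
    and vertices: "simp X 0 = {v}"
begin

abbreviation "T \<equiv> realization X"
abbreviation "b \<equiv> real_vertex X v"

lemma vertex_point: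
  assumes "x \<in> simp X n" "i \<le> n"
  shows "real_point X ((n, x), vert i) = b"
proof -
  have \<theta>: "(\<lambda>_. i) \<in> simplex_maps 0 n" using assms by (auto simp: simplex_maps_def mono_on_def)
  then have "oper X 0 n (\<lambda>_. i) x = v" using oper_closed[OF \<theta> assms(1)] vertices by simp
  then show ?thesis
    using real_point_glue[OF \<theta> assms(1), of "vert 0"] by (simp add: simplex_push_vert real_vertex_eq)
qed

lemma base_in: "b \<in> topspace T"
  by (auto simp: real_vertex_eq topspace_realization vertices intro!: imageI)

lemma pathin_real_edge: "e \<in> simp X 1 \<Longrightarrow> real_edge X e \<in> loops T b"
  by (auto simp: real_edge_eq loops_def vertex_point intro!: pathin_seg)

lemma edge_loop_loops: "edge_loop X v f \<Longrightarrow> f \<in> loops T b"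
proof (induction rule: edge_loop.induct)
  case (homotopic f g)
  then show ?case
    using path_homotopic_pathin[of T f g] path_homotopic_ends[of T f g] by (auto simp: loops_def)
qed (auto simp: loops_const base_in pathin_real_edge loops_rev loops_join)

lemma edge_map:
  assumes "i \<le> j" "j \<le> n"
  shows "(\<lambda>l. if l = 0 then i else j) \<in> simplex_maps 1 n"
  using assms by (auto simp: simplex_maps_def mono_on_def)

lemma face_in:
  "x \<in> simp X n \<Longrightarrow> i \<le> j \<Longrightarrow> j \<le> n \<Longrightarrow> oper X 1 n (\<lambda>l. if l = 0 then i else j) x \<in> simp X 1"
  by (rule oper_closed[OF edge_map])

lemma path_homotopic_face:
  assumes "x \<in> simp X n" "i \<le> j" "j \<le> n"
  shows "path_homotopic T (real_edge X (oper X 1 n (\<lambda>l. if l = 0 then i else j) x)) (seg X n x (vert i) (vert j))"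
  using path_homotopic_seg_oper[OF edge_map[OF assms(2,3)] assms(1), of "vert 0" "vert 1"]
    oper_closed[OF edge_map[OF assms(2,3)] assms(1)]
  by (simp add: real_edge_eq simplex_push_vert)

lemma edge_loop_vert:
  assumes "x \<in> simp X n" "i \<le> n" "j \<le> n"
  shows "edge_loop X v (seg X n x (vert i) (vert j))"
proof (cases "i \<le> j")
  case True
  then show ?thesis
    using edge_loop.homotopic[OF edge_loop.edge[OF face_in[OF assms(1) True assms(3)]]
        path_homotopic_face[OF assms(1) True assms(3)]] by simp
next
  case False
  then have ji: "j \<le> i" by simp
  then have "path_homotopic T (path_rev (real_edge X (oper X 1 n (\<lambda>l. if l = 0 then j else i) x)))
      (seg X n x (vert i) (vert j))"
    using path_homotopic_rev[OF path_homotopic_face[of x n j i]] assms by (simp add: path_rev_seg)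
  then show ?thesis
    by (rule edge_loop.homotopic[OF edge_loop.edge_rev[OF face_in[OF assms(1) ji assms(2)]]])
qed

text \<open>All relations between classes of modules used later come from here: invariance under
  isomorphism and additivity are both read off from suitable 2-simplices.\<close>

lemma triangle_relation:
  assumes "x \<in> simp X 2"
  shows "path_homotopic T (loop_join (real_edge X (oper X 1 2 (\<lambda>l. if l = 0 then 0 else 1) x))
      (real_edge X (oper X 1 2 (\<lambda>l. if l = 0 then 1 else 2) x)))
     (real_edge X (oper X 1 2 (\<lambda>l. if l = 0 then 0 else 2) x))"
proof -
  have "path_homotopic T (loop_join (real_edge X (oper X 1 2 (\<lambda>l. if l = 0 then 0 else 1) x))
      (real_edge X (oper X 1 2 (\<lambda>l. if l = 0 then 1 else 2) x)))
     (loop_join (seg X 2 x (vert 0) (vert 1)) (seg X 2 x (vert 1) (vert 2)))"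
    using path_homotopic_face[OF assms, of 0 1] path_homotopic_face[OF assms, of 1 2]
      path_homotopic_ends(2)[OF path_homotopic_face[OF assms, of 0 1]]
      path_homotopic_ends(1)[OF path_homotopic_face[OF assms, of 1 2]]
    by (intro path_homotopic_join) auto
  also have "path_homotopic T \<dots> (seg X 2 x (vert 0) (vert 2))"
    using assms by (intro path_homotopic_seg_join) auto
  also have "path_homotopic T \<dots> (real_edge X (oper X 1 2 (\<lambda>l. if l = 0 then 0 else 2) x))"
    using path_homotopic_sym[OF path_homotopic_face[OF assms, of 0 2]] by simp
  finally show ?thesis .
qed

text \<open>The invariant that is carried along a loop: up to homotopy, \<open>f\<close> reaches the
  point by an edge loop and one straight path. The chosen vertex and the cell that represents the
  point turn out to be immaterial, so the invariant can pass from one simplex to another.\<close>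

definition edgelike :: "(real \<Rightarrow> 's cell_point set) \<Rightarrow> 's cell_point \<Rightarrow> bool" where
  "edgelike f = (\<lambda>((n, x), t). \<exists>l i. i \<le> n \<and> edge_loop X v l \<and>
     path_homotopic T f (loop_join l (seg X n x (vert i) t)))"

text \<open>Changing the vertex inserts the edge between the two vertices. It is itself a loop,
  because every vertex is the base point, and is absorbed into the edge loop.\<close>

lemma edgelike_any_vertex:
  assumes "edgelike f ((n, x), t)" "x \<in> simp X n" "t \<in> standard_simplex n" "j \<le> n"
  obtains l where "edge_loop X v l" "path_homotopic T f (loop_join l (seg X n x (vert j) t))"
proof -
  obtain l i where l: "i \<le> n" "edge_loop X v l" "path_homotopic T f (loop_join l (seg X n x (vert i) t))"
    using assms by (auto simp: edgelike_def)
  have ll: "pathin T l" "l 1 = b" using edge_loop_loops[OF l(2)] by (auto simp: loops_def)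
  let ?e = "seg X n x (vert i) (vert j)" and ?s = "seg X n x (vert j) t"
  have e: "edge_loop X v ?e" using assms l by (intro edge_loop_vert)
  have p: "pathin T ?e" "pathin T ?s" using assms l by (auto intro!: pathin_seg)
  note l(3)
  also have "path_homotopic T (loop_join l (seg X n x (vert i) t)) (loop_join l (loop_join ?e ?s))"
    using assms l ll by (intro path_homotopic_join_right path_homotopic_sym[OF path_homotopic_seg_join])
      (auto simp: vertex_point)
  also have "path_homotopic T \<dots> (loop_join (loop_join l ?e) ?s)"
    using assms l ll p by (intro path_homotopic_sym[OF path_homotopic_join_assoc]) (auto simp: vertex_point)
  finally show thesis using l(2) e by (intro that[of "loop_join l ?e"] edge_loop.join)
qed

lemma edgelike_homotopic:
  assumes "edgelike f p" "path_homotopic T f g"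
  shows "edgelike g p"
proof -
  have "path_homotopic T f l \<Longrightarrow> path_homotopic T g l" for l
    using path_homotopic_trans[OF path_homotopic_sym[OF assms(2)]] .
  with assms(1) show ?thesis unfolding edgelike_def by (auto split: prod.splits)
qed

text \<open>The operator \<theta> takes the straight path from vertex 0 to the straight path from
  vertex \<open>\<theta> 0\<close>. As the vertex may be chosen freely on either side, this pair of
  vertices is enough.\<close>

lemma edgelike_cong:
  assumes "real_point X p = real_point X q"
  shows "edgelike f p = edgelike f q"
  using assms
proof (rule real_point_induct)
  fix k n \<theta> x t
  assume *: "\<theta> \<in> simplex_maps k n" "x \<in> simp X n" "t \<in> standard_simplex k"
  let ?y = "oper X k n \<theta> x" and ?t = "simplex_push k \<theta> t"
  have y: "?y \<in> simp X k" and t: "?t \<in> standard_simplex n"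
    using * oper_closed simplex_push_in by auto
  have \<theta>0: "\<theta> 0 \<le> n" using simplex_mapsD[OF *(1)] by simp
  have eq: "path_homotopic T (loop_join l (seg X k ?y (vert 0) t)) (loop_join l (seg X n x (vert (\<theta> 0)) ?t))"
    if "edge_loop X v l" for l
    using path_homotopic_seg_oper[OF *(1,2) y, of "vert 0" t] * y edge_loop_loops[OF that]
    by (intro path_homotopic_join_right) (auto simp: loops_def vertex_point simplex_push_vert)
  show "edgelike f ((k, ?y), t) = edgelike f ((n, x), ?t)"
  proof
    assume "edgelike f ((k, ?y), t)"
    then obtain l where "edge_loop X v l" "path_homotopic T f (loop_join l (seg X k ?y (vert 0) t))"
      using edgelike_any_vertex[of f k ?y t 0] y * by auto
    then show "edgelike f ((n, x), ?t)"
      using eq \<theta>0 path_homotopic_trans unfolding edgelike_def by blast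
  next
    assume "edgelike f ((n, x), ?t)"
    then obtain l where "edge_loop X v l" "path_homotopic T f (loop_join l (seg X n x (vert (\<theta> 0)) ?t))"
      using edgelike_any_vertex[of f n x ?t "\<theta> 0"] * \<theta>0 t by auto
    then show "edgelike f ((k, ?y), t)"
      using eq path_homotopic_trans path_homotopic_sym unfolding edgelike_def by blast
  qed
qed

lemma edgelike_end:
  assumes "edgelike f ((n, x), t)"
  shows "pathin T f" "f 1 = real_point X ((n, x), t)"
proof -
  obtain l i where *: "path_homotopic T f (loop_join l (seg X n x (vert i) t))"
    using assms by (auto simp: edgelike_def)
  show "pathin T f" "f 1 = real_point X ((n, x), t)"
    using path_homotopic_pathin(1)[OF *] path_homotopic_ends(2)[OF *] by simp_all
qed

lemma edgelike_seg:
  assumes "edgelike f ((n, x), t)" "x \<in> simp X n" "t \<in> standard_simplex n" "t' \<in> standard_simplex n"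
  shows "edgelike (loop_join f (seg X n x t t')) ((n, x), t')"
proof -
  obtain l i where l: "i \<le> n" "edge_loop X v l" "path_homotopic T f (loop_join l (seg X n x (vert i) t))"
    using assms by (auto simp: edgelike_def)
  have ll: "pathin T l" "l 1 = b" using edge_loop_loops[OF l(2)] by (auto simp: loops_def)
  have p: "pathin T (seg X n x (vert i) t)" "pathin T (seg X n x t t')"
    using assms l by (auto intro!: pathin_seg)
  have "path_homotopic T (loop_join f (seg X n x t t'))
      (loop_join (loop_join l (seg X n x (vert i) t)) (seg X n x t t'))"
    using l p edgelike_end[OF assms(1)] by (intro path_homotopic_join_left) auto
  also have "path_homotopic T \<dots> (loop_join l (loop_join (seg X n x (vert i) t) (seg X n x t t')))"
    using ll p assms l by (intro path_homotopic_join_assoc) (auto simp: vertex_point)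
  also have "path_homotopic T \<dots> (loop_join l (seg X n x (vert i) t'))"
    using ll p assms l by (intro path_homotopic_join_right path_homotopic_seg_join)
      (auto simp: vertex_point)
  finally show ?thesis using l unfolding edgelike_def by auto
qed

lemma edgelike_loop:
  assumes "edgelike f ((0, v), vert 0)"
  shows "edge_loop X v f"
proof -
  obtain l where l: "edge_loop X v l" "path_homotopic T f (loop_join l (seg X 0 v (vert 0) (vert 0)))"
    using assms by (auto simp: edgelike_def)
  have "seg X 0 v (vert 0) (vert 0) = (\<lambda>u. b)"
    by (simp add: seg_def straight_def real_vertex_eq algebra_simps)
  then have "path_homotopic T (loop_join l (seg X 0 v (vert 0) (vert 0))) l"
    using edge_loop_loops[OF l(1)] by (simp add: path_homotopic_join_const_right loops_def)
  then show ?thesis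
    using l path_homotopic_sym path_homotopic_trans edge_loop.homotopic by meson
qed

end

text \<open>\<open>height n x i\<close> plays the role of the size of the edge from the vertex \<open>0\<close> to the vertex
  \<open>i\<close> of \<open>x\<close>; the cone adds an initial vertex to the simplices all of whose edges have size \<open>0\<close>,
  and is arbitrary (but natural) elsewhere.\<close>

locale graded_sset = reduced_sset X v
  for X :: "'s sset" and v :: 's +
  fixes height :: "nat \<Rightarrow> 's \<Rightarrow> nat \<Rightarrow> nat"
  assumes height_oper: "\<theta> \<in> simplex_maps k n \<Longrightarrow> x \<in> simp X n \<Longrightarrow> i \<le> k \<Longrightarrow>
      height k (oper X k n \<theta> x) i + height n x (\<theta> 0) = height n x (\<theta> i)"

locale conical_sset = graded_sset X v height
  for X :: "'s sset" and v :: 's and height :: "nat \<Rightarrow> 's \<Rightarrow> nat \<Rightarrow> nat" +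
  fixes cone :: "nat \<Rightarrow> 's \<Rightarrow> 's"
  assumes cone_closed: "x \<in> simp X n \<Longrightarrow> cone n x \<in> simp X (Suc n)"
    and cone_oper: "\<theta> \<in> simplex_maps k n \<Longrightarrow> x \<in> simp X n \<Longrightarrow>
      cone k (oper X k n \<theta> x) = oper X (Suc k) (Suc n) (case_nat 0 (Suc \<circ> \<theta>)) (cone n x)"
    and cone_base: "x \<in> simp X n \<Longrightarrow> (\<And>i. i \<le> n \<Longrightarrow> height n x i = 0) \<Longrightarrow>
      oper X n (Suc n) Suc (cone n x) = x"
begin

text \<open>The difference of two heights is the height of the edge between the vertices, a natural
  number. In particular the vertices of one height form an interval of indices.\<close>

lemma height_mono:
  assumes "x \<in> simp X n" "i \<le> j" "j \<le> n"
  shows "height n x i \<le> height n x j"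
  using height_oper[OF edge_map[OF assms(2,3)] assms(1), of 1] by simp

text \<open>The vertices of equal height form blocks. The simplex point \<open>t\<close> cuts \<open>[0, 1]\<close> into
  intervals, one for each block, with end points \<open>below t w\<close> and \<open>upto t w\<close>, and \<open>block a t\<close>
  is the projection of \<open>t\<close> to the face spanned by the block whose interval contains \<open>a\<close> in its
  interior.\<close>

definition below :: "nat \<Rightarrow> 's \<Rightarrow> (nat \<Rightarrow> real) \<Rightarrow> nat \<Rightarrow> real" where
  "below n x t w = (\<Sum>j\<le>n. of_bool (height n x j < w) * t j)"

definition upto :: "nat \<Rightarrow> 's \<Rightarrow> (nat \<Rightarrow> real) \<Rightarrow> nat \<Rightarrow> real" where
  "upto n x t w = (\<Sum>j\<le>n. of_bool (height n x j \<le> w) * t j)"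

definition weight :: "real \<Rightarrow> nat \<Rightarrow> 's \<Rightarrow> (nat \<Rightarrow> real) \<Rightarrow> nat \<Rightarrow> real" where
  "weight a n x t i = max 0 ((a - below n x t (height n x i)) * (upto n x t (height n x i) - a))"

definition mass :: "real \<Rightarrow> nat \<Rightarrow> 's \<Rightarrow> (nat \<Rightarrow> real) \<Rightarrow> real" where
  "mass a n x t = (\<Sum>i\<le>n. weight a n x t i * t i)"

definition block :: "real \<Rightarrow> nat \<Rightarrow> 's \<Rightarrow> (nat \<Rightarrow> real) \<Rightarrow> nat \<Rightarrow> real" where
  "block a n x t = (\<lambda>i. weight a n x t i * t i / mass a n x t)"

context
  fixes k n \<theta> x and t :: "nat \<Rightarrow> real" assumes \<theta>: "\<theta> \<in> simplex_maps k n" and x: "x \<in> simp X n"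
begin

text \<open>All heights change by the constant \<open>height n x (\<theta> 0)\<close>, so
  comparisons between them are the same before and after \<theta>. The cumulative masses are then
  compared by change of variables.\<close>

private lemma weight_oper:
  assumes "i \<le> k"
  shows "weight a k (oper X k n \<theta> x) t i = weight a n x (simplex_push k \<theta> t) (\<theta> i)"
proof -
  have "(height k (oper X k n \<theta> x) j < height k (oper X k n \<theta> x) i) = (height n x (\<theta> j) < height n x (\<theta> i))"
    "(height k (oper X k n \<theta> x) j \<le> height k (oper X k n \<theta> x) i) = (height n x (\<theta> j) \<le> height n x (\<theta> i))"
    if "j \<le> k" for j
    using height_oper[OF \<theta> x that] height_oper[OF \<theta> x assms] by linarith+
  moreover have "below n x (simplex_push k \<theta> t) w = (\<Sum>j\<le>k. of_bool (height n x (\<theta> j) < w) * t j)"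
    "upto n x (simplex_push k \<theta> t) w = (\<Sum>j\<le>k. of_bool (height n x (\<theta> j) \<le> w) * t j)" for w
    unfolding below_def upto_def by (intro sum_simplex_push simplex_mapsD(1)[OF \<theta>]; assumption)+
  ultimately have "below k (oper X k n \<theta> x) t (height k (oper X k n \<theta> x) i) =
      below n x (simplex_push k \<theta> t) (height n x (\<theta> i))"
    "upto k (oper X k n \<theta> x) t (height k (oper X k n \<theta> x) i) =
      upto n x (simplex_push k \<theta> t) (height n x (\<theta> i))"
    unfolding below_def[of k] upto_def[of k] by (auto intro!: sum.cong)
  then show ?thesis by (simp add: weight_def)
qed

lemma mass_oper: "mass a k (oper X k n \<theta> x) t = mass a n x (simplex_push k \<theta> t)"
  unfolding mass_def
  by (subst sum_simplex_push) (use simplex_mapsD[OF \<theta>] weight_oper in \<open>auto intro!: sum.cong\<close>)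

text \<open>All vertices in a fibre of \<theta> have the weight of their common image, so
  reweighting commutes with taking the image measure.\<close>

lemma simplex_push_block:
  "simplex_push k \<theta> (block a k (oper X k n \<theta> x) t) = block a n x (simplex_push k \<theta> t)"
proof
  fix j
  have "simplex_push k \<theta> (block a k (oper X k n \<theta> x) t) j =
     (\<Sum>i | i \<le> k \<and> \<theta> i = j. weight a n x (simplex_push k \<theta> t) j * t i / mass a n x (simplex_push k \<theta> t))"
    unfolding simplex_push_def[of k \<theta> "block a k (oper X k n \<theta> x) t"]
    by (rule sum.cong) (auto simp: block_def weight_oper mass_oper)
  also have "\<dots> = block a n x (simplex_push k \<theta> t) j"
    by (simp add: block_def simplex_push_def sum_distrib_left sum_divide_distrib)
  finally show "simplex_push k \<theta> (block a k (oper X k n \<theta> x) t) j = block a n x (simplex_push k \<theta> t) j" .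
qed

end

lemma below_le_upto:
  assumes "t \<in> standard_simplex n"
  shows "below n x t w \<le> upto n x t w" "w < w' \<Longrightarrow> upto n x t w \<le> below n x t w'"
  using assms unfolding below_def upto_def standard_simplex_def
  by (auto intro!: sum_mono2)

text \<open>The two factors cannot both be negative, because \<open>below\<close> never exceeds
  \<open>upto\<close>. So a positive product means that \<open>a\<close> is strictly inside the
  interval of the block.\<close>

lemma weight_pos:
  assumes "t \<in> standard_simplex n"
  shows "weight a n x t i \<noteq> 0 \<longleftrightarrow> below n x t (height n x i) < a \<and> a < upto n x t (height n x i)"
proof -
  have "weight a n x t i \<noteq> 0 \<longleftrightarrow> 0 < (a - below n x t (height n x i)) * (upto n x t (height n x i) - a)"
    by (auto simp: weight_def)
  then show ?thesis using below_le_upto(1)[OF assms, of x "height n x i"]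
    by (auto simp: zero_less_mult_iff)
qed

text \<open>The open intervals that belong to different heights are disjoint, so \<open>a\<close>
  lies in at most one of them.\<close>

lemma block_same_height:
  assumes "t \<in> standard_simplex n" "block a n x t i \<noteq> 0" "block a n x t j \<noteq> 0"
  shows "height n x i = height n x j"
proof -
  have *: "weight a n x t i \<noteq> 0" "weight a n x t j \<noteq> 0" using assms by (auto simp: block_def)
  show ?thesis
    using * below_le_upto(2)[OF assms(1), of "height n x i" "height n x j" x]
      below_le_upto(2)[OF assms(1), of "height n x j" "height n x i" x]
    unfolding weight_pos[OF assms(1)] by (cases "height n x i" "height n x j" rule: linorder_cases) auto
qed

lemma block_in:
  assumes t: "t \<in> standard_simplex n" and "mass a n x t > 0"
  shows "block a n x t \<in> standard_simplex n"
proof -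
  have nonneg: "0 \<le> block a n x t i" for i
    using assms by (auto simp: block_def weight_def standard_simplex_def)
  have 1: "(\<Sum>i\<le>n. block a n x t i) = 1"
    using assms unfolding block_def mass_def by (simp add: sum_divide_distrib[symmetric])
  have 0: "block a n x t i = 0" if "i > n" for i
    using that t by (auto simp: block_def standard_simplex_def)
  have "block a n x t i \<le> 1" for i
    using member_le_sum[of i "{..n}" "block a n x t"] nonneg 1 0[of i] by (cases "i \<le> n") auto
  with nonneg 0 1 show ?thesis by (auto simp: standard_simplex_def)
qed

text \<open>The interval of the lowest height that carries mass starts at 0 and has positive length;
  its midpoint serves as \<open>a\<close>.\<close>

lemma exists_mass:
  assumes t: "t \<in> standard_simplex n"
  obtains a where "mass a n x t > 0"
proof -
  have t0: "\<And>i. 0 \<le> t i" "sum t {..n} = 1" using t by (auto simp: standard_simplex_def)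
  then obtain i where "i \<le> n" "t i \<noteq> 0" by (metis atMost_iff sum.neutral zero_neq_one)
  define i0 where "i0 = arg_min (height n x) (\<lambda>i. i \<le> n \<and> t i \<noteq> 0)"
  have i0: "i0 \<le> n" "t i0 \<noteq> 0"
    using arg_min_natI[of "\<lambda>i. i \<le> n \<and> t i \<noteq> 0" i "height n x"] \<open>i \<le> n\<close> \<open>t i \<noteq> 0\<close> by (auto simp: i0_def)
  have min: "height n x i0 \<le> height n x j" if "j \<le> n" "t j \<noteq> 0" for j
    using that arg_min_nat_le[of "\<lambda>i. i \<le> n \<and> t i \<noteq> 0" j "height n x"] by (simp add: i0_def)
  have L: "below n x t (height n x i0) = 0"
    unfolding below_def by (rule sum.neutral) (use min in force)
  have "t i0 \<le> upto n x t (height n x i0)"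
    using member_le_sum[of i0 "{..n}" "\<lambda>j. of_bool (height n x j \<le> height n x i0) * t j"] i0 t0
    by (simp add: upto_def)
  then have M: "upto n x t (height n x i0) > 0" using i0 t0(1)[of i0] by linarith
  define a where "a = upto n x t (height n x i0) / 2"
  have "weight a n x t i0 \<noteq> 0" unfolding weight_pos[OF t] using L M by (simp add: a_def)
  then have "weight a n x t i0 > 0" by (auto simp: weight_def split: if_splits)
  then have "0 < weight a n x t i0 * t i0" using i0 t0(1)[of i0] by simp
  also have "\<dots> \<le> mass a n x t" unfolding mass_def
    by (rule member_le_sum) (use i0 t0 in \<open>auto simp: weight_def\<close>)
  finally show thesis by (rule that)
qed

lemma continuous_map_weight:
  "continuous_map (simplex_top n) euclideanreal (\<lambda>t. weight a n x t i)"
  unfolding weight_def below_def upto_def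
  by (intro continuous_intros continuous_map_real_max continuous_map_simplex_coord) auto

lemma continuous_map_mass: "continuous_map (simplex_top n) euclideanreal (mass a n x)"
  unfolding mass_def
  by (intro continuous_intros continuous_map_weight continuous_map_simplex_coord) auto

text \<open>The weight depends only on the height, so after normalization it leaves the conditional
  distribution of \<open>t\<close> on the block. Unlike the indicator of the block, the weight tends
  to 0 as \<open>a\<close> approaches an end of the interval; hence numerator and denominator are
  continuous.\<close>

lemma continuous_map_block:
  "continuous_map (subtopology (simplex_top n) {t. mass a n x t > 0}) (simplex_top n) (block a n x)"
proof (rule continuous_map_into_simplex)
  fix i
  show "continuous_map (subtopology (simplex_top n) {t. 0 < mass a n x t}) euclideanreal
      (\<lambda>t. block a n x t i)"
    unfolding block_def
    by (intro continuous_map_real_divide continuous_map_real_mult continuous_map_from_subtopology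
        continuous_map_weight continuous_map_simplex_coord continuous_map_mass) auto
qed (auto intro: block_in)

subsection \<open>Contractible open sets\<close>

lemma cone_map: "\<theta> \<in> simplex_maps k n \<Longrightarrow> case_nat 0 (Suc \<circ> \<theta>) \<in> simplex_maps (Suc k) (Suc n)"
  by (auto simp: simplex_maps_def mono_on_def image_subset_iff split: nat.splits)

lemma Suc_map: "Suc \<in> simplex_maps n (Suc n)"
  by (auto simp: simplex_maps_def mono_on_def)

lemma simplex_push_cone_map:
  assumes "\<theta> \<in> simplex_maps k n"
  shows "simplex_push (Suc k) (case_nat 0 (Suc \<circ> \<theta>)) (simplex_push k Suc t) = simplex_push n Suc (simplex_push k \<theta> t)"
proof -
  have "case_nat 0 (Suc \<circ> \<theta>) \<circ> Suc = Suc \<circ> \<theta>" by auto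
  then show ?thesis using simplex_mapsD[OF assms] by (simp add: simplex_push_comp)
qed

text \<open>The block point lies in a face all of whose edges have height 0, and over such a face
  the base of the cone is the face itself. Naturality transfers this to the cone over
  \<open>x\<close>, so the homotopy need not know which face is involved.\<close>

lemma cone_point:
  assumes x: "x \<in> simp X n" and t: "t \<in> standard_simplex n" and m: "mass a n x t > 0"
  shows "real_point X ((Suc n, cone n x), simplex_push n Suc (block a n x t)) = real_point X ((n, x), block a n x t)"
proof -
  let ?b = "block a n x t"
  have b: "?b \<in> standard_simplex n" using block_in[OF t m] .
  have "sum ?b {..n} = 1" using b by (auto simp: standard_simplex_def)
  then obtain i0 where i0: "i0 \<le> n" "?b i0 \<noteq> 0" by (metis atMost_iff sum.neutral zero_neq_one)
  define B where "B = {i. i \<le> n \<and> height n x i = height n x i0}"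
  have B: "finite B" "i0 \<in> B" using i0 by (auto simp: B_def)
  \<comment> \<open>\<open>B\<close> is an interval of indices, and clamping to its end points is a
    monotone retraction onto the face it spans. As a self-map of the same simplex it lets this face
    be treated as an \<open>n\<close>-simplex without renumbering.\<close>
  define \<rho> where "\<rho> = (\<lambda>i. max (Min B) (min i (Max B)))"
  have MB: "Min B \<in> B" "Max B \<in> B" "Min B \<le> Max B"
  proof -
    have "B \<noteq> {}" using B by auto
    then show "Min B \<in> B" "Max B \<in> B" using B by simp_all
    then show "Min B \<le> Max B" using B by simp
  qed
  have "i \<le> n \<and> height n x i = height n x i0" if "i \<in> B" for i using that by (simp add: B_def)
  note MB' = this[OF MB(1)] this[OF MB(2)]
  have \<rho>: "\<rho> \<in> simplex_maps n n"
    using MB' by (auto simp: \<rho>_def simplex_maps_def mono_on_def)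
  have h: "height n x (\<rho> i) = height n x i0" if "i \<le> n" for i
  proof -
    have "Min B \<le> \<rho> i" "\<rho> i \<le> Max B" "\<rho> i \<le> n" using MB(3) MB' by (auto simp: \<rho>_def)
    then have "height n x (Min B) \<le> height n x (\<rho> i)" "height n x (\<rho> i) \<le> height n x (Max B)"
      using height_mono[OF x, of "Min B" "\<rho> i"] height_mono[OF x, of "\<rho> i" "Max B"] MB' by simp_all
    then show ?thesis using MB' by simp
  qed
  have fixed: "\<rho> i = i" if "i \<le> n" "?b i \<noteq> 0" for i
  proof -
    have "i \<in> B" using that(1) block_same_height[OF t that(2) i0(2)] by (simp add: B_def)
    then have "Min B \<le> i" "i \<le> Max B" using B by auto
    then show ?thesis by (simp add: \<rho>_def)
  qed
  have push: "simplex_push n \<rho> ?b = ?b" by (rule simplex_push_supported[OF \<rho> b fixed])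
  let ?y = "oper X n n \<rho> x"
  have y: "?y \<in> simp X n" using oper_closed[OF \<rho> x] .
  have "height n ?y i = 0" if "i \<le> n" for i
    using height_oper[OF \<rho> x that] h[OF that] h[of 0] by simp
  then have y_eq: "oper X n (Suc n) Suc (cone n ?y) = ?y" by (intro cone_base[OF y])
  have "real_point X ((n, x), ?b) = real_point X ((n, ?y), ?b)"
    using real_point_glue[OF \<rho> x b] push by simp
  also have "\<dots> = real_point X ((Suc n, cone n ?y), simplex_push n Suc ?b)"
    using real_point_glue[OF Suc_map cone_closed[OF y] b] y_eq by simp
  also have "\<dots> = real_point X ((Suc n, cone n x), simplex_push n Suc ?b)"
    unfolding cone_oper[OF \<rho> x]
    using real_point_glue[OF cone_map[OF \<rho>] cone_closed[OF x] simplex_push_in[OF Suc_map b]]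
      simplex_push_cone_map[OF \<rho>] push by simp
  finally show ?thesis ..
qed

definition massive :: "real \<Rightarrow> 's cell_point set set" where
  "massive a = real_point X ` {((n, x), t) | n x t. x \<in> simp X n \<and> t \<in> standard_simplex n \<and> mass a n x t > 0}"

lemma in_massive:
  assumes "x \<in> simp X n" "t \<in> standard_simplex n"
  shows "real_point X ((n, x), t) \<in> massive a \<longleftrightarrow> mass a n x t > 0"
proof
  assume "real_point X ((n, x), t) \<in> massive a"
  then obtain m y s where *: "real_point X ((m, y), s) = real_point X ((n, x), t)" "mass a m y s > 0"
    by (auto simp: massive_def)
  have "(\<lambda>((n, x), t). mass a n x t) ((m, y), s) = (\<lambda>((n, x), t). mass a n x t) ((n, x), t)"
    by (rule real_point_induct[OF *(1)]) (simp add: mass_oper)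
  with * show "mass a n x t > 0" by simp
qed (use assms in \<open>auto simp: massive_def intro!: imageI\<close>)

lemma openin_massive: "openin T (massive a)"
  unfolding openin_realization
proof
  show sub: "massive a \<subseteq> real_point X ` topspace (cells X)" by (auto simp: massive_def intro!: imageI)
  have "continuous_map (cells X) euclideanreal (\<lambda>((n, x), t). mass a n x t)"
    by (simp add: continuous_map_cells continuous_map_mass)
  then have "openin (cells X) {p \<in> topspace (cells X). (\<lambda>((n, x), t). mass a n x t) p \<in> {0<..}}"
    by (rule openin_continuous_map_preimage) auto
  also have "{p \<in> topspace (cells X). (\<lambda>((n, x), t). mass a n x t) p \<in> {0<..}} =
      {p \<in> topspace (cells X). real_point X p \<in> massive a}"
    by (auto simp: topspace_cells in_massive)
  finally show "openin (cells X) {p \<in> topspace (cells X). real_point X p \<in> massive a}" .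
qed

lemma massive_slice:
  assumes "x \<in> simp X n"
  shows "subtopology (simplex_top n) {t. real_point X ((n, x), t) \<in> massive a} =
     subtopology (simplex_top n) {t. mass a n x t > 0}"
proof -
  have "standard_simplex n \<inter> {t. real_point X ((n, x), t) \<in> massive a} = standard_simplex n \<inter> {t. mass a n x t > 0}"
    using assms by (auto simp: in_massive)
  then show ?thesis by (simp add: subtopology_subtopology)
qed

text \<open>The straight paths may run in another simplex \<open>y n x\<close> than the one that
  represents the point. Two cases are used: \<open>x\<close> itself, and the cone over
  \<open>x\<close>.\<close>

lemma continuous_map_massive_homotopy:
  assumes f: "\<And>n x t u. x \<in> simp X n \<Longrightarrow> t \<in> standard_simplex n \<Longrightarrow> mass a n x t > 0 \<Longrightarrow> u \<in> {0..1} \<Longrightarrow>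
      g (real_point X ((n, x), t)) u = real_point X ((m n, y n x), straight (p n x t) (q n x t) u)"
    and y: "\<And>n x. x \<in> simp X n \<Longrightarrow> y n x \<in> simp X (m n)"
    and p: "\<And>n x. x \<in> simp X n \<Longrightarrow>
      continuous_map (subtopology (simplex_top n) {t. mass a n x t > 0}) (simplex_top (m n)) (p n x)"
    and q: "\<And>n x. x \<in> simp X n \<Longrightarrow>
      continuous_map (subtopology (simplex_top n) {t. mass a n x t > 0}) (simplex_top (m n)) (q n x)"
  shows "continuous_map (prod_topology (top_of_set {0..1}) (subtopology T (massive a))) T (\<lambda>(u, P). g P u)"
proof (rule continuous_map_realization_homotopy[OF openin_massive])
  fix n x assume x: "x \<in> simp X n"
  let ?S = "subtopology (simplex_top n) {t. mass a n x t > 0}"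
  let ?Z = "prod_topology (top_of_set {0..1::real}) ?S"
  have "continuous_map ?Z (simplex_top (m n)) (\<lambda>z. straight (p n x (snd z)) (q n x (snd z)) (fst z))"
    by (intro continuous_map_straight continuous_map_compose[OF continuous_map_snd p[OF x], unfolded o_def]
        continuous_map_compose[OF continuous_map_snd q[OF x], unfolded o_def] continuous_map_fst)
  from continuous_map_compose[OF this continuous_map_real_point[OF y[OF x]]]
  have "continuous_map ?Z T (\<lambda>z. real_point X ((m n, y n x), straight (p n x (snd z)) (q n x (snd z)) (fst z)))"
    by (simp add: o_def)
  then have "continuous_map ?Z T (\<lambda>(u, t). g (real_point X ((n, x), t)) u)"
    by (rule continuous_map_eq) (use x f in auto)
  then show "continuous_map (prod_topology (top_of_set {0..1})
      (subtopology (simplex_top n) {t. real_point X ((n, x), t) \<in> massive a})) T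
      (\<lambda>(u, t). case (u, real_point X ((n, x), t)) of (u, P) \<Rightarrow> g P u)"
    by (simp add: massive_slice[OF x] case_prod_unfold)
qed

text \<open>Supplies the square to which \<open>path_homotopic_square\<close> is applied: the
  homotopy restricted to the points of \<open>c\<close>.\<close>

lemma continuous_map_along_path:
  assumes "continuous_map (prod_topology (top_of_set {0..1}) (subtopology T U)) T (\<lambda>(u, P). g P u)"
    and "pathin T c" "c ` {0..1} \<subseteq> U"
  shows "continuous_map (top_of_set ({0..1::real} \<times> {0..1::real})) T (\<lambda>(s, u). g (c s) u)"
proof -
  have c: "continuous_map (top_of_set {0..1}) (subtopology T U) c"
    using assms by (auto simp: pathin_def continuous_map_in_subtopology)
  have "continuous_map (prod_topology (top_of_set {0..1::real}) (top_of_set {0..1::real}))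
     (prod_topology (top_of_set {0..1}) (subtopology T U)) (\<lambda>z. (snd z, c (fst z)))"
    by (intro continuous_map_pairedI continuous_map_snd
        continuous_map_compose[OF continuous_map_fst c, unfolded o_def])
  from continuous_map_compose[OF this assms(1)] show ?thesis
    by (simp add: o_def case_prod_unfold)
qed

text \<open>The path \<open>c\<close> sweeps out two squares. The first ends in the path
  \<open>d\<close> of block points; the second leads from \<open>d\<close> to the apices, where it
  is constant at the base point. So \<open>c\<close> is homotopic to a detour: straight down to the
  apex from its start, then straight up again to its end. Each leg of the detour stays in one
  simplex and keeps the path \<open>edgelike\<close>.\<close>

lemma edgelike_massive_path:
  assumes c: "pathin T c" "c ` {0..1} \<subseteq> massive a"
    and x: "x \<in> simp X n" "t \<in> standard_simplex n" "c 0 = real_point X ((n, x), t)"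
    and y: "y \<in> simp X m" "s \<in> standard_simplex m" "c 1 = real_point X ((m, y), s)"
    and f: "edgelike f ((n, x), t)"
  shows "edgelike (loop_join f c) ((m, y), s)"
proof -
  define f1 where "f1 = (\<lambda>((n, x), t) u. if mass a n x t > 0
     then real_point X ((n, x), straight t (block a n x t) u) else undefined)"
  have "f1 ((k, oper X k n \<theta> x), t) u = f1 ((n, x), simplex_push k \<theta> t) u"
    if u: "u \<in> {0..1}" and *: "\<theta> \<in> simplex_maps k n" "x \<in> simp X n" "t \<in> standard_simplex k" for k n \<theta> x t u
    using real_point_glue[OF *(1,2) straight_in[OF *(3) block_in[OF *(3)] u], of a "oper X k n \<theta> x"]
    by (simp add: f1_def mass_oper[OF *(1,2)] simplex_push_straight simplex_push_block[OF *(1,2)])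
  \<comment> \<open>A straight path is compatible with gluing only while it stays in the simplex,
    that is for parameters in the unit interval. So the paths are cut off there before they are
    passed to the quotient.\<close>
  then have inv: "restrict (f1 ((k, oper X k n \<theta> x), t)) {0..1} = restrict (f1 ((n, x), simplex_push k \<theta> t)) {0..1}"
    if "\<theta> \<in> simplex_maps k n" "x \<in> simp X n" "t \<in> standard_simplex k" for k n \<theta> x t
    using that by (intro restrict_ext)
  have "\<exists>g. \<forall>p. g (real_point X p) = restrict (f1 p) {0..1}"
  proof (rule real_point_factor[of X "\<lambda>p. restrict (f1 p) {0..1}", OF inv])
    fix g assume "\<And>p. g (real_point X p) = restrict (f1 p) {0..1}"
    then show "\<exists>g. \<forall>p. g (real_point X p) = restrict (f1 p) {0..1}" by (intro exI[of _ g] allI)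
  qed
  then obtain g1 where "\<forall>p. g1 (real_point X p) = restrict (f1 p) {0..1}" ..
  note g1 = this[rule_format]
  define f2 where "f2 = (\<lambda>((n, x), t) u. if mass a n x t > 0
     then real_point X ((Suc n, cone n x), straight (simplex_push n Suc (block a n x t)) (vert 0) u) else undefined)"
  have "f2 ((k, oper X k n \<theta> x), t) u = f2 ((n, x), simplex_push k \<theta> t) u"
    if u: "u \<in> {0..1}" and *: "\<theta> \<in> simplex_maps k n" "x \<in> simp X n" "t \<in> standard_simplex k" for k n \<theta> x t u
  proof (cases "mass a n x (simplex_push k \<theta> t) > 0")
    case True
    let ?b = "block a k (oper X k n \<theta> x) t"
    have "?b \<in> standard_simplex k"
      by (rule block_in[OF *(3)]) (simp add: mass_oper[OF *(1,2)] True)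
    then have "straight (simplex_push k Suc ?b) (vert 0) u \<in> standard_simplex (Suc k)"
      by (intro straight_in simplex_push_in[OF Suc_map] u) auto
    from real_point_glue[OF cone_map[OF *(1)] cone_closed[OF *(2)] this]
    show ?thesis
      by (simp add: f2_def True mass_oper[OF *(1,2)] simplex_push_straight simplex_push_block[OF *(1,2)]
          cone_oper[OF *(1,2)] simplex_push_cone_map[OF *(1)] simplex_push_vert)
  qed (simp add: f2_def mass_oper[OF *(1,2)])
  then have inv: "restrict (f2 ((k, oper X k n \<theta> x), t)) {0..1} = restrict (f2 ((n, x), simplex_push k \<theta> t)) {0..1}"
    if "\<theta> \<in> simplex_maps k n" "x \<in> simp X n" "t \<in> standard_simplex k" for k n \<theta> x t
    using that by (intro restrict_ext)
  have "\<exists>g. \<forall>p. g (real_point X p) = restrict (f2 p) {0..1}"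
  proof (rule real_point_factor[of X "\<lambda>p. restrict (f2 p) {0..1}", OF inv])
    fix g assume "\<And>p. g (real_point X p) = restrict (f2 p) {0..1}"
    then show "\<exists>g. \<forall>p. g (real_point X p) = restrict (f2 p) {0..1}" by (intro exI[of _ g] allI)
  qed
  then obtain g2 where "\<forall>p. g2 (real_point X p) = restrict (f2 p) {0..1}" ..
  note g2 = this[rule_format]
  have f1c: "continuous_map (prod_topology (top_of_set {0..1}) (subtopology T (massive a))) T (\<lambda>(u, P). g1 P u)"
    by (rule continuous_map_massive_homotopy[where m = "\<lambda>n. n" and y = "\<lambda>n x. x" and p = "\<lambda>n x t. t"
          and q = "block a"])
      (auto simp: g1 f1_def continuous_map_block continuous_map_from_subtopology)
  have f2c: "continuous_map (prod_topology (top_of_set {0..1}) (subtopology T (massive a))) T (\<lambda>(u, P). g2 P u)"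
  proof (rule continuous_map_massive_homotopy[where m = Suc and y = cone and
        p = "\<lambda>n x t. simplex_push n Suc (block a n x t)" and q = "\<lambda>n x t. vert 0"])
    fix n x assume "x \<in> simp X n"
    show "continuous_map (subtopology (simplex_top n) {t. 0 < mass a n x t}) (simplex_top (Suc n))
        (\<lambda>t. simplex_push n Suc (block a n x t))"
    proof (rule continuous_map_into_simplex)
      fix i
      show "continuous_map (subtopology (simplex_top n) {t. 0 < mass a n x t}) euclideanreal
          (\<lambda>t. simplex_push n Suc (block a n x t) i)"
        unfolding simplex_push_def
        by (intro continuous_map_sum continuous_map_compose[OF continuous_map_block continuous_map_simplex_coord, unfolded o_def])
          auto
    qed (auto intro!: simplex_push_in[OF Suc_map] block_in)
  qed (auto simp: g2 f2_def cone_closed)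
  have mx: "mass a n x t > 0" and my: "mass a m y s > 0"
    using c(2) x y by (auto simp: in_massive[symmetric] simp flip: x(3) y(3))
  let ?bx = "block a n x t" and ?by = "block a m y s"
  let ?cx = "simplex_push n Suc ?bx" and ?cy = "simplex_push m Suc ?by"
  let ?S = "seg X n x t ?bx" and ?S' = "seg X m y s ?by"
  let ?C = "seg X (Suc n) (cone n x) ?cx (vert 0)" and ?C' = "seg X (Suc m) (cone m y) ?cy (vert 0)"
  have bx: "?bx \<in> standard_simplex n" "?cx \<in> standard_simplex (Suc n)"
    and bys: "?by \<in> standard_simplex m" "?cy \<in> standard_simplex (Suc m)"
    using block_in[OF x(2) mx] block_in[OF y(2) my] simplex_push_in[OF Suc_map] by auto
  define d where "d = (\<lambda>r. g1 (c r) 1)"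
  have cm: "c r \<in> massive a" if "r \<in> {0..1}" for r using c that by auto
  have d: "g2 (c r) 0 = d r" "g2 (c r) 1 = b" "g1 (c r) 0 = c r" if r: "r \<in> {0..1}" for r
  proof -
    obtain n x t where *: "x \<in> simp X n" "t \<in> standard_simplex n" "mass a n x t > 0" "c r = real_point X ((n, x), t)"
      using cm[OF r] by (auto simp: massive_def)
    then show "g2 (c r) 0 = d r" "g1 (c r) 0 = c r" "g2 (c r) 1 = b"
      by (auto simp: d_def g1 g2 f1_def f2_def cone_point vertex_point cone_closed)
  qed
  have d0: "d 0 = real_point X ((n, x), ?bx)" and d1: "d 1 = real_point X ((m, y), ?by)"
    using mx my by (simp_all add: d_def x y g1 f1_def)
  note K1 = continuous_map_along_path[OF f1c c]
  note K2 = continuous_map_along_path[OF f2c c]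
  have seg1: "path_homotopic T (\<lambda>u. g1 (c 0) u) ?S" "path_homotopic T (\<lambda>u. g1 (c 1) u) ?S'"
    using x y mx my bx bys
    by (intro path_homotopic_sym[OF path_homotopic_eq] pathin_seg; auto simp: g1 f1_def seg_def)+
  have seg2: "path_homotopic T (\<lambda>u. g2 (c 0) u) ?C"
    "path_homotopic T (\<lambda>u. g2 (c 1) u) ?C'"
    using x y mx my bx bys
    by (intro path_homotopic_sym[OF path_homotopic_eq] pathin_seg; auto simp: g2 f2_def seg_def cone_closed)+
  have slice: "pathin T (\<lambda>r. K (r, u))" if "continuous_map (top_of_set ({0..1::real} \<times> {0..1::real})) T K" "u \<in> {0..1}"
    for K and u :: real
  proof -
    have "continuous_on {0..1::real} (\<lambda>r. (r, u))" by (intro continuous_intros)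
    then have "continuous_map (top_of_set {0..1}) (top_of_set ({0..1} \<times> {0..1})) (\<lambda>r::real. (r, u))"
      using that(2) by auto
    from continuous_map_compose[OF this that(1)] show ?thesis by (simp add: pathin_def o_def)
  qed
  have pd: "pathin T d" using slice[OF K1, of 1] by (simp add: d_def)
  have c_eq: "path_homotopic T (\<lambda>r. g1 (c r) 0) c"
    using d(3) by (intro path_homotopic_sym[OF path_homotopic_eq[OF c(1)]]) auto
  have d_eq: "path_homotopic T (\<lambda>r. g2 (c r) 0) d"
    using d(1) by (intro path_homotopic_sym[OF path_homotopic_eq[OF pd]]) auto
  have b_eq: "path_homotopic T (\<lambda>r. g2 (c r) 1) (\<lambda>r. b)"
    using d(2) base_in by (intro path_homotopic_sym[OF path_homotopic_eq]) (auto simp: pathin_def)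
  have "path_homotopic T (loop_join c ?S') (loop_join (\<lambda>r. g1 (c r) 0) (\<lambda>u. g1 (c 1) u))"
    using c_eq seg1 d(3) y(3) by (intro path_homotopic_join[OF path_homotopic_sym[OF c_eq]] path_homotopic_sym[OF seg1(2)]) auto
  also have "path_homotopic T \<dots> (loop_join (\<lambda>u. g1 (c 0) u) (\<lambda>r. g1 (c r) 1))"
    using path_homotopic_square[OF K1] by simp
  also have "path_homotopic T \<dots> (loop_join ?S d)"
    using seg1 pd by (intro path_homotopic_join) (auto simp: d_def path_homotopic_refl)
  finally have sq1: "path_homotopic T (loop_join c ?S') (loop_join ?S d)" .
  have cy0: "real_point X ((Suc m, cone m y), ?cy) = d 1" and cx0: "real_point X ((Suc n, cone n x), ?cx) = d 0"
    using cone_point[OF x(1,2) mx] cone_point[OF y(1,2) my] d0 d1 by simp_all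
  have "path_homotopic T (loop_join d ?C') (loop_join (\<lambda>r. g2 (c r) 0) (\<lambda>u. g2 (c 1) u))"
    using d(1) cy0 by (intro path_homotopic_join[OF path_homotopic_sym[OF d_eq]] path_homotopic_sym[OF seg2(2)]) auto
  also have "path_homotopic T \<dots> (loop_join (\<lambda>u. g2 (c 0) u) (\<lambda>r. g2 (c r) 1))"
    using path_homotopic_square[OF K2] by simp
  also have "path_homotopic T \<dots> (loop_join ?C (\<lambda>r. b))"
    using seg2 b_eq by (intro path_homotopic_join) auto
  finally have sq2: "path_homotopic T (loop_join d ?C')
      (loop_join ?C (\<lambda>r. b))" .
  let ?f = "loop_join f ?S"
  have f1: "edgelike ?f ((n, x), ?bx)"
    using edgelike_seg[OF f] x bx by blast
  \<comment> \<open>The same point, now viewed in the base of the cone, from where a straight path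
    leads to the apex.\<close>
  have "edgelike ?f ((Suc n, cone n x), ?cx)"
    using edgelike_cong[OF cone_point[OF x(1,2) mx]] f1 by simp
  then have "edgelike (loop_join ?f ?C) ((Suc n, cone n x), vert 0)"
    using cone_closed[OF x(1)] bx by (intro edgelike_seg) auto
  \<comment> \<open>Both apices are the base point. This is the place where the path changes from
    the cone over \<open>x\<close> to the cone over \<open>y\<close>.\<close>
  then have *: "edgelike (loop_join ?f ?C) ((Suc m, cone m y), vert 0)"
    using edgelike_cong[of "((Suc n, cone n x), vert 0)" "((Suc m, cone m y), vert 0)"] x y
    by (simp add: vertex_point cone_closed)
  then have "edgelike (loop_join (loop_join ?f ?C) (\<lambda>r. b)) ((Suc m, cone m y), vert 0)"
    by (rule edgelike_homotopic)
      (use edgelike_end[OF *] y cone_closed in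
        \<open>auto intro!: path_homotopic_sym[OF path_homotopic_join_const_right] simp: vertex_point\<close>)
  then have "edgelike (loop_join (loop_join (loop_join ?f ?C) (\<lambda>r. b))
      (path_rev ?C')) ((Suc m, cone m y), ?cy)"
    unfolding path_rev_seg using y bys by (intro edgelike_seg cone_closed) auto
  then have "edgelike (loop_join ?f d) ((Suc m, cone m y), ?cy)"
  proof (rule edgelike_homotopic)
    show "path_homotopic T (loop_join (loop_join (loop_join ?f ?C) (\<lambda>r. b))
        (path_rev ?C')) (loop_join ?f d)"
      using x y bx bys pd cx0 cy0 d0 edgelike_end[OF f1] base_in
      by (intro path_homotopic_square_transfer[OF sq2] pathin_seg cone_closed)
        (auto simp: vertex_point cone_closed pathin_def)
  qed
  then have "edgelike (loop_join ?f d) ((m, y), ?by)"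
    using edgelike_cong[OF cone_point[OF y(1,2) my]] by simp
  then have "edgelike (loop_join (loop_join ?f d) (path_rev ?S')) ((m, y), s)"
    unfolding path_rev_seg using y bys by (intro edgelike_seg) auto
  then show ?thesis
  proof (rule edgelike_homotopic)
    show "path_homotopic T (loop_join (loop_join ?f d) (path_rev ?S')) (loop_join f c)"
      using x y bx bys c pd d0 edgelike_end[OF f]
      by (intro path_homotopic_square_transfer[OF sq1] pathin_seg) auto
  qed
qed

theorem loops_generated_by_edges:
  assumes c: "c \<in> loops T b"
  shows "edge_loop X v c"
proof -
  have pc: "pathin T c" "c 0 = b" "c 1 = b" using c by (auto simp: loops_def)
  have ctop: "c s \<in> topspace T" if "s \<in> {0..1}" for s
    using pc(1) that by (auto simp: pathin_def continuous_map_def)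
  \<comment> \<open>The Lebesgue number lemma works with open sets of reals, so the relatively open
    preimages in the unit interval are extended to open sets \<open>W a\<close>.\<close>
  have "\<forall>a. \<exists>W. open W \<and> {s \<in> {0..1}. c s \<in> massive a} = W \<inter> {0..1}"
  proof
    fix a
    have "openin (top_of_set {0..1}) {s \<in> topspace (top_of_set {0..1}). c s \<in> massive a}"
      using pc(1) openin_massive unfolding pathin_def by (rule openin_continuous_map_preimage)
    then show "\<exists>W. open W \<and> {s \<in> {0..1}. c s \<in> massive a} = W \<inter> {0..1}"
      by (auto simp: openin_open Int_commute)
  qed
  then obtain W where W: "\<And>a. open (W a)" "\<And>a. {s \<in> {0..1}. c s \<in> massive a} = W a \<inter> {0..1}"
    by metis
  have cover: "{0..1} \<subseteq> \<Union> (range W)"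
  proof
    fix s :: real assume s: "s \<in> {0..1}"
    obtain n x t where *: "x \<in> simp X n" "t \<in> standard_simplex n" "c s = real_point X ((n, x), t)"
      using topspace_realizationE[OF ctop[OF s]] by metis
    obtain a where "mass a n x t > 0" using exists_mass[OF *(2)] .
    then have "s \<in> W a" using W(2)[of a] s * by (auto simp: in_massive)
    then show "s \<in> \<Union> (range W)" by auto
  qed
  obtain \<delta> where \<delta>: "\<delta> > 0" "\<And>S. S \<subseteq> {0..1} \<Longrightarrow> diameter S < \<delta> \<Longrightarrow> \<exists>B \<in> range W. S \<subseteq> B"
  proof (rule Lebesgue_number_lemma[of "{0..1::real}" "range W"])
    show "compact {0..1::real}" "range W \<noteq> {}" "{0..1} \<subseteq> \<Union> (range W)" using cover by simp_all
    show "open B" if "B \<in> range W" for B using that W(1) by blast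
  qed (rule that)
  obtain N :: nat where N: "N > 0" "1 / real N < \<delta>" 
  proof -
    obtain N where "1 / real (Suc N) < \<delta>" using nat_approx_posE[OF \<delta>(1)] by blast
    then show thesis using that[of "Suc N"] by simp
  qed
  \<comment> \<open>The claim covers every cell that represents the point, so the induction
    hypothesis holds for whichever representation the next step picks.\<close>
  have "\<forall>n x t. x \<in> simp X n \<and> t \<in> standard_simplex n \<and> c (k / N) = real_point X ((n, x), t) \<longrightarrow>
     edgelike (subpath_on 0 (k / N) c) ((n, x), t)" if "k \<le> N" for k
    using that
  proof (induction k)
    case 0
    have "seg X 0 v (vert 0) (vert 0) = (\<lambda>u. b)"
      by (simp add: seg_def straight_def real_vertex_eq algebra_simps)
    then have "loop_join (\<lambda>u. b) (seg X 0 v (vert 0) (vert 0)) = (\<lambda>u. b)"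
      by (simp add: loop_join_def)
    moreover have "path_homotopic T (\<lambda>u. b) (\<lambda>u. b)"
      using base_in by (intro path_homotopic_refl) (simp add: pathin_def)
    ultimately have "edgelike (\<lambda>u. b) ((0, v), vert 0)"
      unfolding edgelike_def by (auto intro!: exI[of _ "\<lambda>u. b"] edge_loop.const)
    moreover have "subpath_on 0 0 c = (\<lambda>u. b)" by (simp add: subpath_on_def pc)
    ultimately have *: "edgelike (subpath_on 0 0 c) ((0, v), vert 0)" by simp
    show ?case
    proof (intro allI impI, elim conjE)
      fix n x t assume "c (real 0 / real N) = real_point X ((n, x), t)"
      then have "real_point X ((0, v), vert 0) = real_point X ((n, x), t)"
        using pc(2) by (simp add: real_vertex_eq)
      from edgelike_cong[OF this] * show "edgelike (subpath_on 0 (real 0 / real N) c) ((n, x), t)"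
        by simp
    qed
  next
    case (Suc k)
    let ?r = "real k / N" and ?s = "real (Suc k) / N"
    have rs: "?r \<in> {0..1}" "?s \<in> {0..1}" "?r \<le> ?s" using Suc.prems N by (auto simp: field_simps)
    have "{?r..?s} \<subseteq> {0..1}" "diameter {?r..?s} < \<delta>"
      using rs N by (auto simp: diameter_closed_interval diff_divide_distrib[symmetric])
    then obtain a where a: "{?r..?s} \<subseteq> W a" using \<delta>(2) by blast
    let ?c = "subpath_on ?r ?s c"
    have "?c ` {0..1} \<subseteq> massive a"
    proof
      fix P assume "P \<in> ?c ` {0..1}"
      then obtain u where u: "u \<in> {0..1}" "P = c (?r + (?s - ?r) * u)" by (auto simp: subpath_on_def)
      have "(?s - ?r) * u \<le> (?s - ?r) * 1"
        by (rule mult_left_mono) (use u rs in auto)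
      moreover have "0 \<le> (?s - ?r) * u" using u rs by (intro mult_nonneg_nonneg) auto
      ultimately have "?r + (?s - ?r) * u \<in> {?r..?s}" by auto
      then show "P \<in> massive a" using a W(2)[of a] \<open>{?r..?s} \<subseteq> {0..1}\<close> u(2) by blast
    qed
    note mc = this
    obtain n x t where x: "x \<in> simp X n" "t \<in> standard_simplex n" "c ?r = real_point X ((n, x), t)"
      using topspace_realizationE[OF ctop[OF rs(1)]] by metis
    have ind: "edgelike (subpath_on 0 ?r c) ((n, x), t)" using Suc x by auto
    show ?case
    proof (intro allI impI, elim conjE)
      fix m y s assume y: "y \<in> simp X m" "s \<in> standard_simplex m" "c ?s = real_point X ((m, y), s)"
      have "edgelike (loop_join (subpath_on 0 ?r c) ?c) ((m, y), s)"
        by (rule edgelike_massive_path[OF _ mc x(1,2) _ y(1,2) _ ind])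
          (use x y rs pc in \<open>auto intro: pathin_subpath_on\<close>)
      then show "edgelike (subpath_on 0 ?s c) ((m, y), s)"
        using path_homotopic_subpath_join[OF pc(1) _ rs(1,2), of 0] edgelike_homotopic by auto
    qed
  qed
  from this[of N] N have "edgelike (subpath_on 0 1 c) ((0, v), vert 0)"
    using vertices pc(3) by (auto simp: real_vertex_eq)
  then show ?thesis by (intro edgelike_loop) (simp add: subpath_on_def)
qed

end

section \<open>Additive heights as homomorphisms on the fundamental group\<close>

context graded_sset
begin

definition circle_map :: "'s cell_point \<Rightarrow> complex" where
  "circle_map = (\<lambda>((n, x), t). exp (2 * of_real pi * \<i> * of_real (\<Sum>i\<le>n. real (height n x i) * t i)))"

text \<open>The heights are measured from vertex 0, and \<theta> changes this reference vertex. All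
  heights then differ by one integer; since the coordinates sum to 1, the exponent differs by an
  integral multiple of 2 pi i.\<close>

lemma circle_map_oper:
  assumes "\<theta> \<in> simplex_maps k n" "x \<in> simp X n" "t \<in> standard_simplex k"
  shows "circle_map ((k, oper X k n \<theta> x), t) = circle_map ((n, x), simplex_push k \<theta> t)"
proof -
  have "(\<Sum>i\<le>n. real (height n x i) * simplex_push k \<theta> t i) = (\<Sum>i\<le>k. real (height n x (\<theta> i)) * t i)"
    using simplex_mapsD[OF assms(1)] by (intro sum_simplex_push) auto
  also have "\<dots> = (\<Sum>i\<le>k. real (height k (oper X k n \<theta> x) i) * t i + real (height n x (\<theta> 0)) * t i)"
    by (rule sum.cong) (simp_all only: distrib_right[symmetric] of_nat_add[symmetric]
        height_oper[OF assms(1,2)] atMost_iff)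
  also have "\<dots> = (\<Sum>i\<le>k. real (height k (oper X k n \<theta> x) i) * t i) + real (height n x (\<theta> 0))"
    using assms(3) by (simp add: sum.distrib sum_distrib_left[symmetric] standard_simplex_def)
  finally have *: "2 * of_real pi * \<i> * of_real (\<Sum>i\<le>n. real (height n x i) * simplex_push k \<theta> t i) =
      2 * of_real pi * \<i> * of_real (\<Sum>i\<le>k. real (height k (oper X k n \<theta> x) i) * t i) +
      2 * of_real pi * \<i> * of_nat (height n x (\<theta> 0))"
    by (simp add: algebra_simps)
  have "exp (2 * of_real pi * \<i> * of_nat (height n x (\<theta> 0))) = 1"
    by (metis exp_of_nat_mult exp_two_pi_i' mult.assoc mult.commute power_one)
  note one = this
  have "circle_map ((n, x), simplex_push k \<theta> t) =
      exp (2 * of_real pi * \<i> * of_real (\<Sum>i\<le>n. real (height n x i) * simplex_push k \<theta> t i))"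
    unfolding circle_map_def prod.case ..
  also have "\<dots> = exp (2 * of_real pi * \<i> * of_real (\<Sum>i\<le>k. real (height k (oper X k n \<theta> x) i) * t i)) * 1"
    unfolding * exp_add one ..
  also have "\<dots> = circle_map ((k, oper X k n \<theta> x), t)"
    unfolding circle_map_def prod.case mult_1_right ..
  finally show ?thesis ..
qed

theorem height_homomorphism:
  obtains d :: "(real \<Rightarrow> 's cell_point set) set \<Rightarrow> complex" where
    "\<And>f g. f \<in> loops T b \<Longrightarrow> g \<in> loops T b \<Longrightarrow>
       d (loop_class T b (loop_join f g)) = d (loop_class T b f) + d (loop_class T b g)"
    "\<And>e. e \<in> simp X 1 \<Longrightarrow>
       d (loop_class T b (real_edge X e)) = of_nat (height 1 e 1) - of_nat (height 1 e 0)"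
proof -
  have "\<exists>g. \<forall>p. g (real_point X p) = circle_map p"
  proof (rule real_point_factor[of X circle_map, OF circle_map_oper])
    fix g assume "\<And>p. g (real_point X p) = circle_map p"
    then show "\<exists>g. \<forall>p. g (real_point X p) = circle_map p" by (intro exI[of _ g] allI)
  qed
  then obtain g where "\<forall>p. g (real_point X p) = circle_map p" ..
  note g = this[rule_format]
  have "continuous_map T (top_of_set (- {0})) g"
  proof (rule continuous_map_realization)
    fix n x assume "x \<in> simp X n"
    have c: "continuous_map (simplex_top n) euclideanreal (\<lambda>t. \<Sum>i\<le>n. real (height n x i) * t i)"
      by (intro continuous_intros continuous_map_simplex_coord) auto
    have "continuous_map euclideanreal (top_of_set (- {0})) (\<lambda>r. exp (2 * of_real pi * \<i> * of_real r))"
      by (auto simp: continuous_map_in_subtopology intro!: continuous_intros)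
    from continuous_map_compose[OF c this]
    show "continuous_map (simplex_top n) (top_of_set (- {0})) (\<lambda>t. g (real_point X ((n, x), t)))"
      by (simp add: g circle_map_def o_def)
  qed
  note gc = this
  define w where "w = (\<lambda>f. winding_number (g \<circ> f) 0)"
  have w_eq: "w f = w f'" if "path_homotopic T f f'" for f f'
  proof -
    have "homotopic_paths (- {0}) (g \<circ> f) (g \<circ> f')"
      using path_homotopic_compose[OF that gc]
      unfolding path_homotopic_def homotopic_paths_def pathstart_def pathfinish_def .
    then show ?thesis unfolding w_def by (rule winding_number_homotopic_paths)
  qed
  have path: "path (g \<circ> f)" "0 \<notin> path_image (g \<circ> f)" if "f \<in> loops T b" for f
  proof -
    have "continuous_map (top_of_set {0..1}) T f" using that by (simp add: loops_def pathin_def)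
    from continuous_map_compose[OF this gc] show "path (g \<circ> f)" "0 \<notin> path_image (g \<circ> f)" by (auto simp: path_def path_image_def)
  qed
  define d where "d = (\<lambda>C. w (SOME f. f \<in> C))"
  have d: "d (loop_class T b f) = w f" if "f \<in> loops T b" for f
  proof -
    have "f \<in> loop_class T b f"
      using that by (simp add: loop_class_eq loops_def path_homotopic_refl)
    then have "(SOME f'. f' \<in> loop_class T b f) \<in> loop_class T b f" by (rule someI[where P = "\<lambda>f'. f' \<in> loop_class T b f"])
    then show ?thesis unfolding d_def loop_class_eq[OF that] using w_eq by auto
  qed
  show thesis
  proof (rule that)
    fix f f' assume f: "f \<in> loops T b" "f' \<in> loops T b"
    have "w (loop_join f f') = winding_number ((g \<circ> f) +++ (g \<circ> f')) 0"
      unfolding w_def by (rule arg_cong[where f = "\<lambda>p. winding_number p 0"])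
        (auto simp: joinpaths_def loop_join_def)
    also have "\<dots> = w f + w f'"
      unfolding w_def
      by (rule winding_number_join) (use path f in \<open>auto simp: loops_def pathstart_def pathfinish_def\<close>)
    finally show "d (loop_class T b (loop_join f f')) = d (loop_class T b f) + d (loop_class T b f')"
      using f by (simp add: d loops_join)
  next
    fix e assume e: "e \<in> simp X 1"
    \<comment> \<open>Along an edge the exponent is linear. So \<open>?p\<close> lifts the image of
      the edge through \<open>exp\<close>, and its increment divided by 2 pi i is the winding
      number.\<close>
    let ?p = "\<lambda>u::real. 2 * of_real pi * \<i> * (of_nat (height 1 e 0) + u * (of_nat (height 1 e 1) - of_nat (height 1 e 0))) :: complex"
    have "g \<circ> real_edge X e = exp \<circ> ?p"
      by (auto simp: fun_eq_iff real_edge_def g circle_map_def algebra_simps)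
    then have "w (real_edge X e) = winding_number (exp \<circ> ?p) 0" by (simp add: w_def)
    also have "\<dots> = (pathfinish ?p - pathstart ?p) / (2 * of_real pi * \<i>)"
      by (rule winding_number_compose_exp) (auto simp: path_def intro!: continuous_intros)
    also have "\<dots> = of_nat (height 1 e 1) - of_nat (height 1 e 0)"
      by (simp add: pathfinish_def pathstart_def field_simps)
    finally show "d (loop_class T b (real_edge X e)) = of_nat (height 1 e 1) - of_nat (height 1 e 0)"
      using pathin_real_edge[OF e] by (simp add: d)
  qed
qed

end

section \<open>Finite pointed \<open>G\<close>-sets\<close>

locale finite_group = group G for G (structure) +
  assumes finite_carrier: "finite (carrier G)"
begin

abbreviation "M \<equiv> adjoin_zero G"

lemma carrier_M: "carrier M = insert None (Some ` carrier G)"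
  and one_M: "\<one>\<^bsub>M\<^esub> = Some \<one>"
  and absorb_M: "absorb M = None"
  and mult_M [simp]: "Some g \<otimes>\<^bsub>M\<^esub> Some h = Some (g \<otimes> h)"
    "None \<otimes>\<^bsub>M\<^esub> m = None" "m \<otimes>\<^bsub>M\<^esub> None = None"
  by (auto simp: adjoin_zero_def split: option.splits)

text \<open>Finitely many generators have finitely many translates because \<open>G\<close> is
  finite; conversely a finite module is generated by all its points.\<close>

lemma fg_module_iff:
  "is_fg_module M S \<longleftrightarrow> finite (mpts S) \<and> mbase S \<in> mpts S \<and>
     (\<forall>s\<in>mpts S. \<forall>g\<in>carrier G. mact S s (Some g) \<in> mpts S) \<and>
     (\<forall>g\<in>carrier G. mact S (mbase S) (Some g) = mbase S) \<and>
     (\<forall>s\<in>mpts S. mact S s (Some \<one>) = s) \<and>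
     (\<forall>s\<in>mpts S. \<forall>g\<in>carrier G. \<forall>h\<in>carrier G. mact S s (Some (g \<otimes> h)) = mact S (mact S s (Some g)) (Some h)) \<and>
     (\<forall>s\<in>mpts S. mact S s None = mbase S)"
  (is "_ \<longleftrightarrow> ?R")
proof
  assume S: "is_fg_module M S"
  then obtain S' where S': "finite S'" "mpts S = (\<Union>s\<in>S'. mact S s ` carrier M)"
    by (auto simp: is_fg_module_def)
  have "finite (carrier M)" by (simp add: carrier_M finite_carrier)
  with S' have "finite (mpts S)" by auto
  then show ?R using S by (auto simp: is_fg_module_def is_module_def carrier_M one_M absorb_M)
next
  assume R: ?R
  have "\<exists>S'. finite S' \<and> S' \<subseteq> mpts S \<and> mpts S = (\<Union>s\<in>S'. mact S s ` carrier M)"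
  proof (intro exI[of _ "mpts S"] conjI)
    show "mpts S = (\<Union>s\<in>mpts S. mact S s ` carrier M)"
    proof
      show "mpts S \<subseteq> (\<Union>s\<in>mpts S. mact S s ` carrier M)"
      proof
        fix s assume s: "s \<in> mpts S"
        then have "s = mact S s (Some \<one>)" using R by simp
        moreover have "Some \<one> \<in> carrier M" by (simp add: carrier_M)
        ultimately show "s \<in> (\<Union>s\<in>mpts S. mact S s ` carrier M)" using s by blast
      qed
      show "(\<Union>s\<in>mpts S. mact S s ` carrier M) \<subseteq> mpts S"
        using R by (auto simp: carrier_M)
    qed
  qed (use R in auto)
  with R show "is_fg_module M S"
    by (auto simp: is_fg_module_def is_module_def carrier_M one_M absorb_M)
qed

lemma fg_moduleD:
  assumes "is_fg_module M S"
  shows "finite (mpts S)" "mbase S \<in> mpts S"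
    "s \<in> mpts S \<Longrightarrow> g \<in> carrier G \<Longrightarrow> mact S s (Some g) \<in> mpts S"
    "g \<in> carrier G \<Longrightarrow> mact S (mbase S) (Some g) = mbase S"
    "s \<in> mpts S \<Longrightarrow> mact S s (Some \<one>) = s"
    "s \<in> mpts S \<Longrightarrow> g \<in> carrier G \<Longrightarrow> h \<in> carrier G \<Longrightarrow>
      mact S s (Some (g \<otimes> h)) = mact S (mact S s (Some g)) (Some h)"
    "s \<in> mpts S \<Longrightarrow> mact S s None = mbase S"
  using assms unfolding fg_module_iff by auto

lemma mact_inverse:
  assumes "is_fg_module M S" "s \<in> mpts S" "g \<in> carrier G"
  shows "mact S (mact S s (Some g)) (Some (inv g)) = s"
  using fg_moduleD(5,6)[OF assms(1)] assms by (metis inv_closed r_inv)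

text \<open>Elements of \<open>G\<close> act invertibly, so no other point can be moved to the base
  point. For a general pointed monoid this fails; it is what makes the non-base points a
  \<open>G\<close>-set.\<close>

lemma mact_eq_base_iff:
  assumes "is_fg_module M S" "s \<in> mpts S" "g \<in> carrier G"
  shows "mact S s (Some g) = mbase S \<longleftrightarrow> s = mbase S"
  using mact_inverse[OF assms] fg_moduleD(4)[OF assms(1)] assms(3) by (metis inv_closed)

text \<open>The absorbing element sends everything to the base point, so equivariance for it amounts
  to preservation of the base point.\<close>

lemma arrow_iff:
  "(S, f, T) \<in> FG_arrows M \<longleftrightarrow> is_fg_module M S \<and> is_fg_module M T \<and>
     f \<in> mpts S \<rightarrow>\<^sub>E mpts T \<and> f (mbase S) = mbase T \<and>
     (\<forall>s\<in>mpts S. \<forall>g\<in>carrier G. f (mact S s (Some g)) = mact T (f s) (Some g))"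
proof -
  have "f (mact S s None) = mact T (f s) None"
    if "is_fg_module M S" "is_fg_module M T" "f \<in> mpts S \<rightarrow>\<^sub>E mpts T" "f (mbase S) = mbase T" "s \<in> mpts S" for s
  proof -
    have "f s \<in> mpts T" using that by auto
    then show ?thesis
      by (simp only: fg_moduleD(7)[OF that(1,5)] fg_moduleD(7)[OF that(2)] that(4))
  qed
  then show ?thesis
    unfolding FG_arrows_def by (auto simp: carrier_M)
qed

lemma arrowD:
  assumes "(S, f, T) \<in> FG_arrows M"
  shows "is_fg_module M S" "is_fg_module M T" "s \<in> mpts S \<Longrightarrow> f s \<in> mpts T" "f \<in> extensional (mpts S)"
    "f (mbase S) = mbase T"
    "s \<in> mpts S \<Longrightarrow> g \<in> carrier G \<Longrightarrow> f (mact S s (Some g)) = mact T (f s) (Some g)"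
  using assms unfolding arrow_iff by (auto simp: PiE_def)

lemma arrow_eqI:
  assumes "(S, f, T) \<in> FG_arrows M" "(S, f', T) \<in> FG_arrows M" "\<And>s. s \<in> mpts S \<Longrightarrow> f s = f' s"
  shows "f = f'"
  using assms arrowD(4) by (meson extensionalityI)

lemma comp_simp: "arrow_comp (T, g, U) (S, f, T') = (S, compose (mpts S) g f, U)"
  by (simp add: arrow_comp_def)

lemma comp_in:
  assumes "(S, f, T) \<in> FG_arrows M" "(T, g, U) \<in> FG_arrows M"
  shows "(S, compose (mpts S) g f, U) \<in> FG_arrows M"
  using arrowD[OF assms(1)] arrowD[OF assms(2)] fg_moduleD[of S]
  unfolding arrow_iff by (auto simp: compose_def)

lemma id_in: "is_fg_module M S \<Longrightarrow> arrow_id S \<in> FG_arrows M"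
  unfolding arrow_id_def arrow_iff using fg_moduleD[of S] by auto

lemma comp_id:
  assumes "(S, f, T) \<in> FG_arrows M"
  shows "arrow_comp (S, f, T) (arrow_id S) = (S, f, T)" "arrow_comp (arrow_id T) (S, f, T) = (S, f, T)"
  using arrowD[OF assms] by (auto simp: arrow_id_def comp_simp compose_def extensional_def fun_eq_iff)

lemma FG_simps [simp]:
  "Obj (FG M) = {S. is_fg_module M S}" "Arr (FG M) = FG_arrows M" "Dom (FG M) a = fst a"
  "Cod (FG M) a = snd (snd a)" "Idn (FG M) = arrow_id" "Cmp (FG M) = arrow_comp" "Zer (FG M) = zero_module"
  "Cof (FG M) = FG_cofibrations M" "Weq (FG M) = FG_isos M"
  by (simp_all add: FG_def)

subsection \<open>Trivial modules\<close>

text \<open>One-point modules are the zero objects, but they need not equal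
  \<open>zero_module\<close>: their point, and the values of the action elsewhere, are
  arbitrary.\<close>

definition trivial :: "('a option, 'x) pmod \<Rightarrow> bool" where
  "trivial S \<longleftrightarrow> is_fg_module M S \<and> mpts S = {mbase S}"

definition zero_arrow :: "('a option, 'x) pmod \<Rightarrow> ('a option, 'x) pmod \<Rightarrow> ('a option, 'x) pmod_arrow" where
  "zero_arrow S T = (S, restrict (\<lambda>s. mbase T) (mpts S), T)"

lemma zero_arrow_sel [simp]: "fst (zero_arrow S T) = S" "snd (snd (zero_arrow S T)) = T"
  by (simp_all add: zero_arrow_def)

lemma trivial_iff_card: "trivial S \<longleftrightarrow> is_fg_module M S \<and> card (mpts S) = 1"
  unfolding trivial_def using fg_moduleD(1,2)[of S] by (auto simp: card_1_singleton_iff)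

lemma trivial_fg: "trivial S \<Longrightarrow> is_fg_module M S"
  by (simp add: trivial_def)

lemma trivial_zero: "trivial (zero_module :: ('a option, 'x::zero) pmod)"
  by (auto simp: trivial_def fg_module_iff zero_module_def)

lemma zero_arrow_in: "is_fg_module M S \<Longrightarrow> is_fg_module M T \<Longrightarrow> zero_arrow S T \<in> FG_arrows M"
  using fg_moduleD[of S] fg_moduleD[of T] by (auto simp: zero_arrow_def arrow_iff)

lemma trivial_arrow:
  assumes "a \<in> FG_arrows M" "trivial (fst a) \<or> trivial (snd (snd a))"
  shows "a = zero_arrow (fst a) (snd (snd a))"
proof -
  obtain S f T where a: "a = (S, f, T)" by (cases a)
  have "f = restrict (\<lambda>s. mbase T) (mpts S)"
    using assms arrowD[of S f T] unfolding a by (auto simp: trivial_def extensional_def fun_eq_iff restrict_def)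
  then show ?thesis by (simp add: a zero_arrow_def)
qed

lemma comp_zero_arrow:
  assumes "a \<in> FG_arrows M" "c \<in> FG_arrows M" "snd (snd a) = fst c"
    and "trivial (fst a) \<or> trivial (snd (snd c))"
  shows "arrow_comp c a = zero_arrow (fst a) (snd (snd c))"
proof -
  obtain S f T where a: "a = (S, f, T)" by (cases a)
  obtain g U where c: "c = (T, g, U)" using assms(3) a by (cases c) auto
  have "arrow_comp c a \<in> FG_arrows M" using comp_in assms unfolding a c by (simp add: comp_simp)
  from trivial_arrow[OF this] assms(4) show ?thesis by (simp add: a c comp_simp)
qed

lemma arrow_id_trivial: "trivial S \<Longrightarrow> arrow_id S = zero_arrow S S"
  using trivial_arrow[OF id_in[of S]] by (simp add: trivial_fg arrow_id_def)

lemma iso_in: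
  assumes "(S, f, T) \<in> FG_arrows M" "bij_betw f (mpts S) (mpts T)"
  shows "(S, f, T) \<in> FG_isos M"
proof -
  let ?h = "restrict (inv_into (mpts S) f) (mpts T)"
  note f = arrowD[OF assms(1)] and fS = fg_moduleD[OF arrowD(1)[OF assms(1)]]
  have inv: "?h (f s) = s" if "s \<in> mpts S" for s
    using assms(2) that f by (auto simp: bij_betw_def)
  have inv': "f (?h t) = t" "?h t \<in> mpts S" if "t \<in> mpts T" for t
    using assms(2) that by (auto simp: bij_betw_def f_inv_into_f inv_into_into)
  have "(T, ?h, S) \<in> FG_arrows M"
    unfolding arrow_iff
  proof (intro conjI ballI)
    fix t g assume t: "t \<in> mpts T" "g \<in> carrier G"
    have "mact T t (Some g) = f (mact S (?h t) (Some g))"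
      using f(6)[of "?h t" g] inv'[OF t(1)] t(2) by simp
    then show "?h (mact T t (Some g)) = mact S (?h t) (Some g)"
      using inv fS(3) inv'(2)[OF t(1)] t(2) by metis
  next
    show "?h (mbase T) = mbase S" using inv[of "mbase S"] f fS by simp
  qed (use f inv' in auto)
  moreover have "arrow_comp (T, ?h, S) (S, f, T) = arrow_id S" "arrow_comp (S, f, T) (T, ?h, S) = arrow_id T"
    using inv inv' by (auto simp: comp_simp arrow_id_def compose_def fun_eq_iff restrict_def)
  ultimately show ?thesis using assms(1) unfolding FG_isos_def by blast
qed

lemma iso_bij:
  assumes "(S, f, T) \<in> FG_isos M"
  shows "(S, f, T) \<in> FG_arrows M" "bij_betw f (mpts S) (mpts T)"
proof -
  obtain h where f: "(S, f, T) \<in> FG_arrows M" and h: "(T, h, S) \<in> FG_arrows M"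
    and eq: "arrow_comp (T, h, S) (S, f, T) = arrow_id S" "arrow_comp (S, f, T) (T, h, S) = arrow_id T"
    using assms by (auto simp: FG_isos_def)
  show "(S, f, T) \<in> FG_arrows M" by (rule f)
  have 1: "h (f s) = s" if "s \<in> mpts S" for s
    using eq(1) that by (simp add: comp_simp arrow_id_def) (metis compose_eq id_apply restrict_apply')
  have 2: "f (h t) = t" if "t \<in> mpts T" for t
    using eq(2) that by (simp add: comp_simp arrow_id_def) (metis compose_eq id_apply restrict_apply')
  show "bij_betw f (mpts S) (mpts T)"
    by (rule bij_betw_byWitness[of _ h]) (use 1 2 arrowD[OF f] arrowD[OF h] in auto)
qed

lemma arrow_id_iso: "is_fg_module M S \<Longrightarrow> arrow_id S \<in> FG_isos M"
  using iso_in[of S "restrict id (mpts S)" S] id_in[of S] by (simp add: arrow_id_def bij_betw_def inj_on_def)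

lemma zero_arrow_iso:
  assumes "trivial S" "trivial T"
  shows "zero_arrow S T \<in> FG_isos M"
  using iso_in[of S "restrict (\<lambda>s. mbase T) (mpts S)" T] zero_arrow_in[of S T] assms
  by (auto simp: zero_arrow_def trivial_def bij_betw_def)

subsection \<open>Quotients and fixed points\<close>

lemma quotient_fg:
  assumes T: "is_fg_module M T" and A: "A \<subseteq> mpts T" "mbase T \<in> A"
    and act: "\<And>a g. a \<in> A \<Longrightarrow> g \<in> carrier G \<Longrightarrow> mact T a (Some g) \<in> A"
  shows "is_fg_module M (quotient_module T A)"
  unfolding fg_module_iff using fg_moduleD[OF T] A
  by (auto simp: quotient_module_def intro: act)

lemma quotient_arrow:
  assumes T: "is_fg_module M T" and A: "A \<subseteq> mpts T" "mbase T \<in> A"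
    and act: "\<And>a g. a \<in> A \<Longrightarrow> g \<in> carrier G \<Longrightarrow> mact T a (Some g) \<in> A"
  shows "(T, restrict (\<lambda>t. if t \<in> A then mbase T else t) (mpts T), quotient_module T A) \<in> FG_arrows M"
  unfolding arrow_iff using fg_moduleD[OF T] A quotient_fg[OF assms] T
  by (auto simp: quotient_module_def intro: act)

text \<open>The image of an equivariant map is a submodule, and a quotient of a finite module is
  finite. Hence the condition on the quotient follows from the existence of the retraction.\<close>

lemma cofibrationI:
  assumes "(S, f, T) \<in> FG_arrows M" "(T, r, S) \<in> FG_arrows M" "\<And>s. s \<in> mpts S \<Longrightarrow> r (f s) = s"
  shows "(S, f, T) \<in> FG_cofibrations M"
proof -
  have "arrow_comp (T, r, S) (S, f, T) = arrow_id S"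
    using assms(3) by (auto simp: comp_simp arrow_id_def compose_def fun_eq_iff restrict_def)
  moreover have "is_fg_module M (quotient_module T (f ` mpts S))"
  proof (rule quotient_fg)
    note f = arrowD[OF assms(1)] and S = fg_moduleD[OF arrowD(1)[OF assms(1)]]
    show "is_fg_module M T" "f ` mpts S \<subseteq> mpts T" using f by auto
    show "mbase T \<in> f ` mpts S" using f(5) S(2) by (metis image_eqI)
    fix a g assume "a \<in> f ` mpts S" "g \<in> carrier G"
    then show "mact T a (Some g) \<in> f ` mpts S" using f(6) S(3) by (auto simp flip: f(6))
  qed
  ultimately show ?thesis using assms unfolding FG_cofibrations_def by blast
qed

lemma iso_cofibration:
  assumes "a \<in> FG_isos M"
  shows "a \<in> FG_cofibrations M"
proof -
  obtain S f T where a: "a = (S, f, T)" by (cases a)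
  obtain h where h: "(S, f, T) \<in> FG_arrows M" "(T, h, S) \<in> FG_arrows M"
    "arrow_comp (T, h, S) (S, f, T) = arrow_id S"
    using assms by (auto simp: FG_isos_def a)
  have "h (f s) = s" if "s \<in> mpts S" for s
    using h(3) that by (simp add: comp_simp arrow_id_def) (metis compose_eq id_apply restrict_apply')
  then show ?thesis unfolding a using cofibrationI h by blast
qed

lemma zero_cofibration:
  assumes "trivial S" "is_fg_module M T"
  shows "zero_arrow S T \<in> FG_cofibrations M"
  unfolding zero_arrow_def
proof (rule cofibrationI[where r = "restrict (\<lambda>t. mbase S) (mpts T)"])
  show "(S, restrict (\<lambda>s. mbase T) (mpts S), T) \<in> FG_arrows M" "(T, restrict (\<lambda>t. mbase S) (mpts T), S) \<in> FG_arrows M"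
    using zero_arrow_in[of S T] zero_arrow_in[of T S] assms trivial_fg by (auto simp: zero_arrow_def)
qed (use assms fg_moduleD(2)[OF assms(2)] in \<open>auto simp: trivial_def\<close>)

definition fixed_points :: "'a set \<Rightarrow> ('a option, 'x) pmod \<Rightarrow> 'x set" where
  "fixed_points H S = {s \<in> mpts S. \<forall>g \<in> H \<inter> carrier G. mact S s (Some g) = s}"

lemma fixed_points_base: "is_fg_module M S \<Longrightarrow> mbase S \<in> fixed_points H S"
  using fg_moduleD(2,4)[of S] by (auto simp: fixed_points_def)

lemma finite_fixed_points: "is_fg_module M S \<Longrightarrow> finite (fixed_points H S)"
  using fg_moduleD(1)[of S] by (auto simp: fixed_points_def)

lemma card_fixed_points_pos: "is_fg_module M S \<Longrightarrow> card (fixed_points H S) > 0"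
  using fixed_points_base finite_fixed_points card_gt_0_iff by blast

lemma fixed_points_empty [simp]: "fixed_points {} S = mpts S"
  by (simp add: fixed_points_def)

lemma fixed_points_trivial: "trivial S \<Longrightarrow> fixed_points H S = {mbase S}"
  using fixed_points_base[of S H] by (auto simp: trivial_def fixed_points_def)

lemma card_fixed_points_iso:
  assumes "(S, f, T) \<in> FG_isos M"
  shows "card (fixed_points H S) = card (fixed_points H T)"
proof (rule bij_betw_same_card)
  note f = arrowD[OF iso_bij(1)[OF assms]] and b = iso_bij(2)[OF assms]
  have iff: "f s \<in> fixed_points H T \<longleftrightarrow> s \<in> fixed_points H S" if "s \<in> mpts S" for s
    using that f(3,6) b fg_moduleD(3)[OF f(1)] unfolding fixed_points_def bij_betw_def
    by (auto simp: inj_on_def simp flip: f(6))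
  have sub: "fixed_points H S \<subseteq> mpts S" "fixed_points H T \<subseteq> mpts T" "mpts T = f ` mpts S"
    using b by (auto simp: fixed_points_def bij_betw_def)
  have "f ` fixed_points H S = fixed_points H T"
  proof
    show "f ` fixed_points H S \<subseteq> fixed_points H T" 
    proof
      fix t assume "t \<in> f ` fixed_points H S"
      then obtain s where "s \<in> fixed_points H S" "t = f s" by blast
      then show "t \<in> fixed_points H T" using iff[of s] sub(1) by auto
    qed
    show "fixed_points H T \<subseteq> f ` fixed_points H S"
    proof
      fix t assume t: "t \<in> fixed_points H T"
      then obtain s where "s \<in> mpts S" "t = f s" using sub(2,3) by blast
      then show "t \<in> f ` fixed_points H S" using iff t by simp
    qed
  qed
  then show "bij_betw f (fixed_points H S) (fixed_points H T)"
    using b by (auto simp: bij_betw_def fixed_points_def intro: inj_on_subset)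
qed

text \<open>The complement of a submodule is invariant because \<open>G\<close> is a group; this makes the
  cofibre sequences of pointed \<open>G\<close>-sets additive on fixed points.\<close>

lemma card_fixed_points_pushout:
  assumes po: "is_pushout (FG M) f g h k" and cof: "f \<in> FG_cofibrations M" and triv: "trivial (snd (snd g))"
  shows "card (fixed_points H (snd (snd f))) + 1 = card (fixed_points H (fst f)) + card (fixed_points H (snd (snd h)))"
proof -
  obtain A i B where f: "f = (A, i, B)" by (cases f)
  obtain j Z where g: "g = (A, j, Z)" using po f by (cases g) (auto simp: is_pushout_def)
  obtain q D where h: "h = (B, q, D)" using po f by (cases h) (auto simp: is_pushout_def)
  obtain l where k: "k = (Z, l, D)" using po f g h by (cases k) (auto simp: is_pushout_def)
  have arr: "(A, i, B) \<in> FG_arrows M" "(A, j, Z) \<in> FG_arrows M" "(B, q, D) \<in> FG_arrows M" "(Z, l, D) \<in> FG_arrows M"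
    and comm: "compose (mpts A) q i = compose (mpts A) l j"
    using po by (auto simp: is_pushout_def f g h k comp_simp)
  have univ: "\<exists>!u. (D, u, E) \<in> FG_arrows M \<and> compose (mpts B) u q = q' \<and> compose (mpts Z) u l = l'"
    if "(B, q', E) \<in> FG_arrows M" "(Z, l', E) \<in> FG_arrows M" "compose (mpts A) q' i = compose (mpts A) l' j"
    for E q' l'
  proof -
    have "\<exists>!u. u \<in> FG_arrows M \<and> fst u = D \<and> snd (snd u) = E \<and> arrow_comp u h = (B, q', E) \<and> arrow_comp u k = (Z, l', E)"
    proof -
      have "\<forall>h'\<in>FG_arrows M. \<forall>k'\<in>FG_arrows M.
          fst h' = snd (snd f) \<and> fst k' = snd (snd g) \<and> snd (snd h') = snd (snd k') \<and>
          arrow_comp h' f = arrow_comp k' g \<longrightarrow>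
          (\<exists>!u. u \<in> FG_arrows M \<and> fst u = snd (snd h) \<and> snd (snd u) = snd (snd h') \<and>
             arrow_comp u h = h' \<and> arrow_comp u k = k')"
        using po unfolding is_pushout_def FG_simps by (elim conjE)
      from this[rule_format, of "(B, q', E)" "(Z, l', E)"] that show ?thesis
        by (simp add: f g h k comp_simp)
    qed
    then obtain u where u: "u \<in> FG_arrows M" "fst u = D" "snd (snd u) = E" "arrow_comp u h = (B, q', E)" "arrow_comp u k = (Z, l', E)"
      and uniq: "\<And>u'. u' \<in> FG_arrows M \<Longrightarrow> fst u' = D \<Longrightarrow> snd (snd u') = E \<Longrightarrow> arrow_comp u' h = (B, q', E) \<Longrightarrow>
         arrow_comp u' k = (Z, l', E) \<Longrightarrow> u' = u" by blast
    show ?thesis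
    proof (rule ex1I[of _ "fst (snd u)"])
      show "(D, fst (snd u), E) \<in> FG_arrows M \<and> compose (mpts B) (fst (snd u)) q = q' \<and> compose (mpts Z) (fst (snd u)) l = l'"
        using u by (cases u) (auto simp: h k comp_simp)
      show "u' = fst (snd u)" if "(D, u', E) \<in> FG_arrows M \<and> compose (mpts B) u' q = q' \<and> compose (mpts Z) u' l = l'" for u'
      proof -
        have "(D, u', E) = u" using uniq[of "(D, u', E)"] that by (simp add: h k comp_simp)
        then show ?thesis by auto
      qed
    qed
  qed
  note A = fg_moduleD[OF arrowD(1)[OF arr(1)]] and B = fg_moduleD[OF arrowD(1)[OF arr(3)]]
    and D = fg_moduleD[OF arrowD(2)[OF arr(3)]]
  note ai = arrowD[OF arr(1)] and aq = arrowD[OF arr(3)]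
  obtain r where r: "(B, r, A) \<in> FG_arrows M" "arrow_comp (B, r, A) (A, i, B) = arrow_id A"
    using cof by (auto simp: f FG_cofibrations_def)
  have ri: "r (i a) = a" if "a \<in> mpts A" for a
    using r(2) that by (simp add: comp_simp arrow_id_def) (metis compose_eq id_apply restrict_apply')
  have inj_i: "inj_on i (mpts A)" by (rule inj_on_inverseI[of _ r]) (rule ri)
  have Z: "mpts Z = {mbase Z}" using triv by (simp add: g trivial_def)
  have iB: "i ` mpts A \<subseteq> mpts B" "mbase B \<in> i ` mpts A"
    using ai(3,5) A(2) by (auto simp flip: ai(5))
  have iact: "mact B b (Some x) \<in> i ` mpts A" if "b \<in> i ` mpts A" "x \<in> carrier G" for b x
    using that A(3) by (auto simp flip: ai(6))
  have iact': "b \<in> i ` mpts A" if "mact B b (Some x) \<in> i ` mpts A" "b \<in> mpts B" "x \<in> carrier G" for b x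
    using iact[OF that(1), of "inv x"] mact_inverse[OF arrowD(1)[OF arr(3)] that(2,3)] that(3) by simp
  have qi: "q (i a) = mbase D" if "a \<in> mpts A" for a
  proof -
    have "q (i a) = l (j a)" using comm that by (metis compose_eq)
    also have "j a = mbase Z" using arrowD(3)[OF arr(2) that] Z by simp
    finally show ?thesis using arrowD(5)[OF arr(4)] by simp
  qed
  \<comment> \<open>First test object for the universal property: the quotient of \<open>B\<close>
    by the image of \<open>A\<close>. The induced map recovers every point off this image, so
    \<open>q\<close> is injective there and does not reach the base point.\<close>
  let ?Q = "quotient_module B (i ` mpts A)"
  let ?p = "restrict (\<lambda>t. if t \<in> i ` mpts A then mbase B else t) (mpts B)"
  have Q: "(B, ?p, ?Q) \<in> FG_arrows M"
    using quotient_arrow[OF arrowD(1)[OF arr(3)] iB iact] .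
  have Zmap: "(Z, restrict (\<lambda>z. mbase E) (mpts Z), E) \<in> FG_arrows M" if "is_fg_module M E" for E
    using zero_arrow_in[OF _ that, of Z] arrowD(2)[OF arr(2)] by (simp add: zero_arrow_def)
  have Qb: "mbase ?Q = mbase B" by (simp add: quotient_module_def)
  have jZ: "j a \<in> mpts Z" if "a \<in> mpts A" for a using arrowD(3)[OF arr(2) that] .
  have "compose (mpts A) ?p i = compose (mpts A) (restrict (\<lambda>z. mbase ?Q) (mpts Z)) j"
    using ai(3) jZ by (auto simp: compose_def fun_eq_iff restrict_def Qb)
  from univ[OF Q Zmap[OF arrowD(2)[OF Q]] this]
  obtain u where u: "compose (mpts B) u q = ?p" by blast
  have uq: "u (q b) = b" if "b \<in> mpts B" "b \<notin> i ` mpts A" for b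
    using that compose_eq[OF that(1), of u q] unfolding u by simp
  have ubase: "u (q b) = mbase B" if "b \<in> i ` mpts A" for b
    using that iB compose_eq[of b "mpts B" u q] unfolding u by auto
  have inj_q: "inj_on q (mpts B - i ` mpts A)"
    by (rule inj_on_inverseI[of _ u]) (use uq in auto)
  have q_nonbase: "q b \<noteq> mbase D" if "b \<in> mpts B" "b \<notin> i ` mpts A" for b
    using uq[OF that] ubase[OF iB(2)] aq(5) iB(2) that(2) by metis
  have qB: "q ` mpts B = mpts D"
  proof -
    \<comment> \<open>Second test object: the quotient of \<open>D\<close> by the image of
      \<open>q\<close>. The projection and the zero map have the same composites with
      \<open>q\<close> and \<open>l\<close>, so they agree by uniqueness and \<open>q\<close> is
      onto.\<close>
    let ?E = "quotient_module D (q ` mpts B)"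
    have sub: "q ` mpts B \<subseteq> mpts D" "mbase D \<in> q ` mpts B"
      using aq(3,5) B(2) by (auto simp flip: aq(5))
    have act: "mact D d (Some x) \<in> q ` mpts B" if "d \<in> q ` mpts B" "x \<in> carrier G" for d x
      using that B(3) by (auto simp flip: aq(6))
    let ?e = "restrict (\<lambda>t. if t \<in> q ` mpts B then mbase D else t) (mpts D)"
    have E: "(D, ?e, ?E) \<in> FG_arrows M"
      using quotient_arrow[OF arrowD(2)[OF arr(3)] sub act] .
    have fgE: "is_fg_module M ?E" using arrowD(2)[OF E] .
    have zE: "(D, restrict (\<lambda>d. mbase ?E) (mpts D), ?E) \<in> FG_arrows M" "(B, restrict (\<lambda>d. mbase ?E) (mpts B), ?E) \<in> FG_arrows M"
      using zero_arrow_in[OF _ fgE] arrowD(1,2)[OF arr(3)] by (auto simp: zero_arrow_def)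
    have Eb: "mbase ?E = mbase D" by (simp add: quotient_module_def)
    have lD: "l z \<in> q ` mpts B" "l z \<in> mpts D" if "z \<in> mpts Z" for z
      using that Z arrowD(5)[OF arr(4)] sub by auto
    have "compose (mpts A) (restrict (\<lambda>d. mbase ?E) (mpts B)) i = compose (mpts A) (restrict (\<lambda>z. mbase ?E) (mpts Z)) j"
      using ai(3) jZ by (auto simp: compose_def fun_eq_iff restrict_def)
    from univ[OF zE(2) Zmap[OF fgE] this]
    have "?e = restrict (\<lambda>d. mbase ?E) (mpts D)"
    proof (rule ex1E)
      fix u assume *: "\<forall>y. (D, y, ?E) \<in> FG_arrows M \<and> compose (mpts B) y q = restrict (\<lambda>d. mbase ?E) (mpts B) \<and>
         compose (mpts Z) y l = restrict (\<lambda>z. mbase ?E) (mpts Z) \<longrightarrow> y = u"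
      have "compose (mpts B) ?e q = restrict (\<lambda>d. mbase ?E) (mpts B)"
        "compose (mpts Z) ?e l = restrict (\<lambda>z. mbase ?E) (mpts Z)"
        "compose (mpts B) (restrict (\<lambda>d. mbase ?E) (mpts D)) q = restrict (\<lambda>d. mbase ?E) (mpts B)"
        "compose (mpts Z) (restrict (\<lambda>d. mbase ?E) (mpts D)) l = restrict (\<lambda>z. mbase ?E) (mpts Z)"
        using aq(3) lD by (auto simp: compose_def fun_eq_iff restrict_def Eb)
      then have "?e = u" "restrict (\<lambda>d. mbase ?E) (mpts D) = u" using * E zE(1) by blast+
      then show ?thesis by simp
    qed
    then have *: "?e d = mbase D" if "d \<in> mpts D" for d using that by (simp add: Eb)
    have "d \<in> q ` mpts B" if "d \<in> mpts D" for d
      using *[OF that] that sub(2) by (cases "d \<in> q ` mpts B") auto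
    with sub(1) show ?thesis by auto
  qed
  have qfix: "q b \<in> fixed_points H D \<longleftrightarrow> b \<in> fixed_points H B" if b: "b \<in> mpts B" "b \<notin> i ` mpts A" for b
  proof
    assume q: "q b \<in> fixed_points H D"
    have "mact B b (Some x) = b" if x: "x \<in> H \<inter> carrier G" for x
    proof (rule inj_onD[OF inj_q])
      show "q (mact B b (Some x)) = q b" using q x b aq(6) by (auto simp: fixed_points_def)
      show "mact B b (Some x) \<in> mpts B - i ` mpts A" using x b iact' B(3) by auto
    qed (use b in auto)
    then show "b \<in> fixed_points H B" using b by (simp add: fixed_points_def)
  next
    assume "b \<in> fixed_points H B"
    then show "q b \<in> fixed_points H D" using b aq(3) by (auto simp: fixed_points_def simp flip: aq(6))
  qed
  have ifix: "i a \<in> fixed_points H B \<longleftrightarrow> a \<in> fixed_points H A" if a: "a \<in> mpts A" for a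
    using a ai(3) A(3) inj_i by (auto simp: fixed_points_def inj_on_def simp flip: ai(6))
  have "q ` (fixed_points H B - i ` mpts A) = fixed_points H D - {mbase D}"
  proof
    show "q ` (fixed_points H B - i ` mpts A) \<subseteq> fixed_points H D - {mbase D}"
      using qfix q_nonbase by (auto simp: fixed_points_def)
    show "fixed_points H D - {mbase D} \<subseteq> q ` (fixed_points H B - i ` mpts A)"
    proof
      fix d assume d: "d \<in> fixed_points H D - {mbase D}"
      then obtain b where b: "b \<in> mpts B" "d = q b" using qB by (auto simp: fixed_points_def)
      have "b \<notin> i ` mpts A" using b d qi by auto
      then show "d \<in> q ` (fixed_points H B - i ` mpts A)" using b d qfix by auto
    qed
  qed
  then have 1: "card (fixed_points H D - {mbase D}) = card (fixed_points H B - i ` mpts A)"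
    using card_image[OF inj_on_subset[OF inj_q], of "fixed_points H B - i ` mpts A"]
    by (auto simp: fixed_points_def)
  have "i ` fixed_points H A = fixed_points H B \<inter> i ` mpts A"
    using ifix by (auto simp: fixed_points_def[of H A])
  then have 2: "card (fixed_points H A) = card (fixed_points H B \<inter> i ` mpts A)"
    using card_image[OF inj_on_subset[OF inj_i], of "fixed_points H A"] by (auto simp: fixed_points_def)
  have 3: "card (fixed_points H B) = card (fixed_points H B \<inter> i ` mpts A) + card (fixed_points H B - i ` mpts A)"
    by (rule card_Int_Diff) (rule finite_fixed_points[OF arrowD(1)[OF arr(3)]])
  have 4: "card (fixed_points H D - {mbase D}) + 1 = card (fixed_points H D)"
    using card_Suc_Diff1[OF finite_fixed_points fixed_points_base] arrowD(2)[OF arr(3)] by simp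
  show ?thesis using 1 2 3 4 by (simp add: f h)
qed

end

section \<open>The simplicial set \<open>wS\<close>\<close>

text \<open>A simplex of the diagonal has bidegree \<open>(n, n)\<close> and may be reindexed by
  different maps in the direction of the S-construction and in that of the nerve. Equal maps give
  the simplicial structure of \<open>wS\<close>; unequal ones are needed to cut the square that has
  a given edge as its diagonal into triangles.\<close>

definition bi_index :: "(nat \<Rightarrow> nat) \<Rightarrow> (nat \<Rightarrow> nat) \<Rightarrow> index \<Rightarrow> index" where
  "bi_index \<sigma> \<tau> = (\<lambda>(i, j, p). (\<sigma> i, \<sigma> j, \<tau> p))"

definition bi_oper :: "nat \<Rightarrow> (nat \<Rightarrow> nat) \<Rightarrow> (nat \<Rightarrow> nat) \<Rightarrow> (index \<Rightarrow> index \<Rightarrow> 'a) \<Rightarrow> index \<Rightarrow> index \<Rightarrow> 'a" where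
  "bi_oper k \<sigma> \<tau> F = (\<lambda>x y. if (x, y) \<in> index_arrows k then F (bi_index \<sigma> \<tau> x) (bi_index \<sigma> \<tau> y) else undefined)"

lemma oper_wS: "oper (wS C) k n \<theta> F = bi_oper k \<theta> \<theta> F"
  by (simp add: wS_def bi_oper_def index_map_def bi_index_def fun_eq_iff)

lemma simp_wS [simp]: "simp (wS C) = wS_simplices C"
  by (simp add: wS_def)

lemma bi_index_in:
  assumes "\<sigma> \<in> simplex_maps k n" "\<tau> \<in> simplex_maps k n"
  shows "x \<in> indices k \<Longrightarrow> bi_index \<sigma> \<tau> x \<in> indices n"
    "(x, y) \<in> index_arrows k \<Longrightarrow> (bi_index \<sigma> \<tau> x, bi_index \<sigma> \<tau> y) \<in> index_arrows n"
  using simplex_mapsD[OF assms(1)] simplex_mapsD[OF assms(2)]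
  by (auto simp: indices_def index_arrows_def bi_index_def)

lemma index_arrows_refl: "x \<in> indices n \<Longrightarrow> (x, x) \<in> index_arrows n"
  by (auto simp: indices_def index_arrows_def)

lemma wS_simplicesD:
  assumes "F \<in> wS_simplices C n"
  shows "(x, y) \<notin> index_arrows n \<Longrightarrow> F x y = undefined"
    "x \<in> indices n \<Longrightarrow> Dom C (F x x) \<in> Obj C" "x \<in> indices n \<Longrightarrow> F x x = Idn C (Dom C (F x x))"
    "(x, y) \<in> index_arrows n \<Longrightarrow> F x y \<in> Arr C" "(x, y) \<in> index_arrows n \<Longrightarrow> Dom C (F x y) = Dom C (F x x)"
    "(x, y) \<in> index_arrows n \<Longrightarrow> Cod C (F x y) = Dom C (F y y)"
    "(x, y) \<in> index_arrows n \<Longrightarrow> (y, z) \<in> index_arrows n \<Longrightarrow> F x z = Cmp C (F y z) (F x y)"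
    "j \<le> n \<Longrightarrow> p \<le> n \<Longrightarrow> Dom C (F (j, j, p) (j, j, p)) = Zer C"
    "i \<le> j \<Longrightarrow> j \<le> k \<Longrightarrow> k \<le> n \<Longrightarrow> p \<le> n \<Longrightarrow> F (i, j, p) (i, k, p) \<in> Cof C"
    "i \<le> j \<Longrightarrow> j \<le> k \<Longrightarrow> k \<le> n \<Longrightarrow> p \<le> n \<Longrightarrow>
       is_pushout C (F (i, j, p) (i, k, p)) (F (i, j, p) (j, j, p)) (F (i, k, p) (j, k, p)) (F (j, j, p) (j, k, p))"
    "i \<le> j \<Longrightarrow> j \<le> n \<Longrightarrow> p \<le> q \<Longrightarrow> q \<le> n \<Longrightarrow> F (i, j, p) (i, j, q) \<in> Weq C"
proof -
  note A = assms[unfolded wS_simplices_def mem_Collect_eq]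
  note c1 = A[THEN conjunct1] and A1 = A[THEN conjunct2]
  note c2 = A1[THEN conjunct1] and A2 = A1[THEN conjunct2]
  note c3 = A2[THEN conjunct1] and A3 = A2[THEN conjunct2]
  note c4 = A3[THEN conjunct1] and A4 = A3[THEN conjunct2]
  note c5 = A4[THEN conjunct1] and A5 = A4[THEN conjunct2]
  note c6 = A5[THEN conjunct1] and c7 = A5[THEN conjunct2]
  show "(x, y) \<notin> index_arrows n \<Longrightarrow> F x y = undefined" using c1 by blast
  show "x \<in> indices n \<Longrightarrow> Dom C (F x x) \<in> Obj C" "x \<in> indices n \<Longrightarrow> F x x = Idn C (Dom C (F x x))"
    using c2 by blast+
  show "(x, y) \<in> index_arrows n \<Longrightarrow> F x y \<in> Arr C" "(x, y) \<in> index_arrows n \<Longrightarrow> Dom C (F x y) = Dom C (F x x)"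
    "(x, y) \<in> index_arrows n \<Longrightarrow> Cod C (F x y) = Dom C (F y y)"
    using c3 by blast+
  show "(x, y) \<in> index_arrows n \<Longrightarrow> (y, z) \<in> index_arrows n \<Longrightarrow> F x z = Cmp C (F y z) (F x y)"
    using c4 by blast
  show "j \<le> n \<Longrightarrow> p \<le> n \<Longrightarrow> Dom C (F (j, j, p) (j, j, p)) = Zer C" using c5 by blast
  show "i \<le> j \<Longrightarrow> j \<le> k \<Longrightarrow> k \<le> n \<Longrightarrow> p \<le> n \<Longrightarrow> F (i, j, p) (i, k, p) \<in> Cof C"
    "i \<le> j \<Longrightarrow> j \<le> k \<Longrightarrow> k \<le> n \<Longrightarrow> p \<le> n \<Longrightarrow>
       is_pushout C (F (i, j, p) (i, k, p)) (F (i, j, p) (j, j, p)) (F (i, k, p) (j, k, p)) (F (j, j, p) (j, k, p))"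
    using c6 by simp_all
  show "i \<le> j \<Longrightarrow> j \<le> n \<Longrightarrow> p \<le> q \<Longrightarrow> q \<le> n \<Longrightarrow> F (i, j, p) (i, j, q) \<in> Weq C" using c7 by simp
qed

lemma bi_oper_in:
  assumes F: "F \<in> wS_simplices C n" and \<sigma>: "\<sigma> \<in> simplex_maps k n" and \<tau>: "\<tau> \<in> simplex_maps k n"
  shows "bi_oper k \<sigma> \<tau> F \<in> wS_simplices C k"
proof -
  let ?F = "bi_oper k \<sigma> \<tau> F"
  note D = wS_simplicesD[OF F]
  note \<sigma>D = simplex_mapsD[OF \<sigma>] and \<tau>D = simplex_mapsD[OF \<tau>] and B = bi_index_in[OF \<sigma> \<tau>]
  have eq: "?F x y = F (bi_index \<sigma> \<tau> x) (bi_index \<sigma> \<tau> y)" if "(x, y) \<in> index_arrows k" for x y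
    using that by (simp add: bi_oper_def)
  have eq3: "?F (i, j, p) (i', j', p') = F (\<sigma> i, \<sigma> j, \<tau> p) (\<sigma> i', \<sigma> j', \<tau> p')"
    if "i \<le> j" "j \<le> k" "i' \<le> j'" "j' \<le> k" "p \<le> p'" "p' \<le> k" "i \<le> i'" "j \<le> j'" for i j p i' j' p'
    using that by (subst eq) (auto simp: index_arrows_def indices_def bi_index_def)
  show ?thesis
    unfolding wS_simplices_def mem_Collect_eq
  proof (intro conjI ballI allI impI)
    fix x y assume "(x, y) \<notin> index_arrows k"
    then show "?F x y = undefined" by (auto simp: bi_oper_def)
  next
    fix x assume x: "x \<in> indices k"
    show "Dom C (?F x x) \<in> Obj C"
      "?F x x = Idn C (Dom C (?F x x))"
      using D(2,3)[OF B(1)[OF x]] by (simp_all add: eq[OF index_arrows_refl[OF x]])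
  next
    fix a assume "a \<in> index_arrows k"
    moreover obtain x y where "a = (x, y)" by (cases a)
    ultimately have a: "a = (x, y)" "(x, y) \<in> index_arrows k" by auto
    have "x \<in> indices k" "y \<in> indices k" using a by (auto simp: index_arrows_def)
    then show "case a of (x, y) \<Rightarrow> ?F x y \<in> Arr C \<and>
        Dom C (?F x y) = Dom C (?F x x) \<and>
        Cod C (?F x y) = Dom C (?F y y)"
      using D(4-6)[OF B(2)[OF a(2)]] a(2) by (simp add: a(1) eq index_arrows_refl)
  next
    fix x y z assume "(x, y) \<in> index_arrows k \<and> (y, z) \<in> index_arrows k"
    then have xyz: "(x, y) \<in> index_arrows k" "(y, z) \<in> index_arrows k" by auto
    then have "(x, z) \<in> index_arrows k" by (auto simp: index_arrows_def)
    then show "?F x z = Cmp C (?F y z) (?F x y)"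
      using D(7)[OF B(2)[OF xyz(1)] B(2)[OF xyz(2)]] xyz by (simp add: eq)
  next
    fix j p assume "j \<le> k" "p \<le> k"
    then show "Dom C (?F (j, j, p) (j, j, p)) = Zer C"
      using D(8)[OF \<sigma>D(1) \<tau>D(1), of j p] by (simp add: eq3)
  next
    fix i j l p assume "i \<le> j \<and> j \<le> l \<and> l \<le> k \<and> p \<le> k"
    then have *: "i \<le> j" "j \<le> l" "l \<le> k" "p \<le> k" "j \<le> k" "i \<le> k" "i \<le> l" by auto
    have **: "\<sigma> i \<le> \<sigma> j" "\<sigma> j \<le> \<sigma> l" "\<sigma> l \<le> n" "\<tau> p \<le> n" using * \<sigma>D \<tau>D by auto
    show "?F (i, j, p) (i, l, p) \<in> Cof C" using D(9)[OF **] * by (simp add: eq3)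
    show "is_pushout C (?F (i, j, p) (i, l, p)) (?F (i, j, p) (j, j, p))
       (?F (i, l, p) (j, l, p)) (?F (j, j, p) (j, l, p))"
      using D(10)[OF **] * by (simp add: eq3)
  next
    fix i j p q assume *: "i \<le> j \<and> j \<le> k \<and> p \<le> q \<and> q \<le> k"
    have "\<sigma> i \<le> \<sigma> j" "\<sigma> j \<le> n" "\<tau> p \<le> \<tau> q" "\<tau> q \<le> n" using * \<sigma>D \<tau>D by auto
    from D(11)[OF this] * show "?F (i, j, p) (i, j, q) \<in> Weq C" by (simp add: eq3)
  qed
qed

lemma bi_oper_comp:
  assumes "\<sigma>' \<in> simplex_maps j k" "\<tau>' \<in> simplex_maps j k"
  shows "bi_oper j \<sigma>' \<tau>' (bi_oper k \<sigma> \<tau> F) = bi_oper j (\<sigma> \<circ> \<sigma>') (\<tau> \<circ> \<tau>') F"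
proof -
  have "bi_index \<sigma> \<tau> (bi_index \<sigma>' \<tau>' x) = bi_index (\<sigma> \<circ> \<sigma>') (\<tau> \<circ> \<tau>') x" for x
    by (cases x) (simp add: bi_index_def)
  then show ?thesis
    using bi_index_in(2)[OF assms] by (auto simp: bi_oper_def fun_eq_iff)
qed

context finite_group
begin

abbreviation "ob F x \<equiv> fst (F x x)"

lemma FG_simplexD:
  assumes "F \<in> wS_simplices (FG M) n"
  shows "x \<in> indices n \<Longrightarrow> is_fg_module M (ob F x)" "x \<in> indices n \<Longrightarrow> F x x = arrow_id (ob F x)"
    "(x, y) \<in> index_arrows n \<Longrightarrow> F x y \<in> FG_arrows M" "(x, y) \<in> index_arrows n \<Longrightarrow> fst (F x y) = ob F x"
    "(x, y) \<in> index_arrows n \<Longrightarrow> snd (snd (F x y)) = ob F y"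
    "j \<le> n \<Longrightarrow> p \<le> n \<Longrightarrow> ob F (j, j, p) = zero_module"
  using wS_simplicesD[OF assms] by simp_all

subsection \<open>Building simplices\<close>

lemma FG_simplexI:
  assumes undef: "\<And>x y. (x, y) \<notin> index_arrows n \<Longrightarrow> F x y = undefined"
    and ob: "\<And>x. x \<in> indices n \<Longrightarrow> is_fg_module M (ob' x)" "\<And>x. x \<in> indices n \<Longrightarrow> F x x = arrow_id (ob' x)"
    and arr: "\<And>x y. (x, y) \<in> index_arrows n \<Longrightarrow> F x y \<in> FG_arrows M \<and> fst (F x y) = ob' x \<and> snd (snd (F x y)) = ob' y"
    and comp: "\<And>x y z. (x, y) \<in> index_arrows n \<Longrightarrow> (y, z) \<in> index_arrows n \<Longrightarrow> F x z = arrow_comp (F y z) (F x y)"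
    and zero: "\<And>j p. j \<le> n \<Longrightarrow> p \<le> n \<Longrightarrow> ob' (j, j, p) = zero_module"
    and cof: "\<And>i j k p. i \<le> j \<Longrightarrow> j \<le> k \<Longrightarrow> k \<le> n \<Longrightarrow> p \<le> n \<Longrightarrow> F (i, j, p) (i, k, p) \<in> FG_cofibrations M"
    and po: "\<And>i j k p. i \<le> j \<Longrightarrow> j \<le> k \<Longrightarrow> k \<le> n \<Longrightarrow> p \<le> n \<Longrightarrow>
       is_pushout (FG M) (F (i, j, p) (i, k, p)) (F (i, j, p) (j, j, p)) (F (i, k, p) (j, k, p)) (F (j, j, p) (j, k, p))"
    and weq: "\<And>i j p q. i \<le> j \<Longrightarrow> j \<le> n \<Longrightarrow> p \<le> q \<Longrightarrow> q \<le> n \<Longrightarrow> F (i, j, p) (i, j, q) \<in> FG_isos M"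
  shows "F \<in> wS_simplices (FG M) n"
proof -
  have fst: "fst (F x x) = ob' x" if "x \<in> indices n" for x
    using ob(2)[OF that] by (simp add: arrow_id_def)
  show ?thesis
    unfolding wS_simplices_def mem_Collect_eq FG_simps
  proof (intro conjI ballI allI impI)
    fix x assume "x \<in> indices n"
    then show "is_fg_module M (fst (F x x))" "F x x = arrow_id (fst (F x x))" using fst ob by simp_all
  next
    fix a assume "a \<in> index_arrows n"
    moreover obtain x y where "a = (x, y)" by (cases a)
    ultimately have a: "a = (x, y)" "(x, y) \<in> index_arrows n" by auto
    have "x \<in> indices n" "y \<in> indices n" using a by (auto simp: index_arrows_def)
    then show "case a of (x, y) \<Rightarrow> F x y \<in> FG_arrows M \<and> fst (F x y) = fst (F x x) \<and> snd (snd (F x y)) = fst (F y y)"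
      using arr[OF a(2)] fst by (simp add: a(1))
  next
    fix j p assume "j \<le> n" "p \<le> n"
    then show "fst (F (j, j, p) (j, j, p)) = zero_module"
      using fst[of "(j, j, p)"] zero[of j p] by (simp add: indices_def)
  qed (use undef comp cof po weq in auto)
qed

lemma pushout_id_left:
  fixes g :: "('a option, 'd::zero) pmod_arrow"
  assumes "g \<in> FG_arrows M"
  shows "is_pushout (FG M) (arrow_id (fst g)) g g (arrow_id (snd (snd g)))"
proof -
  obtain A f B where g: "g = (A, f, B)" by (cases g)
  note fg = arrowD(1,2)[OF assms[unfolded g]]
  have c: "arrow_comp h' (arrow_id (fst h')) = h'" "arrow_comp (arrow_id (snd (snd h'))) h' = h'" if "h' \<in> FG_arrows M"
    for h' :: "('a option, 'd) pmod_arrow"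
  proof -
    obtain S f T where h': "h' = (S, f, T)" by (cases h')
    show "arrow_comp h' (arrow_id (fst h')) = h'" "arrow_comp (arrow_id (snd (snd h'))) h' = h'"
      using comp_id[of S f T] that by (simp_all add: h')
  qed
  show ?thesis
    unfolding is_pushout_def FG_simps
  proof (intro conjI ballI impI)
    fix h' k' assume h: "h' \<in> FG_arrows M" "k' \<in> FG_arrows M"
      "fst h' = snd (snd (arrow_id (fst g))) \<and> fst k' = snd (snd g) \<and> snd (snd h') = snd (snd k') \<and>
       arrow_comp h' (arrow_id (fst g)) = arrow_comp k' g"
    have id: "snd (snd (arrow_id S)) = S" "fst (arrow_id S) = S" for S :: "('a option, 'd) pmod"
      by (simp_all add: arrow_id_def)
    have h': "h' = arrow_comp k' g" using h c(1)[OF h(1)] by (simp add: id)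
    show "\<exists>!u. u \<in> FG_arrows M \<and> fst u = snd (snd g) \<and> snd (snd u) = snd (snd h') \<and>
        arrow_comp u g = h' \<and> arrow_comp u (arrow_id (snd (snd g))) = k'"
    proof (rule ex1I[of _ k'])
      show "k' \<in> FG_arrows M \<and> fst k' = snd (snd g) \<and> snd (snd k') = snd (snd h') \<and>
        arrow_comp k' g = h' \<and> arrow_comp k' (arrow_id (snd (snd g))) = k'"
        using h h' c(1)[OF h(2)] by simp
      fix u assume u: "u \<in> FG_arrows M \<and> fst u = snd (snd g) \<and> snd (snd u) = snd (snd h') \<and>
        arrow_comp u g = h' \<and> arrow_comp u (arrow_id (snd (snd g))) = k'"
      then show "u = k'" using c(1)[of u] by simp
    qed
  qed (use assms id_in fg c[OF assms] in \<open>auto simp: g arrow_id_def\<close>)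
qed

lemma pushout_sym: "is_pushout C f g h k \<Longrightarrow> is_pushout C g f k h"
  unfolding is_pushout_def by (auto; metis)

lemma pushout_trivial:
  assumes arr: "f \<in> FG_arrows M" "g \<in> FG_arrows M" "h \<in> FG_arrows M" "k \<in> FG_arrows M"
    and ends: "fst f = fst g" "snd (snd f) = fst h" "snd (snd g) = fst k" "snd (snd h) = snd (snd k)"
    and triv: "trivial (fst f)" "trivial (fst h)" "trivial (fst k)" "trivial (snd (snd h))"
  shows "is_pushout (FG M) f g h k"
proof -
  have "arrow_comp h f = zero_arrow (fst f) (snd (snd h))" "arrow_comp k g = zero_arrow (fst f) (snd (snd h))"
    using comp_zero_arrow[OF arr(1,3)] comp_zero_arrow[OF arr(2,4)] ends triv by simp_all
  then show ?thesis
    unfolding is_pushout_def FG_simps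
  proof (intro conjI ballI impI)
    fix h' k' assume h: "h' \<in> FG_arrows M" "k' \<in> FG_arrows M"
      "fst h' = snd (snd f) \<and> fst k' = snd (snd g) \<and> snd (snd h') = snd (snd k') \<and> arrow_comp h' f = arrow_comp k' g"
    have E: "is_fg_module M (snd (snd h'))" using h(1) arrowD(2) by (cases h') auto
    let ?z = "zero_arrow (snd (snd h)) (snd (snd h'))"
    have z: "?z \<in> FG_arrows M" using zero_arrow_in[OF trivial_fg[OF triv(4)] E] .
    have "arrow_comp ?z h = h'" "arrow_comp ?z k = k'"
      using comp_zero_arrow[OF arr(3) z] comp_zero_arrow[OF arr(4) z] trivial_arrow[OF h(1)] trivial_arrow[OF h(2)]
        h(3) ends triv by auto
    then show "\<exists>!u. u \<in> FG_arrows M \<and> fst u = snd (snd h) \<and> snd (snd u) = snd (snd h') \<and>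
        arrow_comp u h = h' \<and> arrow_comp u k = k'"
    proof (intro ex1I[of _ ?z])
      fix u assume u: "u \<in> FG_arrows M \<and> fst u = snd (snd h) \<and> snd (snd u) = snd (snd h') \<and>
        arrow_comp u h = h' \<and> arrow_comp u k = k'"
      then show "u = ?z" using trivial_arrow[of u] triv(4) by simp
    qed (use z in simp)
  qed (use arr ends in auto)
qed

text \<open>Between zero objects all arrows are forced and every square is a pushout. So a family of
  objects, with \<open>zero_module\<close> at the places \<open>(j, j, p)\<close>, already is a
  simplex; the cones rest on this freedom.\<close>

definition trivial_simplex :: "nat \<Rightarrow> (index \<Rightarrow> ('a option, 'x) pmod) \<Rightarrow> index \<Rightarrow> index \<Rightarrow> ('a option, 'x) pmod_arrow" where
  "trivial_simplex n O' = (\<lambda>x y. if (x, y) \<in> index_arrows n then zero_arrow (O' x) (O' y) else undefined)"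

lemma trivial_simplex_in:
  assumes triv: "\<And>x. x \<in> indices n \<Longrightarrow> trivial (O' x)"
    and zero: "\<And>j p. j \<le> n \<Longrightarrow> p \<le> n \<Longrightarrow> O' (j, j, p) = zero_module"
  shows "trivial_simplex n O' \<in> wS_simplices (FG M) n"
proof (rule FG_simplexI[where ob' = O'])
  let ?F = "trivial_simplex n O'"
  have ends: "x \<in> indices n \<and> y \<in> indices n" if "(x, y) \<in> index_arrows n" for x y
    using that by (auto simp: index_arrows_def)
  have eq: "?F x y = zero_arrow (O' x) (O' y)" if "(x, y) \<in> index_arrows n" for x y
    using that by (simp add: trivial_simplex_def)
  show arr: "?F x y \<in> FG_arrows M \<and> fst (?F x y) = O' x \<and>
      snd (snd (?F x y)) = O' y" if "(x, y) \<in> index_arrows n" for x y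
    using ends[OF that] by (simp add: eq[OF that] zero_arrow_in trivial_fg triv)
  show "is_fg_module M (O' x)" if "x \<in> indices n" for x by (rule trivial_fg[OF triv[OF that]])
  show "?F x x = arrow_id (O' x)" if "x \<in> indices n" for x
    using arrow_id_trivial[OF triv[OF that]] eq[OF index_arrows_refl[OF that]] by simp
  show "?F x z = arrow_comp (?F y z) (?F x y)"
    if xyz: "(x, y) \<in> index_arrows n" "(y, z) \<in> index_arrows n" for x y z
  proof -
    have "(x, z) \<in> index_arrows n" using xyz by (auto simp: index_arrows_def)
    then show ?thesis
      using comp_zero_arrow[of "?F x y" "?F y z"] arr xyz ends triv by (simp add: eq)
  qed
  fix i j k p assume *: "i \<le> j" "j \<le> k" "k \<le> n" "p \<le> n"
  then have a: "((i, j, p), (i, k, p)) \<in> index_arrows n" "((i, j, p), (j, j, p)) \<in> index_arrows n"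
    "((i, k, p), (j, k, p)) \<in> index_arrows n" "((j, j, p), (j, k, p)) \<in> index_arrows n"
    by (auto simp: index_arrows_def indices_def)
  show "?F (i, j, p) (i, k, p) \<in> FG_cofibrations M"
    using ends[OF a(1)] by (simp add: eq[OF a(1)] iso_cofibration zero_arrow_iso triv)
  show "is_pushout (FG M) (?F (i, j, p) (i, k, p)) (?F (i, j, p) (j, j, p))
     (?F (i, k, p) (j, k, p)) (?F (j, j, p) (j, k, p))"
    using arr[OF a(1)] arr[OF a(2)] arr[OF a(3)] arr[OF a(4)] ends[OF a(1)] ends[OF a(4)] triv
    by (intro pushout_trivial) auto
next
  fix i j p q assume "i \<le> j" "j \<le> n" "p \<le> q" "q \<le> n"
  then have a: "((i, j, p), (i, j, q)) \<in> index_arrows n" by (auto simp: index_arrows_def indices_def)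
  then have "(i, j, p) \<in> indices n" "(i, j, q) \<in> indices n" by (auto simp: index_arrows_def)
  then show "trivial_simplex n O' (i, j, p) (i, j, q) \<in> FG_isos M"
    by (simp add: trivial_simplex_def a zero_arrow_iso triv)
qed (auto simp: trivial_simplex_def zero)

lemma trivial_simplex_unique:
  assumes F: "F \<in> wS_simplices (FG M) n" and triv: "\<And>x. x \<in> indices n \<Longrightarrow> trivial (ob F x)"
  shows "F = trivial_simplex n (ob F)"
proof (intro ext)
  fix x y
  show "F x y = trivial_simplex n (ob F) x y"
  proof (cases "(x, y) \<in> index_arrows n")
    case True
    then have "x \<in> indices n" by (auto simp: index_arrows_def)
    then show ?thesis
      using trivial_arrow[OF FG_simplexD(3)[OF F True]] FG_simplexD(4,5)[OF F True] triv True
      by (simp add: trivial_simplex_def)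
  qed (use wS_simplicesD(1)[OF F] in \<open>simp add: trivial_simplex_def\<close>)
qed

lemma bi_oper_trivial_simplex:
  assumes "\<sigma> \<in> simplex_maps k n" "\<tau> \<in> simplex_maps k n"
  shows "bi_oper k \<sigma> \<tau> (trivial_simplex n O') = trivial_simplex k (O' \<circ> bi_index \<sigma> \<tau>)"
  using bi_index_in(2)[OF assms] by (auto simp: bi_oper_def trivial_simplex_def fun_eq_iff)

lemma trivial_simplex_cong:
  assumes "\<And>x. x \<in> indices n \<Longrightarrow> O1 x = O2 x"
  shows "trivial_simplex n O1 = trivial_simplex n O2"
  using assms by (auto simp: trivial_simplex_def fun_eq_iff index_arrows_def)

subsection \<open>Heights and cones\<close>

definition base_vertex :: "index \<Rightarrow> index \<Rightarrow> ('a option, 'x::zero) pmod_arrow" where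
  "base_vertex = (\<lambda>x y. if (x, y) \<in> index_arrows 0 then arrow_id zero_module else undefined)"

text \<open>The base point is discounted so that zero modules get height 0. It is fixed by every
  subset of \<open>G\<close>, so the subtraction does not truncate.\<close>

definition mark_height :: "'a set \<Rightarrow> nat \<Rightarrow> (index \<Rightarrow> index \<Rightarrow> ('a option, 'x) pmod_arrow) \<Rightarrow> nat \<Rightarrow> nat" where
  "mark_height H n F i = card (fixed_points H (ob F (0, i, 0))) - 1"

text \<open>The one-point modules of \<open>F\<close> are kept rather than replaced by
  \<open>zero_module\<close>, because the face opposite the apex has to equal \<open>F\<close> and
  not only be isomorphic to it. Putting \<open>zero_module\<close> for all other objects makes the
  formula a simplex, natural in \<open>F\<close>, in every case.\<close>

definition cone :: "nat \<Rightarrow> (index \<Rightarrow> index \<Rightarrow> ('a option, 'x::zero) pmod_arrow) \<Rightarrow> index \<Rightarrow> index \<Rightarrow> ('a option, 'x) pmod_arrow" where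
  "cone n F = trivial_simplex (Suc n) (\<lambda>(i, j, p). case (i, j, p) of
     (Suc i', Suc j', Suc p') \<Rightarrow> if trivial (ob F (i', j', p')) then ob F (i', j', p') else zero_module
   | _ \<Rightarrow> zero_module)"

lemma base_vertex_eq: "base_vertex = trivial_simplex 0 (\<lambda>x. zero_module)"
  by (simp add: base_vertex_def trivial_simplex_def arrow_id_trivial[OF trivial_zero] cong: if_cong)

lemma wS_vertices: "wS_simplices (FG M) 0 = {base_vertex}"
proof
  show "{base_vertex} \<subseteq> wS_simplices (FG M) 0"
    by (auto simp: base_vertex_eq trivial_zero intro!: trivial_simplex_in)
  show "wS_simplices (FG M) 0 \<subseteq> {base_vertex}"
  proof
    fix F assume F: "F \<in> wS_simplices (FG M) 0"
    have *: "ob F x = zero_module" if "x \<in> indices 0" for x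
      using that FG_simplexD(6)[OF F, of 0 0] by (auto simp: indices_def)
    then have "F = trivial_simplex 0 (ob F)"
      by (intro trivial_simplex_unique[OF F]) (simp add: trivial_zero)
    also have "\<dots> = base_vertex"
      unfolding base_vertex_eq by (rule trivial_simplex_cong) (rule *)
    finally show "F \<in> {base_vertex}" by simp
  qed
qed

text \<open>The object \<open>(j, j, p)\<close> is zero, so the pushout square in the definition of
  a simplex is a cofibre sequence with the objects at \<open>(i, j)\<close>, \<open>(i, k)\<close>
  and \<open>(j, k)\<close>.\<close>

lemma card_fixed_points_edge:
  assumes F: "F \<in> wS_simplices (FG M) n" and "i \<le> j" "j \<le> k" "k \<le> n" "p \<le> n"
  shows "card (fixed_points H (ob F (i, k, p))) + 1 =
     card (fixed_points H (ob F (i, j, p))) + card (fixed_points H (ob F (j, k, p)))"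
proof -
  have a: "((i, j, p), (i, k, p)) \<in> index_arrows n" "((i, j, p), (j, j, p)) \<in> index_arrows n"
    "((i, k, p), (j, k, p)) \<in> index_arrows n"
    using assms by (auto simp: index_arrows_def indices_def)
  have "card (fixed_points H (snd (snd (F (i, j, p) (i, k, p))))) + 1 =
     card (fixed_points H (fst (F (i, j, p) (i, k, p)))) + card (fixed_points H (snd (snd (F (i, k, p) (j, k, p)))))"
  proof (rule card_fixed_points_pushout)
    show "is_pushout (FG M) (F (i, j, p) (i, k, p)) (F (i, j, p) (j, j, p)) (F (i, k, p) (j, k, p)) (F (j, j, p) (j, k, p))"
      "F (i, j, p) (i, k, p) \<in> FG_cofibrations M"
      using wS_simplicesD(9,10)[OF F assms(2-5)] by simp_all
    show "trivial (snd (snd (F (i, j, p) (j, j, p))))"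
      using FG_simplexD(5)[OF F a(2)] FG_simplexD(6)[OF F, of j p] assms trivial_zero by simp
  qed
  then show ?thesis using FG_simplexD(4,5)[OF F a(1)] FG_simplexD(5)[OF F a(3)] by simp
qed

lemma card_fixed_points_stage:
  assumes F: "F \<in> wS_simplices (FG M) n" and "i \<le> j" "j \<le> n" "p \<le> n"
  shows "card (fixed_points H (ob F (i, j, p))) = card (fixed_points H (ob F (i, j, 0)))"
proof -
  have a: "((i, j, 0), (i, j, p)) \<in> index_arrows n" using assms by (auto simp: index_arrows_def indices_def)
  have "F (i, j, 0) (i, j, p) \<in> FG_isos M" using wS_simplicesD(11)[OF F, of i j 0 p] assms by simp
  moreover obtain S f T where "F (i, j, 0) (i, j, p) = (S, f, T)" by (metis prod_cases3)
  ultimately show ?thesis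
    using card_fixed_points_iso[of S f T H] FG_simplexD(4,5)[OF F a] by simp
qed

text \<open>The heights determine the fixed points of every object, at every stage. Both the cocycle
  condition and, for \<open>H = {}\<close>, the recognition of simplices of zero modules follow. The
  additive form avoids truncated subtraction.\<close>

lemma card_fixed_points_height:
  assumes F: "F \<in> wS_simplices (FG M) n" and "i \<le> j" "j \<le> n" "p \<le> n"
  shows "card (fixed_points H (ob F (i, j, p))) + mark_height H n F i = mark_height H n F j + 1"
proof -
  have fg: "is_fg_module M (ob F (0, l, 0))" if "l \<le> n" for l
    using FG_simplexD(1)[OF F] that by (simp add: indices_def)
  have "card (fixed_points H (ob F (0, j, 0))) + 1 =
     card (fixed_points H (ob F (0, i, 0))) + card (fixed_points H (ob F (i, j, 0)))"
    using card_fixed_points_edge[OF F, of 0 i j 0] assms by simp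
  then show ?thesis
    using card_fixed_points_stage[OF assms] card_fixed_points_pos[OF fg[of i], of H] card_fixed_points_pos[OF fg[of j], of H] assms
    by (simp add: mark_height_def)
qed

lemma ob_bi_oper:
  assumes "x \<in> indices k"
  shows "ob (bi_oper k \<sigma> \<tau> F) x = ob F (bi_index \<sigma> \<tau> x)"
  using index_arrows_refl[OF assms] by (simp add: bi_oper_def)

lemma wS_reduced: "reduced_sset (wS (FG M)) (base_vertex :: index \<Rightarrow> index \<Rightarrow> ('a option, 'x::zero) pmod_arrow)"
proof
  fix \<theta> k n and F :: "index \<Rightarrow> index \<Rightarrow> ('a option, 'x) pmod_arrow"
  assume "\<theta> \<in> simplex_maps k n" "F \<in> simp (wS (FG M)) n"
  then show "oper (wS (FG M)) k n \<theta> F \<in> simp (wS (FG M)) k" by (simp add: oper_wS bi_oper_in)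
qed (simp add: wS_vertices)

lemma wS_graded:
  "graded_sset (wS (FG M)) (base_vertex :: index \<Rightarrow> index \<Rightarrow> ('a option, 'x::zero) pmod_arrow) (mark_height H)"
proof (intro graded_sset.intro wS_reduced graded_sset_axioms.intro)
  fix \<theta> k n i and F :: "index \<Rightarrow> index \<Rightarrow> ('a option, 'x) pmod_arrow"
  assume \<theta>: "\<theta> \<in> simplex_maps k n" and "F \<in> simp (wS (FG M)) n" and i: "i \<le> k"
  then have F: "F \<in> wS_simplices (FG M) n" by simp
  have x: "(0, i, 0) \<in> indices k" using i by (simp add: indices_def)
  have "card (fixed_points H (ob F (\<theta> 0, \<theta> i, \<theta> 0))) + mark_height H n F (\<theta> 0) = mark_height H n F (\<theta> i) + 1"
    using simplex_mapsD[OF \<theta>] i by (intro card_fixed_points_height[OF F]) auto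
  moreover have "card (fixed_points H (ob F (\<theta> 0, \<theta> i, \<theta> 0))) > 0"
    using bi_index_in(1)[OF \<theta> \<theta> x] FG_simplexD(1)[OF F] by (intro card_fixed_points_pos) (simp add: bi_index_def)
  ultimately show "mark_height H k (oper (wS (FG M)) k n \<theta> F) i + mark_height H n F (\<theta> 0) = mark_height H n F (\<theta> i)"
    by (simp add: mark_height_def[of H k] oper_wS ob_bi_oper[OF x] bi_index_def)
qed

lemma wS_conical:
  "conical_sset (wS (FG M)) (base_vertex :: index \<Rightarrow> index \<Rightarrow> ('a option, 'x::zero) pmod_arrow) (mark_height {}) cone"
proof (intro conical_sset.intro wS_graded conical_sset_axioms.intro)
  fix n and F :: "index \<Rightarrow> index \<Rightarrow> ('a option, 'x) pmod_arrow"
  assume "F \<in> simp (wS (FG M)) n"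
  then have F: "F \<in> wS_simplices (FG M) n" by simp
  show "cone n F \<in> simp (wS (FG M)) (Suc n)"
    unfolding cone_def simp_wS
    by (rule trivial_simplex_in) (auto simp: trivial_zero FG_simplexD(6)[OF F] split: nat.split)
  show "oper (wS (FG M)) n (Suc n) Suc (cone n F) = F" if h: "\<And>i. i \<le> n \<Longrightarrow> mark_height {} n F i = 0"
  proof -
    have triv: "trivial (ob F x)" if "x \<in> indices n" for x
    proof -
      obtain i j p where x: "x = (i, j, p)" "i \<le> j" "j \<le> n" "p \<le> n"
        using \<open>x \<in> indices n\<close> by (cases x) (auto simp: indices_def)
      then show ?thesis
        using card_fixed_points_height[OF F x(2-4), of "{}"] h[of i] h[of j] FG_simplexD(1)[OF F \<open>x \<in> indices n\<close>]
        by (simp add: trivial_iff_card)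
    qed
    have Suc: "Suc \<in> simplex_maps n (Suc n)" by (auto simp: simplex_maps_def mono_on_def)
    have "oper (wS (FG M)) n (Suc n) Suc (cone n F) = trivial_simplex n (ob F)"
      unfolding oper_wS cone_def bi_oper_trivial_simplex[OF Suc Suc]
    proof (intro trivial_simplex_cong)
      fix x assume x: "x \<in> indices n"
      obtain i j p where "x = (i, j, p)" by (cases x)
      then show "((\<lambda>(i, j, p). case (i, j, p) of
           (Suc i', Suc j', Suc p') \<Rightarrow> if trivial (ob F (i', j', p')) then ob F (i', j', p') else zero_module
         | _ \<Rightarrow> zero_module) \<circ> bi_index Suc Suc) x = ob F x"
        using triv[OF x] by (simp add: bi_index_def)
    qed
    also have "\<dots> = F" using trivial_simplex_unique[OF F triv] by (rule sym)
    finally show ?thesis .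
  qed
next
  fix \<theta> k n and F :: "index \<Rightarrow> index \<Rightarrow> ('a option, 'x) pmod_arrow"
  assume \<theta>: "\<theta> \<in> simplex_maps k n" and "F \<in> simp (wS (FG M)) n"
  have \<theta>': "case_nat 0 (Suc \<circ> \<theta>) \<in> simplex_maps (Suc k) (Suc n)"
    using \<theta> by (auto simp: simplex_maps_def mono_on_def image_subset_iff split: nat.splits)
  have "ob (bi_oper k \<theta> \<theta> F) (i, j, p) = ob F (\<theta> i, \<theta> j, \<theta> p)" if "i \<le> j" "j \<le> k" "p \<le> k" for i j p
    using ob_bi_oper[of "(i, j, p)" k \<theta> \<theta> F] that by (simp add: indices_def bi_index_def)
  then show "cone k (oper (wS (FG M)) k n \<theta> F) = oper (wS (FG M)) (Suc k) (Suc n) (case_nat 0 (Suc \<circ> \<theta>)) (cone n F)"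
    unfolding oper_wS cone_def bi_oper_trivial_simplex[OF \<theta>' \<theta>']
    by (intro trivial_simplex_cong) (auto simp: bi_index_def indices_def split: nat.splits)
qed

end

context finite_group
begin

subsection \<open>Edges given by isomorphisms\<close>

definition iso_ob :: "('a option, 'x::zero) pmod_arrow \<Rightarrow> index \<Rightarrow> ('a option, 'x) pmod" where
  "iso_ob a = (\<lambda>(i, j, p). if i = 0 \<and> j = 1 then if p = 0 then fst a else snd (snd a) else zero_module)"

definition iso_simplex :: "('a option, 'x::zero) pmod_arrow \<Rightarrow> index \<Rightarrow> index \<Rightarrow> ('a option, 'x) pmod_arrow" where
  "iso_simplex a = (\<lambda>(i, j, p) (i', j', p').
     if ((i, j, p), (i', j', p')) \<in> index_arrows 1 then
       if (i, j) = (0, 1) \<and> (i', j') = (0, 1) then if p = p' then arrow_id (iso_ob a (i, j, p)) else a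
       else zero_arrow (iso_ob a (i, j, p)) (iso_ob a (i', j', p'))
     else undefined)"

lemma iso_ob_fg:
  assumes "a \<in> FG_isos M"
  shows "is_fg_module M (iso_ob a x)" "iso_ob a x = zero_module \<or> (\<exists>p. x = (0, 1, p))"
proof -
  obtain S f T where a: "a = (S, f, T)" by (cases a)
  have "is_fg_module M S" "is_fg_module M T" using arrowD(1,2)[OF iso_bij(1)[OF assms[unfolded a]]] .
  then show "is_fg_module M (iso_ob a x)" "iso_ob a x = zero_module \<or> (\<exists>p. x = (0, 1, p))"
    by (auto simp: iso_ob_def a trivial_fg trivial_zero split: prod.splits)
qed

lemma iso_simplex_in:
  fixes a :: "('a option, 'x::zero) pmod_arrow"
  assumes "a \<in> FG_isos M"
  shows "iso_simplex a \<in> wS_simplices (FG M) 1"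
proof -
  let ?F = "iso_simplex a" and ?O = "iso_ob a"
  note fg = iso_ob_fg[OF assms]
  obtain S f T where a: "a = (S, f, T)" by (cases a)
  have aarr: "a \<in> FG_arrows M" using iso_bij(1)[of S f T] assms a by simp
  have cid: "arrow_comp c (arrow_id (fst c)) = c" "arrow_comp (arrow_id (snd (snd c))) c = c"
    if "c \<in> FG_arrows M" for c :: "('a option, 'x) pmod_arrow"
    using comp_id[of "fst c" "fst (snd c)" "snd (snd c)"] that by simp_all
  have idid: "arrow_comp (arrow_id Q) (arrow_id Q) = arrow_id Q" if "is_fg_module M Q" for Q :: "('a option, 'x) pmod"
    using cid(1)[OF id_in[OF that]] by (simp add: arrow_id_def)
  have Fid: "?F x x = arrow_id (?O x)" if "x \<in> indices 1" for x
    using index_arrows_refl[OF that] fg(2)[of x]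
    by (cases x) (auto simp: iso_simplex_def arrow_id_trivial[OF trivial_zero])
  have arr: "?F x y \<in> FG_arrows M \<and> fst (?F x y) = ?O x \<and> snd (snd (?F x y)) = ?O y"
    if "(x, y) \<in> index_arrows 1" for x y
  proof -
    obtain i j p where x: "x = (i, j, p)" by (cases x)
    obtain i' j' p' where y: "y = (i', j', p')" by (cases y)
    have p: "p \<le> p'" "p' \<le> 1" using that by (auto simp: x y index_arrows_def indices_def)
    show ?thesis
    proof (cases "(i, j) = (0, 1) \<and> (i', j') = (0, 1)")
      case True
      then have ij: "i = 0" "j = 1" "i' = 0" "j' = 1" by auto
      consider "p = p'" | "p = 0" "p' = 1" using p by linarith
      then show ?thesis
      proof cases
        case 1
        then have "?F x y = arrow_id (?O x)" "?O y = ?O x" using that ij by (simp_all add: iso_simplex_def x y)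
        then show ?thesis using id_in[OF fg(1)[of x]] by (simp add: arrow_id_def)
      next
        case 2
        then show ?thesis using that ij aarr by (simp add: iso_simplex_def x y iso_ob_def)
      qed
    next
      case False
      then have "?F x y = zero_arrow (?O x) (?O y)" using that by (auto simp: iso_simplex_def x y)
      then show ?thesis using zero_arrow_in[OF fg(1) fg(1)] by simp
    qed
  qed
  have comp: "?F x z = arrow_comp (?F y z) (?F x y)" if xyz: "(x, y) \<in> index_arrows 1" "(y, z) \<in> index_arrows 1" for x y z
  proof -
    obtain i j p where x: "x = (i, j, p)" by (cases x)
    obtain i' j' p' where y: "y = (i', j', p')" by (cases y)
    obtain i'' j'' p'' where z: "z = (i'', j'', p'')" by (cases z)
    have xz: "(x, z) \<in> index_arrows 1" using xyz by (auto simp: index_arrows_def)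
    show ?thesis
    proof (cases "(i, j) = (0, 1) \<and> (i'', j'') = (0, 1)")
      case True
      then have ij: "i = 0" "j = 1" "i' = 0" "j' = 1" "i'' = 0" "j'' = 1" "p \<le> p'" "p' \<le> p''" "p'' \<le> 1"
        using xyz by (auto simp: x y z index_arrows_def indices_def)
      then consider "p = p'" "p' = p''" | "p = p'" "p = 0" "p'' = 1" | "p = 0" "p' = 1" "p'' = 1" by linarith
      then show ?thesis
        using xyz xz ij cid[OF aarr] idid fg(1)[of x]
        by cases (simp_all add: iso_simplex_def x y z iso_ob_def)
    next
      case False
      then have F: "?F x z = zero_arrow (?O x) (?O z)" using xz by (auto simp: iso_simplex_def x z)
      have "trivial (?O x) \<or> trivial (?O z)" using False fg(2)[of x] fg(2)[of z] trivial_zero by (auto simp: x z)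
      then show ?thesis
        using comp_zero_arrow[of "?F x y" "?F y z"] arr[OF xyz(1)] arr[OF xyz(2)] F by simp
    qed
  qed
  show ?thesis
  proof (rule FG_simplexI[where ob' = ?O])
    fix i j k p :: nat assume *: "i \<le> j" "j \<le> k" "k \<le> 1" "p \<le> 1"
    have ind: "((i, j, p), (i, k, p)) \<in> index_arrows 1" "((i, i, p), (i, k, p)) \<in> index_arrows 1"
      "((i, k, p), (k, k, p)) \<in> index_arrows 1"
      "(i, i, p) \<in> indices 1" "(i, k, p) \<in> indices 1" "(k, k, p) \<in> indices 1"
      using * by (auto simp: index_arrows_def indices_def)
    consider "i = j" | "j = k" using * by linarith
    note cs = this
    show "?F (i, j, p) (i, k, p) \<in> FG_cofibrations M"
      using cs
    proof cases
      case 1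
      then have "?F (i, j, p) (i, k, p) = zero_arrow (?O (i, i, p)) (?O (i, k, p))" "?O (i, i, p) = zero_module"
        using ind by (auto simp: iso_simplex_def iso_ob_def)
      then show ?thesis using zero_cofibration[OF trivial_zero fg(1)] by simp
    next
      case 2
      then show ?thesis using Fid[OF ind(5)] iso_cofibration[OF arrow_id_iso[OF fg(1)]] by simp
    qed
    show "is_pushout (FG M) (?F (i, j, p) (i, k, p)) (?F (i, j, p) (j, j, p)) (?F (i, k, p) (j, k, p)) (?F (j, j, p) (j, k, p))"
      using cs
    proof cases
      case 1
      then show ?thesis
        using pushout_sym[OF pushout_id_left[of "?F (i, i, p) (i, k, p)"]] arr[OF ind(2)] Fid[OF ind(4)] Fid[OF ind(5)] by simp
    next
      case 2
      then show ?thesis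
        using pushout_id_left[of "?F (i, k, p) (k, k, p)"] arr[OF ind(3)] Fid[OF ind(5)] Fid[OF ind(6)] by simp
    qed
  next
    fix i j p q :: nat assume *: "i \<le> j" "j \<le> 1" "p \<le> q" "q \<le> 1"
    then have ind: "((i, j, p), (i, j, q)) \<in> index_arrows 1" by (auto simp: index_arrows_def indices_def)
    show "?F (i, j, p) (i, j, q) \<in> FG_isos M"
    proof (cases "(i, j) = (0, 1)")
      case True
      then show ?thesis
        using ind assms by (auto simp: iso_simplex_def arrow_id_iso fg(1))
    next
      case False
      then have "?F (i, j, p) (i, j, q) = zero_arrow zero_module zero_module"
        using ind by (auto simp: iso_simplex_def iso_ob_def)
      then show ?thesis using zero_arrow_iso[OF trivial_zero trivial_zero] by simp
    qed
  qed (use arr comp Fid fg in \<open>auto simp: iso_simplex_def iso_ob_def\<close>)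
qed

text \<open>Every other arrow of the edge is an identity or has a zero object at one end, so this
  single arrow determines the edge. Therefore the description in \<open>object_simplex\<close> picks
  out a unique simplex.\<close>

lemma edge_eqI:
  assumes F: "F \<in> wS_simplices (FG M) 1" and F': "F' \<in> wS_simplices (FG M) 1"
    and eq: "F (0, 1, 0) (0, 1, 1) = F' (0, 1, 0) (0, 1, 1)"
  shows "F = F'"
proof -
  have a: "((0, 1, 0), (0, 1, 1)) \<in> index_arrows 1" by (simp add: index_arrows_def indices_def)
  have "ob F (0, 1, 0) = ob F' (0, 1, 0)" "ob F (0, 1, 1) = ob F' (0, 1, 1)"
    using FG_simplexD(4,5)[OF F a] FG_simplexD(4,5)[OF F' a] eq by simp_all
  then have ob1: "ob F (0, 1, p) = ob F' (0, 1, p)" if "p \<le> 1" for p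
    using that by (cases "p = 0") (auto simp: le_Suc_eq)
  have zob: "ob F (j, j, p) = zero_module" "ob F' (j, j, p) = zero_module" if "j \<le> 1" "p \<le> 1" for j p
    using FG_simplexD(6)[OF F that] FG_simplexD(6)[OF F' that] by simp_all
  have indc: "(\<exists>p\<le>1. x = (0, 1, p)) \<or> (\<exists>j\<le>1. \<exists>p\<le>1. x = (j, j, p))" if "x \<in> indices 1" for x
  proof -
    obtain i j p where "x = (i, j, p)" by (cases x)
    with that show ?thesis by (cases "i = j") (auto simp: indices_def)
  qed
  have obs: "ob F x = ob F' x" if "x \<in> indices 1" for x
    using indc[OF that] ob1 zob by (elim disjE exE conjE) simp_all
  show ?thesis
  proof (intro ext)
    fix x y
    show "F x y = F' x y"
    proof (cases "(x, y) \<in> index_arrows 1")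
      case True
      then have xy: "x \<in> indices 1" "y \<in> indices 1" by (auto simp: index_arrows_def)
      have triv: "F x y = F' x y" if "trivial (ob F x) \<or> trivial (ob F y)"
        using trivial_arrow[OF FG_simplexD(3)[OF F True]] trivial_arrow[OF FG_simplexD(3)[OF F' True]]
          FG_simplexD(4,5)[OF F True] FG_simplexD(4,5)[OF F' True] obs[OF xy(1)] obs[OF xy(2)] that by simp
      show ?thesis
      proof (cases "trivial (ob F x) \<or> trivial (ob F y)")
        case False
        then have "\<not> (\<exists>j\<le>1. \<exists>p\<le>1. x = (j, j, p))" "\<not> (\<exists>j\<le>1. \<exists>p\<le>1. y = (j, j, p))"
          using zob trivial_zero by auto
        then obtain p q where pq: "x = (0, 1, p)" "y = (0, 1, q)" "p \<le> 1" "q \<le> 1"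
          using indc[OF xy(1)] indc[OF xy(2)] by blast
        have "p \<le> q" using True by (simp add: pq index_arrows_def)
        then have "p = q \<or> p = 0 \<and> q = 1" using pq by linarith
        then consider "x = y" | "p = 0" "q = 1" using pq by blast
        then show ?thesis
        proof cases
          case 1
          then show ?thesis using FG_simplexD(2)[OF F xy(1)] FG_simplexD(2)[OF F' xy(1)] obs[OF xy(1)] by simp
        next
          case 2
          then show ?thesis using eq pq by simp
        qed
      qed (rule triv)
    qed (use wS_simplicesD(1)[OF F] wS_simplicesD(1)[OF F'] in simp)
  qed
qed

lemma object_simplex_eqI:
  assumes "F \<in> wS_simplices (FG M) 1" "F (0, 1, 0) (0, 1, 1) = arrow_id S"
  shows "object_simplex (FG M) S = F"
  unfolding object_simplex_def FG_simps
proof (rule the_equality)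
  fix F' assume "F' \<in> wS_simplices (FG M) 1 \<and> F' (0, 1, 0) (0, 1, 1) = arrow_id S"
  then show "F' = F" by (intro edge_eqI) (simp_all only: assms)
qed (use assms in simp)

subsection \<open>Two-simplices given by filtered \<open>G\<close>-sets\<close>

text \<open>\<open>D\<close> is the quotient of \<open>B\<close> by the image of \<open>A\<close>,
  represented on those points of \<open>B\<close> that are not collapsed. The induced map on
  \<open>D\<close> is then just the restriction of the given map on \<open>B\<close>.\<close>

lemma pushoutI_submodule:
  assumes arr: "(A, f, B) \<in> FG_arrows M" "(A, g, Z) \<in> FG_arrows M" "(B, h, D) \<in> FG_arrows M" "(Z, k, D) \<in> FG_arrows M"
    and triv: "trivial Z"
    and sub: "mpts D \<subseteq> mpts B" "mbase D = mbase B" "\<And>d. d \<in> mpts D \<Longrightarrow> h d = d"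
      "\<And>d x. d \<in> mpts D \<Longrightarrow> x \<in> carrier G \<Longrightarrow> mact D d (Some x) = mact B d (Some x)"
    and rest: "\<And>b. b \<in> mpts B \<Longrightarrow> b \<notin> mpts D \<Longrightarrow> h b = mbase D \<and> b \<in> f ` mpts A"
    and hf: "\<And>a. a \<in> mpts A \<Longrightarrow> h (f a) = mbase D"
  shows "is_pushout (FG M) (A, f, B) (A, g, Z) (B, h, D) (Z, k, D)"
proof -
  have Z: "mpts Z = {mbase Z}" using triv by (simp add: trivial_def)
  have gZ: "g a = mbase Z" if "a \<in> mpts A" for a using arrowD(3)[OF arr(2) that] Z by simp
  have kZ: "k (mbase Z) = mbase D" using arrowD(5)[OF arr(4)] .
  have "compose (mpts A) h f = compose (mpts A) k g"
    using hf gZ kZ by (auto simp: compose_def fun_eq_iff restrict_def)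
  then show ?thesis
    unfolding is_pushout_def FG_simps
  proof (intro conjI ballI impI)
    fix h' k' assume hk: "h' \<in> FG_arrows M" "k' \<in> FG_arrows M"
      "fst h' = snd (snd (A, f, B)) \<and> fst k' = snd (snd (A, g, Z)) \<and> snd (snd h') = snd (snd k') \<and>
       arrow_comp h' (A, f, B) = arrow_comp k' (A, g, Z)"
    obtain q E where h': "h' = (B, q, E)" using hk(3) by (cases h') auto
    obtain l where k': "k' = (Z, l, E)" using hk(3) h' by (cases k') auto
    note Q = arrowD[OF hk(1)[unfolded h']] and L = arrowD[OF hk(2)[unfolded k']]
    note Dm = fg_moduleD[OF arrowD(2)[OF arr(3)]]
    have qf: "q (f a) = mbase E" if "a \<in> mpts A" for a
    proof -
      have "compose (mpts A) q f = compose (mpts A) l g" using hk(3) by (simp add: h' k' comp_simp)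
      then have "q (f a) = l (g a)" using that by (metis compose_eq)
      then show ?thesis using gZ[OF that] L(5) by simp
    qed
    let ?u = "restrict q (mpts D)"
    have u: "(D, ?u, E) \<in> FG_arrows M"
      unfolding arrow_iff using Q Dm(2,3) sub arrowD(2)[OF arr(3)] by (auto simp: subset_iff)
    have "compose (mpts B) ?u h = q"
    proof
      fix b
      show "compose (mpts B) ?u h b = q b"
      proof (cases "b \<in> mpts B")
        case True
        show ?thesis
        proof (cases "b \<in> mpts D")
          case False
          then obtain a where "a \<in> mpts A" "b = f a" "h b = mbase D" using rest[OF True] by blast
          then show ?thesis using True Dm(2) qf Q(5) sub(2) by (simp add: compose_def)
        qed (use True sub in \<open>simp add: compose_def\<close>)
      qed (use Q(4) in \<open>auto simp: compose_def extensional_def\<close>)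
    qed
    moreover have "compose (mpts Z) ?u k = l"
    proof
      fix z
      show "compose (mpts Z) ?u k z = l z"
      proof (cases "z \<in> mpts Z")
        case True
        then have "z = mbase Z" using Z by auto
        then show ?thesis using True kZ Dm(2) Q(5) L(5) sub(2) by (simp add: compose_def)
      qed (use L(4) in \<open>simp add: compose_def extensional_def\<close>)
    qed
    moreover have "u' = ?u" if "(D, u', E) \<in> FG_arrows M" "compose (mpts B) u' h = q" for u'
    proof (rule arrow_eqI[OF that(1) u])
      fix d assume d: "d \<in> mpts D"
      then have "u' (h d) = q d" using compose_eq[of d "mpts B" u' h] that(2) sub(1) by auto
      then show "u' d = ?u d" using d sub(3) by simp
    qed
    ultimately have u1: "compose (mpts B) ?u h = q" "compose (mpts Z) ?u k = l"
      and u2: "\<And>u'. (D, u', E) \<in> FG_arrows M \<Longrightarrow> compose (mpts B) u' h = q \<Longrightarrow> u' = ?u" by blast+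
    show "\<exists>!u. u \<in> FG_arrows M \<and> fst u = snd (snd (B, h, D)) \<and> snd (snd u) = snd (snd h') \<and>
        arrow_comp u (B, h, D) = h' \<and> arrow_comp u (Z, k, D) = k'"
    proof (rule ex1I[of _ "(D, ?u, E)"])
      fix v assume v: "v \<in> FG_arrows M \<and> fst v = snd (snd (B, h, D)) \<and> snd (snd v) = snd (snd h') \<and>
        arrow_comp v (B, h, D) = h' \<and> arrow_comp v (Z, k, D) = k'"
      then obtain u' where u': "v = (D, u', E)" by (cases v) (simp add: h')
      then have "compose (mpts B) u' h = q" "(D, u', E) \<in> FG_arrows M" using v by (simp_all add: h' comp_simp)
      then show "v = (D, ?u, E)" using u2 by (simp add: u')
    qed (use u u1 in \<open>simp add: h' k' comp_simp\<close>)
  qed (use arr in \<open>auto simp: comp_simp\<close>)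
qed

context
  fixes U :: "('a, nat) gset" and level :: "nat \<Rightarrow> nat"
  assumes U: "U \<in> finite_gsets G"
    and level_invariant: "\<forall>x\<in>gpts U. \<forall>g\<in>carrier G. level (gact U x g) = level x"
begin

text \<open>For the filtration of \<open>U\<close> by \<open>level\<close> this is the quotient of
  the \<open>j\<close>-th step by the \<open>i\<close>-th, with the points of level in
  \<open>(i, j]\<close>. The action is set to 0 off the layer so that an empty layer equals
  \<open>zero_module\<close> as a record, as the definition of a simplex demands.\<close>

definition layer_ob :: "index \<Rightarrow> ('a option, nat) pmod" where
  "layer_ob = (\<lambda>(i, j, p). \<lparr> mpts = insert 0 (Suc ` {x \<in> gpts U. i < level x \<and> level x \<le> j}), mbase = 0,
     mact = (\<lambda>y m. case (y, m) of
         (Suc x, Some g) \<Rightarrow> if x \<in> gpts U \<and> i < level x \<and> level x \<le> j then Suc (gact U x g) else 0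
       | _ \<Rightarrow> 0) \<rparr>)"

text \<open>One formula covers the inclusions, where \<open>j\<close> grows, and the collapses,
  where \<open>i\<close> grows: common points stay, all others go to the base point.\<close>

definition layer_map :: "index \<Rightarrow> index \<Rightarrow> nat \<Rightarrow> nat" where
  "layer_map x y = restrict (\<lambda>s. if s \<in> mpts (layer_ob y) then s else 0) (mpts (layer_ob x))"

definition layer_simplex :: "nat \<Rightarrow> index \<Rightarrow> index \<Rightarrow> ('a option, nat) pmod_arrow" where
  "layer_simplex n = (\<lambda>x y. if (x, y) \<in> index_arrows n then (layer_ob x, layer_map x y, layer_ob y) else undefined)"

lemma UD:
  "finite (gpts U)" "x \<in> gpts U \<Longrightarrow> g \<in> carrier G \<Longrightarrow> gact U x g \<in> gpts U"
  "x \<in> gpts U \<Longrightarrow> gact U x \<one> = x"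
  "x \<in> gpts U \<Longrightarrow> g \<in> carrier G \<Longrightarrow> h \<in> carrier G \<Longrightarrow> gact U x (g \<otimes> h) = gact U (gact U x g) h"
  using U by (auto simp: finite_gsets_def)

lemma layer_ob_sel [simp]:
  "mbase (layer_ob x) = 0"
  "s \<in> mpts (layer_ob (i, j, p)) \<longleftrightarrow> s = 0 \<or> (\<exists>e \<in> gpts U. s = Suc e \<and> i < level e \<and> level e \<le> j)"
  "mact (layer_ob x) 0 m = 0"
  "e \<in> gpts U \<Longrightarrow> i < level e \<Longrightarrow> level e \<le> j \<Longrightarrow> mact (layer_ob (i, j, p)) (Suc e) (Some g) = Suc (gact U e g)"
  "mact (layer_ob x) s None = 0"
  by (auto simp: layer_ob_def split: prod.splits nat.splits)

lemma layer_ob_fg: "is_fg_module M (layer_ob x)"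
proof -
  obtain i j p where x: "x = (i, j, p)" by (cases x)
  have "finite (mpts (layer_ob x))" using UD(1) by (simp add: layer_ob_def x)
  then show ?thesis unfolding fg_module_iff by (auto simp: x UD level_invariant)
qed

lemma layer_partial_in:
  assumes "\<And>s. s \<in> mpts (layer_ob x) \<Longrightarrow> f s = (if s \<in> mpts (layer_ob y) then s else 0)"
    and "f \<in> extensional (mpts (layer_ob x))"
  shows "(layer_ob x, f, layer_ob y) \<in> FG_arrows M"
proof -
  obtain i j p where x: "x = (i, j, p)" by (cases x)
  obtain i' j' p' where y: "y = (i', j', p')" by (cases y)
  have f: "f s = (if s \<in> mpts (layer_ob y) then s else 0)" if "s \<in> mpts (layer_ob x)" for s
    using assms(1) that .
  show ?thesis
    unfolding arrow_iff
  proof (intro conjI ballI)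
    show "f \<in> mpts (layer_ob x) \<rightarrow>\<^sub>E mpts (layer_ob y)"
      using f assms(2) by (auto simp: PiE_def x y)
    show "f (mbase (layer_ob x)) = mbase (layer_ob y)" using f[of 0] by (simp add: x y)
    fix s g assume s: "s \<in> mpts (layer_ob x)" and g: "g \<in> carrier G"
    consider "s = 0" | e where "s = Suc e" "e \<in> gpts U" "i < level e" "level e \<le> j" using s by (auto simp: x)
    then show "f (mact (layer_ob x) s (Some g)) = mact (layer_ob y) (f s) (Some g)"
    proof cases
      case 1
      then show ?thesis using f[of 0] by (simp add: x y)
    next
      case 2
      then show ?thesis
        using f[of s] f[of "Suc (gact U e g)"] g by (auto simp: x y UD level_invariant)
    qed
  qed (rule layer_ob_fg)+
qed

lemma layer_simplex_in: "layer_simplex n \<in> wS_simplices (FG M) n"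
proof (rule FG_simplexI[where ob' = layer_ob])
  let ?F = "layer_simplex n"
  have eq: "?F x y = (layer_ob x, layer_map x y, layer_ob y)" if "(x, y) \<in> index_arrows n" for x y
    using that by (simp add: layer_simplex_def)
  have marr: "(layer_ob x, layer_map x y, layer_ob y) \<in> FG_arrows M" for x y
    by (rule layer_partial_in) (auto simp: layer_map_def)
  show "is_fg_module M (layer_ob x)" for x by (rule layer_ob_fg)
  have idm: "(layer_ob x, layer_map x y, layer_ob y) = arrow_id (layer_ob x)" if "layer_ob x = layer_ob y" for x y
    using that by (auto simp: arrow_id_def layer_map_def fun_eq_iff restrict_def)
  show "?F x x = arrow_id (layer_ob x)" if "x \<in> indices n" for x
    using eq[OF index_arrows_refl[OF that]] idm by simp
  show "?F x y \<in> FG_arrows M \<and> fst (?F x y) = layer_ob x \<and> snd (snd (?F x y)) = layer_ob y"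
    if "(x, y) \<in> index_arrows n" for x y
    using eq[OF that] marr by simp
  show "?F x z = arrow_comp (?F y z) (?F x y)"
    if xyz: "(x, y) \<in> index_arrows n" "(y, z) \<in> index_arrows n" for x y z
  proof -
    have xz: "(x, z) \<in> index_arrows n" using xyz by (auto simp: index_arrows_def)
    obtain i j p where x: "x = (i, j, p)" by (cases x)
    obtain i' j' p' where y: "y = (i', j', p')" by (cases y)
    obtain i'' j'' p'' where z: "z = (i'', j'', p'')" by (cases z)
    have le: "i \<le> i'" "i' \<le> i''" "j \<le> j'" "j' \<le> j''" using xyz by (auto simp: x y z index_arrows_def)
    have mid: "s \<in> mpts (layer_ob y)" if "s \<in> mpts (layer_ob x)" "s \<in> mpts (layer_ob z)" for s
      using that le by (auto simp: x y z)
    have "layer_map x z = compose (mpts (layer_ob x)) (layer_map y z) (layer_map x y)"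
    proof
      fix s
      have "0 \<in> mpts (layer_ob y)" by (simp add: y)
      then show "layer_map x z s = compose (mpts (layer_ob x)) (layer_map y z) (layer_map x y) s"
        using mid[of s] by (auto simp: layer_map_def compose_def)
    qed
    then show ?thesis using eq[OF xz] eq[OF xyz(1)] eq[OF xyz(2)] by (simp add: comp_simp)
  qed
  show zero: "layer_ob (j, j, p) = zero_module" for j p
    by (auto simp: layer_ob_def zero_module_def fun_eq_iff split: nat.splits option.splits)
  fix i j k p assume *: "i \<le> j" "j \<le> k" "k \<le> n" "p \<le> n"
  then have a: "((i, j, p), (i, k, p)) \<in> index_arrows n" "((i, j, p), (j, j, p)) \<in> index_arrows n"
    "((i, k, p), (j, k, p)) \<in> index_arrows n" "((j, j, p), (j, k, p)) \<in> index_arrows n"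
    by (auto simp: index_arrows_def indices_def)
  have incl: "s \<in> mpts (layer_ob (i, j, p)) \<Longrightarrow> s \<in> mpts (layer_ob (i, k, p))" for s using * by auto
  show "?F (i, j, p) (i, k, p) \<in> FG_cofibrations M"
    unfolding eq[OF a(1)]
    by (rule cofibrationI[OF marr marr]) (use incl in \<open>simp add: layer_map_def\<close>)
  show "is_pushout (FG M) (?F (i, j, p) (i, k, p)) (?F (i, j, p) (j, j, p))
     (?F (i, k, p) (j, k, p)) (?F (j, j, p) (j, k, p))"
    unfolding eq[OF a(1)] eq[OF a(2)] eq[OF a(3)] eq[OF a(4)]
  proof (rule pushoutI_submodule[OF marr marr marr marr])
    show "trivial (layer_ob (j, j, p))" unfolding zero by (rule trivial_zero)
    show "mpts (layer_ob (j, k, p)) \<subseteq> mpts (layer_ob (i, k, p))" using * by auto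
    show "layer_map (i, k, p) (j, k, p) d = d" if "d \<in> mpts (layer_ob (j, k, p))" for d
      using that * by (auto simp: layer_map_def)
    show "mact (layer_ob (j, k, p)) d (Some x) = mact (layer_ob (i, k, p)) d (Some x)"
      if "d \<in> mpts (layer_ob (j, k, p))" for d x
      using that * by auto
    show "layer_map (i, k, p) (j, k, p) b = mbase (layer_ob (j, k, p)) \<and>
        b \<in> layer_map (i, j, p) (i, k, p) ` mpts (layer_ob (i, j, p))"
      if b: "b \<in> mpts (layer_ob (i, k, p))" "b \<notin> mpts (layer_ob (j, k, p))" for b
    proof
      show "layer_map (i, k, p) (j, k, p) b = mbase (layer_ob (j, k, p))" using b by (simp add: layer_map_def)
      have "b \<in> mpts (layer_ob (i, j, p))" using b by auto
      then show "b \<in> layer_map (i, j, p) (i, k, p) ` mpts (layer_ob (i, j, p))"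
        using b(1) by (intro image_eqI[of _ _ b]) (simp_all add: layer_map_def)
    qed
    show "layer_map (i, k, p) (j, k, p) (layer_map (i, j, p) (i, k, p) a) = mbase (layer_ob (j, k, p))"
      if "a \<in> mpts (layer_ob (i, j, p))" for a
      using that incl[OF that] by (auto simp: layer_map_def)
  qed simp
next
  fix i j p q assume "i \<le> j" "j \<le> n" "p \<le> q" "q \<le> n"
  then have a: "((i, j, p), (i, j, q)) \<in> index_arrows n" by (auto simp: index_arrows_def indices_def)
  have "layer_ob (i, j, p) = layer_ob (i, j, q)" by (simp add: layer_ob_def)
  then have "layer_simplex n (i, j, p) (i, j, q) = arrow_id (layer_ob (i, j, p))"
    using a by (auto simp: layer_simplex_def arrow_id_def layer_map_def fun_eq_iff restrict_def)
  then show "layer_simplex n (i, j, p) (i, j, q) \<in> FG_isos M" using arrow_id_iso[OF layer_ob_fg] by simp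
qed (auto simp: layer_simplex_def)

end

end

section \<open>The group \<open>G\<^sub>0\<close>\<close>

context finite_group
begin

abbreviation "WS \<equiv> wS (FG M :: (('a option, nat) pmod, ('a option, nat) pmod_arrow) wald)"
abbreviation "K \<equiv> K0 (FG M :: (('a option, nat) pmod, ('a option, nat) pmod_arrow) wald)"
abbreviation "cls S \<equiv> K0_class (FG M :: (('a option, nat) pmod, ('a option, nat) pmod_arrow) wald) S"

interpretation W: conical_sset WS base_vertex "mark_height {}" cone
  by (rule wS_conical)

definition edge_class :: "(index \<Rightarrow> index \<Rightarrow> ('a option, nat) pmod_arrow) \<Rightarrow> ('a option, nat) pmod_arrow K0_elem" where
  "edge_class e = loop_class W.T W.b (real_edge WS e)"

lemma wS_base_eq: "wS_base (FG M :: (('a option, nat) pmod, ('a option, nat) pmod_arrow) wald) = W.b"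
  by (simp add: wS_base_def base_vertex_def cong: if_cong)

lemma K_eq: "K = fundamental_group W.T W.b"
  by (simp add: K0_def wS_space_def wS_base_eq)

lemma cls_eq: "cls S = edge_class (object_simplex (FG M) S)"
  by (simp add: K0_class_def edge_class_def wS_space_def wS_base_eq)

lemma group_K: "group K"
  unfolding K_eq by (rule fundamental_group_is_group[OF W.base_in])

lemma edge_class_in: "e \<in> wS_simplices (FG M) 1 \<Longrightarrow> edge_class e \<in> carrier K"
  using W.pathin_real_edge[of e] by (simp add: edge_class_def K_eq fundamental_group_carrier)

lemma face_map: "i \<le> j \<Longrightarrow> j \<le> n \<Longrightarrow> (\<lambda>l. if l = 0 then i else j) \<in> simplex_maps 1 n" for i j n :: nat
  by (rule W.edge_map)

lemma edge_class_triangle: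
  assumes "F \<in> wS_simplices (FG M) 2"
  shows "edge_class (bi_oper 1 (\<lambda>l. if l = 0 then 0 else 1) (\<lambda>l. if l = 0 then 0 else 1) F) \<otimes>\<^bsub>K\<^esub>
     edge_class (bi_oper 1 (\<lambda>l. if l = 0 then 1 else 2) (\<lambda>l. if l = 0 then 1 else 2) F) =
     edge_class (bi_oper 1 (\<lambda>l. if l = 0 then 0 else 2) (\<lambda>l. if l = 0 then 0 else 2) F)"
proof -
  have F: "F \<in> simp WS 2" using assms by simp
  have "real_edge WS (oper WS 1 2 (\<lambda>l. if l = 0 then i else j) F) \<in> loops W.T W.b" if "i \<le> j" "j \<le> 2" for i j
    using W.pathin_real_edge[OF W.face_in[OF F that]] .
  note in01 = this[of 0 1] and in12 = this[of 1 2] and in02 = this[of 0 2]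
  show ?thesis
    using in01 in12 in02 W.triangle_relation[OF F]
    unfolding edge_class_def K_eq oper_wS
    by (simp add: fundamental_group_mult loop_class_eq_iff loops_join)
qed

lemma bi_edge_class:
  assumes F: "F \<in> wS_simplices (FG M) n" and \<sigma>: "\<sigma> \<in> simplex_maps 1 n" and \<tau>: "\<tau> \<in> simplex_maps 1 n"
    and S: "F (\<sigma> 0, \<sigma> 1, \<tau> 0) (\<sigma> 0, \<sigma> 1, \<tau> 1) = arrow_id S"
  shows "edge_class (bi_oper 1 \<sigma> \<tau> F) = cls S"
proof -
  have "((0, 1, 0), (0, 1, 1)) \<in> index_arrows 1" by (simp add: index_arrows_def indices_def)
  then have "bi_oper 1 \<sigma> \<tau> F (0, 1, 0) (0, 1, 1) = arrow_id S"
    using S by (simp add: bi_oper_def bi_index_def)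
  then show ?thesis
    using object_simplex_eqI[OF bi_oper_in[OF F \<sigma> \<tau>]] by (simp add: cls_eq)
qed

lemma object_simplex:
  assumes "is_fg_module M S"
  shows "object_simplex (FG M) S \<in> wS_simplices (FG M) 1" "ob (object_simplex (FG M) S) (0, 1, 0) = S"
proof -
  let ?F = "iso_simplex (arrow_id S)"
  have F: "?F \<in> wS_simplices (FG M) 1" using iso_simplex_in[OF arrow_id_iso[OF assms]] .
  have "?F (0, 1, 0) (0, 1, 1) = arrow_id S" "ob ?F (0, 1, 0) = S"
    by (simp_all add: iso_simplex_def index_arrows_def indices_def iso_ob_def arrow_id_def)
  then show "object_simplex (FG M) S \<in> wS_simplices (FG M) 1" "ob (object_simplex (FG M) S) (0, 1, 0) = S"
    using object_simplex_eqI[OF F] F by simp_all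
qed

lemma cls_in: "is_fg_module M S \<Longrightarrow> cls S \<in> carrier K"
  unfolding cls_eq by (rule edge_class_in[OF object_simplex(1)])

text \<open>\<sigma> and \<tau> choose one of the two triangles of the square with diagonal
  \<open>F\<close>. Its long side is \<open>F\<close> itself, and the two assumptions on identities
  say that its short sides are the edges of the objects \<open>S\<close> and
  \<open>S'\<close>.\<close>

lemma bi_faces:
  assumes "F \<in> wS_simplices (FG M) 1" "\<sigma> \<in> simplex_maps 2 1" "\<tau> \<in> simplex_maps 2 1"
    and "F (\<sigma> 0, \<sigma> 1, \<tau> 0) (\<sigma> 0, \<sigma> 1, \<tau> 1) = arrow_id S" "F (\<sigma> 1, \<sigma> 2, \<tau> 1) (\<sigma> 1, \<sigma> 2, \<tau> 2) = arrow_id S'"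
    and "\<sigma> 0 = 0" "\<sigma> 2 = 1" "\<tau> 0 = 0" "\<tau> 2 = 1"
  shows "cls S \<otimes>\<^bsub>K\<^esub> cls S' = edge_class F"
proof -
  have \<theta>: "(\<lambda>l. if l = 0 then 0 else 1) \<in> simplex_maps 1 2" "(\<lambda>l. if l = 0 then 1 else 2) \<in> simplex_maps 1 2"
    "(\<lambda>l. if l = 0 then 0 else 2) \<in> simplex_maps 1 2"
    by (rule face_map; simp)+
  have "edge_class (bi_oper 1 (\<sigma> \<circ> (\<lambda>l. if l = 0 then 0 else 1)) (\<tau> \<circ> (\<lambda>l. if l = 0 then 0 else 1)) F) = cls S"
    using assms by (intro bi_edge_class simplex_maps_comp[OF _ \<theta>(1)]) auto
  moreover have "edge_class (bi_oper 1 (\<sigma> \<circ> (\<lambda>l. if l = 0 then 1 else 2)) (\<tau> \<circ> (\<lambda>l. if l = 0 then 1 else 2)) F) = cls S'"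
    using assms by (intro bi_edge_class simplex_maps_comp[OF _ \<theta>(2)]) auto
  moreover have "bi_oper 1 (\<sigma> \<circ> (\<lambda>l. if l = 0 then 0 else 2)) (\<tau> \<circ> (\<lambda>l. if l = 0 then 0 else 2)) F = F"
  proof (rule edge_eqI[OF bi_oper_in[OF assms(1)] assms(1)])
    show "bi_oper 1 (\<sigma> \<circ> (\<lambda>l. if l = 0 then 0 else 2)) (\<tau> \<circ> (\<lambda>l. if l = 0 then 0 else 2)) F (0, 1, 0) (0, 1, 1) =
        F (0, 1, 0) (0, 1, 1)"
      using assms by (simp add: bi_oper_def bi_index_def index_arrows_def indices_def)
  qed (use assms simplex_maps_comp[OF _ \<theta>(3)] in auto)
  ultimately show ?thesis
    using edge_class_triangle[OF bi_oper_in[OF assms(1-3)], unfolded bi_oper_comp[OF \<theta>(1) \<theta>(1)]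
      bi_oper_comp[OF \<theta>(2) \<theta>(2)] bi_oper_comp[OF \<theta>(3) \<theta>(3)]] by metis
qed

lemma stage_zero:
  assumes F: "F \<in> wS_simplices (FG M) 1" and "j \<le> 1"
  shows "F (j, j, 0) (j, j, 1) = arrow_id zero_module"
proof -
  have a: "((j, j, 0), (j, j, 1)) \<in> index_arrows 1" using assms by (simp add: index_arrows_def indices_def)
  have e: "fst (F (j, j, 0) (j, j, 1)) = zero_module" "snd (snd (F (j, j, 0) (j, j, 1))) = zero_module"
    using FG_simplexD(4,5)[OF F a] FG_simplexD(6)[OF F assms(2)] by simp_all
  have "F (j, j, 0) (j, j, 1) = zero_arrow (fst (F (j, j, 0) (j, j, 1))) (snd (snd (F (j, j, 0) (j, j, 1))))"
    by (rule trivial_arrow[OF FG_simplexD(3)[OF F a]]) (unfold e, rule disjI1, rule trivial_zero)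
  also have "\<dots> = arrow_id zero_module" unfolding e by (rule arrow_id_trivial[OF trivial_zero, symmetric])
  finally show ?thesis .
qed

text \<open>The triangle makes the class of the zero module idempotent, and the only idempotent of a
  group is its unit.\<close>

lemma cls_zero: "cls zero_module = \<one>\<^bsub>K\<^esub>"
proof -
  interpret K: group K by (rule group_K)
  note z = trivial_fg[OF trivial_zero]
  let ?F = "object_simplex (FG M) zero_module"
  have F: "?F \<in> wS_simplices (FG M) 1" using object_simplex(1)[OF z] .
  have s: "(\<lambda>l. min l 1) \<in> simplex_maps 2 1" "(\<lambda>l. l - 1) \<in> simplex_maps 2 1"
    by (auto simp: simplex_maps_def mono_on_def)
  have "?F (0, 1, 0) (0, 1, 0) = arrow_id zero_module"
    using FG_simplexD(2)[OF F, of "(0, 1, 0)"] unfolding object_simplex(2)[OF z] by (simp add: indices_def)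
  moreover have "?F (1, 1, 0) (1, 1, 1) = arrow_id zero_module" by (rule stage_zero[OF F]) simp
  ultimately have "cls zero_module \<otimes>\<^bsub>K\<^esub> cls zero_module = edge_class ?F"
    by (intro bi_faces[OF F s]) auto
  then show ?thesis using cls_in[OF z] by (simp add: cls_eq[symmetric])
qed

text \<open>The two triangles of the square with diagonal \<open>F\<close>. One passes
  \<open>(0, 1)\<close> at stage 0 and then changes the stage at the zero object
  \<open>(1, 1)\<close>; the other changes the stage at \<open>(0, 0)\<close> first and passes
  \<open>(0, 1)\<close> at stage 1.\<close>

lemma edge_class_ends:
  assumes F: "F \<in> wS_simplices (FG M) 1"
  shows "edge_class F = cls (ob F (0, 1, 0))" "edge_class F = cls (ob F (0, 1, 1))"
proof -
  interpret K: group K by (rule group_K)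
  have s: "(\<lambda>l. min l 1) \<in> simplex_maps 2 1" "(\<lambda>l. l - 1) \<in> simplex_maps 2 1"
    by (auto simp: simplex_maps_def mono_on_def)
  have ind: "(0, 1, 0) \<in> indices 1" "(0, 1, 1) \<in> indices 1" by (simp_all add: indices_def)
  note z = stage_zero[OF F, of 0, simplified] stage_zero[OF F, of 1, simplified]
  have i: "F (0, 1, 0) (0, 1, 0) = arrow_id (ob F (0, 1, 0))" "F (0, 1, 1) (0, 1, 1) = arrow_id (ob F (0, 1, 1))"
    using FG_simplexD(2)[OF F ind(1)] FG_simplexD(2)[OF F ind(2)] .
  have "cls (ob F (0, 1, 0)) \<otimes>\<^bsub>K\<^esub> cls zero_module = edge_class F"
    by (rule bi_faces[OF F s]) (use z i in simp_all)
  moreover have "cls zero_module \<otimes>\<^bsub>K\<^esub> cls (ob F (0, 1, 1)) = edge_class F"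
    by (rule bi_faces[OF F s(2,1)]) (use z i in simp_all)
  moreover have "cls (ob F (0, 1, 0)) \<in> carrier K" "cls (ob F (0, 1, 1)) \<in> carrier K"
    using cls_in[OF FG_simplexD(1)[OF F ind(1)]] cls_in[OF FG_simplexD(1)[OF F ind(2)]] .
  ultimately show "edge_class F = cls (ob F (0, 1, 0))" "edge_class F = cls (ob F (0, 1, 1))"
    by (simp_all add: cls_zero)
qed

lemma cls_iso:
  assumes "(A, f, B) \<in> FG_isos M"
  shows "cls A = cls B"
  using edge_class_ends[OF iso_simplex_in[OF assms]]
  by (simp add: iso_simplex_def index_arrows_def indices_def iso_ob_def arrow_id_def)

subsection \<open>Classes of \<open>G\<close>-sets\<close>

lemma gsetD:
  assumes "S \<in> finite_gsets G"
  shows "finite (gpts S)" "x \<in> gpts S \<Longrightarrow> g \<in> carrier G \<Longrightarrow> gact S x g \<in> gpts S"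
    "x \<in> gpts S \<Longrightarrow> gact S x \<one> = x"
    "x \<in> gpts S \<Longrightarrow> g \<in> carrier G \<Longrightarrow> h \<in> carrier G \<Longrightarrow> gact S x (g \<otimes> h) = gact S (gact S x g) h"
  using assms by (auto simp: finite_gsets_def)

lemma add_point_sel [simp]:
  "mpts (add_point S) = insert 0 (Suc ` gpts S)" "mbase (add_point S) = 0"
  "mact (add_point S) 0 m = 0" "mact (add_point S) (Suc x) (Some g) = Suc (gact S x g)" "mact (add_point S) y None = 0"
  by (auto simp: add_point_def split: nat.splits)

lemma add_point_fg: "S \<in> finite_gsets G \<Longrightarrow> is_fg_module M (add_point S)"
  unfolding fg_module_iff using gsetD[of S] by auto

lemma cls_add_point_eqI:
  assumes A: "is_fg_module M A" and S: "S \<in> finite_gsets G"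
    and e: "bij_betw e (gpts S) (mpts A - {mbase A})"
    and equiv: "\<And>x g. x \<in> gpts S \<Longrightarrow> g \<in> carrier G \<Longrightarrow> e (gact S x g) = mact A (e x) (Some g)"
  shows "cls (add_point S) = cls A"
proof -
  define f where "f = restrict (case_nat (mbase A) e) (mpts (add_point S))"
  have f: "f 0 = mbase A" "x \<in> gpts S \<Longrightarrow> f (Suc x) = e x" for x by (simp_all add: f_def)
  have eA: "e x \<in> mpts A" "e x \<noteq> mbase A" if "x \<in> gpts S" for x using e that by (auto simp: bij_betw_def)
  have "(add_point S, f, A) \<in> FG_arrows M"
    unfolding arrow_iff
  proof (intro conjI ballI)
    show "f \<in> mpts (add_point S) \<rightarrow>\<^sub>E mpts A"
      using f eA fg_moduleD(2)[OF A] by (auto simp: PiE_def f_def)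
    fix s g assume "s \<in> mpts (add_point S)" "g \<in> carrier G"
    then show "f (mact (add_point S) s (Some g)) = mact A (f s) (Some g)"
      using f equiv gsetD(2)[OF S] fg_moduleD(4)[OF A] by auto
  qed (use A add_point_fg[OF S] f in auto)
  moreover have "bij_betw f (mpts (add_point S)) (mpts A)"
    unfolding bij_betw_def
  proof
    show "inj_on f (mpts (add_point S))"
      using e eA f by (auto simp: inj_on_def bij_betw_def)
    have "f ` Suc ` gpts S = e ` gpts S" using f by (auto simp: image_image)
    then have "f ` mpts (add_point S) = insert (mbase A) (e ` gpts S)" using f by simp
    also have "\<dots> = mpts A" using e fg_moduleD(2)[OF A] by (auto simp: bij_betw_def)
    finally show "f ` mpts (add_point S) = mpts A" .
  qed
  ultimately show ?thesis using cls_iso iso_in by blast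
qed

definition reduced :: "('a option, nat) pmod \<Rightarrow> ('a, nat) gset" where
  "reduced A = \<lparr> gpts = mpts A - {mbase A}, gact = (\<lambda>x g. mact A x (Some g)) \<rparr>"

lemma reduced:
  assumes A: "is_fg_module M A"
  shows "reduced A \<in> finite_gsets G" "cls (add_point (reduced A)) = cls A"
proof -
  show S: "reduced A \<in> finite_gsets G"
    unfolding finite_gsets_def using fg_moduleD[OF A] mact_eq_base_iff[OF A] by (auto simp: reduced_def)
  show "cls (add_point (reduced A)) = cls A"
    by (rule cls_add_point_eqI[OF A S, of id]) (auto simp: reduced_def)
qed

lemma cls_gset_iso:
  assumes "S \<in> finite_gsets G" "T \<in> finite_gsets G" "gset_iso G S T"
  shows "cls (add_point S) = cls (add_point T)"
proof -
  obtain f where f: "bij_betw f (gpts S) (gpts T)" "\<forall>x\<in>gpts S. \<forall>g\<in>carrier G. f (gact S x g) = gact T (f x) g"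
    using assms(3) by (auto simp: gset_iso_def)
  show ?thesis
  proof (rule cls_add_point_eqI[OF add_point_fg[OF assms(2)] assms(1), of "Suc \<circ> f"])
    have "mpts (add_point T) - {mbase (add_point T)} = Suc ` gpts T" by auto
    then show "bij_betw (Suc \<circ> f) (gpts S) (mpts (add_point T) - {mbase (add_point T)})"
      using bij_betw_trans[OF f(1), of Suc "Suc ` gpts T"] by (simp add: bij_betw_def)
  qed (use f in auto)
qed

lemma gset_union_sel [simp]:
  "gpts (gset_union S T) = sum_encode ` (gpts S <+> gpts T)"
  "gact (gset_union S T) (sum_encode (Inl x)) g = sum_encode (Inl (gact S x g))"
  "gact (gset_union S T) (sum_encode (Inr y)) g = sum_encode (Inr (gact T y g))"
  by (simp_all add: gset_union_def)

lemma gset_union_in: "S \<in> finite_gsets G \<Longrightarrow> T \<in> finite_gsets G \<Longrightarrow> gset_union S T \<in> finite_gsets G"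
  by (auto simp: finite_gsets_def)

lemma cls_gset_union:
  assumes S: "S \<in> finite_gsets G" and T: "T \<in> finite_gsets G"
  shows "cls (add_point (gset_union S T)) = cls (add_point S) \<otimes>\<^bsub>K\<^esub> cls (add_point T)"
proof -
  let ?U = "gset_union S T"
  \<comment> \<open>With \<open>S\<close> on level 1 and \<open>T\<close> on level 2, the layers
    \<open>(0, 1]\<close>, \<open>(1, 2]\<close> and \<open>(0, 2]\<close> are \<open>S\<close>,
    \<open>T\<close> and their union, and all three occur in one 2-simplex.\<close>
  define level where "level = (\<lambda>z. case sum_decode z of Inl x \<Rightarrow> 1 | Inr y \<Rightarrow> (2 :: nat))"
  have U: "?U \<in> finite_gsets G" using gset_union_in[OF S T] .
  have lev: "\<forall>x\<in>gpts ?U. \<forall>g\<in>carrier G. level (gact ?U x g) = level x"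
    by (auto simp: level_def)
  have level [simp]: "level (sum_encode (Inl x)) = 1" "level (sum_encode (Inr x)) = 2" for x
    by (simp_all add: level_def)
  let ?F = "layer_simplex ?U level 2" and ?O = "layer_ob ?U level"
  have F: "?F \<in> wS_simplices (FG M) 2" using layer_simplex_in[OF U lev] .
  have Oid: "?F (i, j, p) (i, j, q) = arrow_id (?O (i, j, 0))" if "i \<le> j" "j \<le> 2" "p \<le> q" "q \<le> 2" for i j p q
  proof -
    have "?O (i, j, p) = ?O (i, j, 0)" "?O (i, j, q) = ?O (i, j, 0)" by (simp_all add: layer_ob_def[OF U lev])
    then show ?thesis
      using that unfolding layer_simplex_def[OF U lev] layer_map_def[OF U lev] arrow_id_def
      by (auto simp: index_arrows_def indices_def fun_eq_iff restrict_def)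
  qed
  have fg: "is_fg_module M (?O x)" for x by (rule layer_ob_fg[OF U lev])
  have 1: "cls (add_point S) = cls (?O (0, 1, 0))"
  proof (rule cls_add_point_eqI[OF fg S, of "\<lambda>x. Suc (sum_encode (Inl x))"])
    show "bij_betw (\<lambda>x. Suc (sum_encode (Inl x))) (gpts S) (mpts (?O (0, 1, 0)) - {mbase (?O (0, 1, 0))})"
      unfolding bij_betw_def
      by (auto simp: inj_on_def layer_ob_def[OF U lev] image_iff sum_encode_eq)
  qed (use gsetD(2)[OF S] in \<open>auto simp: layer_ob_def[OF U lev]\<close>)
  have 2: "cls (add_point T) = cls (?O (1, 2, 0))"
  proof (rule cls_add_point_eqI[OF fg T, of "\<lambda>x. Suc (sum_encode (Inr x))"])
    show "bij_betw (\<lambda>x. Suc (sum_encode (Inr x))) (gpts T) (mpts (?O (1, 2, 0)) - {mbase (?O (1, 2, 0))})"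
      unfolding bij_betw_def
      by (auto simp: inj_on_def layer_ob_def[OF U lev] image_iff sum_encode_eq)
  qed (use gsetD(2)[OF T] in \<open>auto simp: layer_ob_def[OF U lev]\<close>)
  have 3: "cls (add_point ?U) = cls (?O (0, 2, 0))"
  proof (rule cls_add_point_eqI[OF fg U, of Suc])
    show "bij_betw Suc (gpts ?U) (mpts (?O (0, 2, 0)) - {mbase (?O (0, 2, 0))})"
      unfolding bij_betw_def
      by (auto simp: layer_ob_def[OF U lev] image_iff sum_encode_eq)
  qed (use gsetD(2)[OF U] in \<open>auto simp: layer_ob_def[OF U lev]\<close>)
  have "cls (?O (0, 1, 0)) \<otimes>\<^bsub>K\<^esub> cls (?O (1, 2, 0)) = cls (?O (0, 2, 0))"
    using edge_class_triangle[OF F]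
      bi_edge_class[OF F face_map[of 0 1 2] face_map[of 0 1 2], of "?O (0, 1, 0)"]
      bi_edge_class[OF F face_map[of 1 2 2] face_map[of 1 2 2], of "?O (1, 2, 0)"]
      bi_edge_class[OF F face_map[of 0 2 2] face_map[of 0 2 2], of "?O (0, 2, 0)"]
    by (simp add: Oid)
  then show ?thesis using 1 2 3 by simp
qed

subsection \<open>Marks on \<open>G\<^sub>0\<close>\<close>

text \<open>For a concatenation the class of one numerator has to move past the class of the other
  denominator. This asks only that classes of \<open>G\<close>-sets commute, and they do once
  disjoint unions do up to isomorphism. The hypothesis \<open>comm\<close> records that; it is later
  obtained from marks.\<close>

lemma K_generated:
  assumes x: "x \<in> carrier K"
    and comm: "\<And>S T. S \<in> finite_gsets G \<Longrightarrow> T \<in> finite_gsets G \<Longrightarrow> gset_iso G (gset_union S T) (gset_union T S)"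
  obtains S T where "S \<in> finite_gsets G" "T \<in> finite_gsets G" "x \<otimes>\<^bsub>K\<^esub> cls (add_point T) = cls (add_point S)"
proof -
  interpret K: group K by (rule group_K)
  have empty: "gset_empty \<in> finite_gsets G" "cls (add_point gset_empty) = \<one>\<^bsub>K\<^esub>"
  proof -
    show E: "gset_empty \<in> finite_gsets G" by (simp add: finite_gsets_def gset_empty_def)
    show "cls (add_point gset_empty) = \<one>\<^bsub>K\<^esub>"
      using cls_add_point_eqI[OF trivial_fg[OF trivial_zero] E, of id] cls_zero
      by (simp add: gset_empty_def zero_module_def)
  qed
  have clsK: "cls (add_point S) \<in> carrier K" if "S \<in> finite_gsets G" for S
    using cls_in[OF add_point_fg[OF that]] .
  have comm': "cls (add_point S) \<otimes>\<^bsub>K\<^esub> cls (add_point T) = cls (add_point T) \<otimes>\<^bsub>K\<^esub> cls (add_point S)"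
    if "S \<in> finite_gsets G" "T \<in> finite_gsets G" for S T
    using cls_gset_iso[OF gset_union_in[OF that] gset_union_in[OF that(2,1)] comm[OF that]]
    by (simp add: cls_gset_union that)
  have "\<exists>S \<in> finite_gsets G. \<exists>T \<in> finite_gsets G. loop_class W.T W.b c \<otimes>\<^bsub>K\<^esub> cls (add_point T) = cls (add_point S)"
    if "edge_loop WS base_vertex c" for c
    using that
  proof (induction rule: edge_loop.induct)
    case const
    have "loop_class W.T W.b (\<lambda>u. W.b) = \<one>\<^bsub>K\<^esub>" by (simp add: K_eq fundamental_group_one)
    then show ?case using empty K.one_closed K.r_one by (intro bexI[of _ gset_empty]) auto
  next
    case (edge e)
    then have e: "e \<in> wS_simplices (FG M) 1" by simp
    have fg: "is_fg_module M (ob e (0, 1, 0))" using FG_simplexD(1)[OF e] by (simp add: indices_def)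
    have "loop_class W.T W.b (real_edge WS e) = cls (add_point (reduced (ob e (0, 1, 0))))"
      using edge_class_ends(1)[OF e] reduced(2)[OF fg] by (simp add: edge_class_def)
    then show ?case
      using empty reduced(1)[OF fg] clsK
      by (intro bexI[of _ "reduced (ob e (0, 1, 0))"] bexI[of _ gset_empty]) auto
  next
    case (edge_rev e)
    then have e: "e \<in> wS_simplices (FG M) 1" by simp
    have fg: "is_fg_module M (ob e (0, 1, 0))" using FG_simplexD(1)[OF e] by (simp add: indices_def)
    have "loop_class W.T W.b (real_edge WS e) = cls (add_point (reduced (ob e (0, 1, 0))))"
      using edge_class_ends(1)[OF e] reduced(2)[OF fg] by (simp add: edge_class_def)
    moreover have "loop_class W.T W.b (path_rev (real_edge WS e)) \<otimes>\<^bsub>K\<^esub> loop_class W.T W.b (real_edge WS e) = \<one>\<^bsub>K\<^esub>"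
      unfolding K_eq by (rule fundamental_group_rev[OF W.pathin_real_edge]) (use e in simp)
    ultimately show ?case
      using empty reduced(1)[OF fg]
      by (intro bexI[of _ "gset_empty"] bexI[of _ "reduced (ob e (0, 1, 0))"]) auto
  next
    case (join f g)
    note fl = W.edge_loop_loops[OF join(1)] and gl = W.edge_loop_loops[OF join(2)]
    let ?f = "loop_class W.T W.b f" and ?g = "loop_class W.T W.b g"
    have K: "?f \<in> carrier K" "?g \<in> carrier K" using fl gl by (simp_all add: K_eq fundamental_group_carrier)
    obtain S T where ST: "S \<in> finite_gsets G" "T \<in> finite_gsets G" "?f \<otimes>\<^bsub>K\<^esub> cls (add_point T) = cls (add_point S)"
      using join by blast
    obtain S' T' where ST': "S' \<in> finite_gsets G" "T' \<in> finite_gsets G" "?g \<otimes>\<^bsub>K\<^esub> cls (add_point T') = cls (add_point S')"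
      using join by blast
    have "loop_class W.T W.b (loop_join f g) = ?f \<otimes>\<^bsub>K\<^esub> ?g"
      using fundamental_group_mult[OF fl gl] by (simp add: K_eq)
    then have "loop_class W.T W.b (loop_join f g) \<otimes>\<^bsub>K\<^esub> cls (add_point (gset_union T' T)) =
        ?f \<otimes>\<^bsub>K\<^esub> (?g \<otimes>\<^bsub>K\<^esub> cls (add_point T')) \<otimes>\<^bsub>K\<^esub> cls (add_point T)"
      using K clsK ST(1,2) ST'(1,2) by (simp add: cls_gset_union K.m_assoc)
    also have "\<dots> = ?f \<otimes>\<^bsub>K\<^esub> (cls (add_point S') \<otimes>\<^bsub>K\<^esub> cls (add_point T))"
      using K clsK ST(1,2) ST' by (simp add: K.m_assoc)
    also have "\<dots> = ?f \<otimes>\<^bsub>K\<^esub> cls (add_point T) \<otimes>\<^bsub>K\<^esub> cls (add_point S')"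
      using comm'[OF ST'(1) ST(2)] K clsK ST(1,2) ST'(1,2) by (simp add: K.m_assoc)
    also have "\<dots> = cls (add_point (gset_union S S'))"
      using ST ST' by (simp add: cls_gset_union)
    finally show ?case using gset_union_in ST ST' by blast
  next
    case (homotopic f g)
    have "loop_class W.T W.b f = loop_class W.T W.b g"
      using loop_class_eq_iff[OF W.edge_loop_loops[OF homotopic(1)] W.edge_loop_loops[OF edge_loop.homotopic[OF homotopic(1,2)]]]
        homotopic(2) by simp
    then show ?case using homotopic by simp
  qed
  moreover obtain c where "c \<in> loops W.T W.b" "x = loop_class W.T W.b c"
    using x by (auto simp: K_eq fundamental_group_carrier)
  ultimately show thesis using W.loops_generated_by_edges that by blast
qed

lemma K_mark:
  obtains d :: "('a option, nat) pmod_arrow K0_elem \<Rightarrow> complex" where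
    "\<And>x y. x \<in> carrier K \<Longrightarrow> y \<in> carrier K \<Longrightarrow> d (x \<otimes>\<^bsub>K\<^esub> y) = d x + d y"
    "\<And>S. is_fg_module M S \<Longrightarrow> d (cls S) + 1 = of_nat (card (fixed_points H S))"
proof -
  interpret WH: graded_sset WS base_vertex "mark_height H" by (rule wS_graded)
  obtain d where d: "\<And>f g. f \<in> loops W.T W.b \<Longrightarrow> g \<in> loops W.T W.b \<Longrightarrow>
       d (loop_class W.T W.b (loop_join f g)) = d (loop_class W.T W.b f) + d (loop_class W.T W.b g)"
    "\<And>e. e \<in> simp WS 1 \<Longrightarrow>
       d (loop_class W.T W.b (real_edge WS e)) = (of_nat (mark_height H 1 e 1) - of_nat (mark_height H 1 e 0) :: complex)"
    by (rule WH.height_homomorphism) blast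
  show thesis
  proof (rule that[of d])
    fix x y assume "x \<in> carrier K" "y \<in> carrier K"
    then show "d (x \<otimes>\<^bsub>K\<^esub> y) = d x + d y"
      using d(1) by (auto simp: K_eq fundamental_group_carrier fundamental_group_mult)
  next
    fix S :: "('a option, nat) pmod" assume S: "is_fg_module M S"
    let ?e = "object_simplex (FG M) S"
    have e: "?e \<in> wS_simplices (FG M) 1" by (rule object_simplex(1)[OF S])
    have height0: "mark_height H 1 ?e 0 = 0"
      using FG_simplexD(6)[OF e, of 0 0] by (simp add: mark_height_def fixed_points_trivial[OF trivial_zero])
    have "mark_height H 1 ?e 1 + 1 = card (fixed_points H S)"
      using object_simplex(2)[OF S] card_fixed_points_pos[OF S, of H] by (simp add: mark_height_def)
    then have card: "card (fixed_points H S) = Suc (mark_height H 1 ?e 1)" by simp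
    have "d (cls S) = of_nat (mark_height H 1 ?e 1) - of_nat (mark_height H 1 ?e 0)"
      using d(2)[of ?e] e by (simp add: cls_eq edge_class_def)
    then show "d (cls S) + 1 = of_nat (card (fixed_points H S))"
      unfolding card using height0 by simp
  qed
qed

end

section \<open>Marks\<close>

context finite_group
begin

text \<open>\<open>H\<close> may be any set: its fixed points are those of the subgroup generated by
  its part in \<open>G\<close>. So the marks are the usual ones, without a side condition on the
  index.\<close>

definition fixed :: "('a, 'x) gset \<Rightarrow> 'a set \<Rightarrow> 'x set" where
  "fixed S H = {x \<in> gpts S. \<forall>h \<in> H \<inter> carrier G. gact S x h = x}"

definition mark :: "('a, 'x) gset \<Rightarrow> 'a set \<Rightarrow> nat" where
  "mark S H = card (fixed S H)"

lemma finite_fixed: "S \<in> finite_gsets G \<Longrightarrow> finite (fixed S H)"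
  using gsetD(1)[of S] by (auto simp: fixed_def)

lemma mark_iso:
  assumes "gset_iso G S T" "\<And>x g. x \<in> gpts S \<Longrightarrow> g \<in> carrier G \<Longrightarrow> gact S x g \<in> gpts S"
  shows "mark S H = mark T H"
proof -
  obtain f where f: "bij_betw f (gpts S) (gpts T)" "\<And>x g. x \<in> gpts S \<Longrightarrow> g \<in> carrier G \<Longrightarrow> f (gact S x g) = gact T (f x) g"
    using assms(1) by (auto simp: gset_iso_def)
  have inj: "inj_on f (gpts S)" and img: "f ` gpts S = gpts T" using f(1) by (auto simp: bij_betw_def)
  have iff: "f x \<in> fixed T H \<longleftrightarrow> x \<in> fixed S H" if x: "x \<in> gpts S" for x
  proof -
    have "f x \<in> gpts T" using x img by blast
    moreover have "gact T (f x) h = f x \<longleftrightarrow> gact S x h = x" if "h \<in> carrier G" for h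
      using inj_on_eq_iff[OF inj assms(2)[OF x that] x] f(2)[OF x that] by simp
    ultimately show ?thesis using x by (auto simp: fixed_def)
  qed
  have "f ` fixed S H = fixed T H"
  proof
    show "f ` fixed S H \<subseteq> fixed T H" using iff by (auto simp: fixed_def[of S])
    show "fixed T H \<subseteq> f ` fixed S H"
    proof
      fix y assume y: "y \<in> fixed T H"
      then obtain x where "x \<in> gpts S" "y = f x" using img by (auto simp: fixed_def)
      then show "y \<in> f ` fixed S H" using iff y by simp
    qed
  qed
  moreover have "inj_on f (fixed S H)" using inj by (rule inj_on_subset) (auto simp: fixed_def)
  ultimately show ?thesis unfolding mark_def using card_image by metis
qed

lemma mark_union:
  assumes "S \<in> finite_gsets G" "T \<in> finite_gsets G"
  shows "mark (gset_union S T) H = mark S H + mark T H"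
proof -
  have "fixed (gset_union S T) H = sum_encode ` (fixed S H <+> fixed T H)"
    by (auto simp: fixed_def sum_encode_eq)
  moreover have "inj sum_encode" by (rule inj_sum_encode)
  ultimately show ?thesis
    using assms by (simp add: mark_def card_image inj_on_subset card_Plus finite_fixed)
qed

lemma gset_prod_sel [simp]:
  "gpts (gset_prod S T) = prod_encode ` (gpts S \<times> gpts T)"
  "gact (gset_prod S T) (prod_encode (x, y)) g = prod_encode (gact S x g, gact T y g)"
  by (simp_all add: gset_prod_def)

lemma gset_prod_in: "S \<in> finite_gsets G \<Longrightarrow> T \<in> finite_gsets G \<Longrightarrow> gset_prod S T \<in> finite_gsets G"
  by (auto simp: finite_gsets_def)

lemma mark_prod:
  assumes "S \<in> finite_gsets G" "T \<in> finite_gsets G"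
  shows "mark (gset_prod S T) H = mark S H * mark T H"
proof -
  have "fixed (gset_prod S T) H = prod_encode ` (fixed S H \<times> fixed T H)"
    by (auto simp: fixed_def)
  moreover have "inj prod_encode" by (rule inj_prod_encode)
  ultimately show ?thesis
    by (simp add: mark_def card_image inj_on_subset card_cartesian_product)
qed

lemma gset_empty_in: "gset_empty \<in> finite_gsets G" and gset_point_in: "gset_point \<in> finite_gsets G"
  by (auto simp: finite_gsets_def gset_empty_def gset_point_def)

lemma mark_empty: "mark gset_empty H = 0" and mark_point: "mark gset_point H = 1"
proof -
  have "fixed gset_empty H = {}" "fixed gset_point H = {0}" by (auto simp: fixed_def gset_empty_def gset_point_def)
  then show "mark gset_empty H = 0" "mark gset_point H = 1" by (simp_all add: mark_def)
qed

lemma card_fixed_points_add_point: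
  assumes "S \<in> finite_gsets G"
  shows "card (fixed_points H (add_point S)) = mark S H + 1"
proof -
  have "fixed_points H (add_point S) = insert 0 (Suc ` fixed S H)"
    by (auto simp: fixed_points_def fixed_def)
  then show ?thesis using finite_fixed[OF assms, of H] by (simp add: mark_def card_image)
qed

subsection \<open>Marks determine finite \<open>G\<close>-sets\<close>

definition orbit :: "('a, 'x) gset \<Rightarrow> 'x \<Rightarrow> 'x set" where
  "orbit S x = gact S x ` carrier G"

definition stab :: "('a, 'x) gset \<Rightarrow> 'x \<Rightarrow> 'a set" where
  "stab S x = {g \<in> carrier G. gact S x g = x}"

lemma gact_eq_iff:
  assumes S: "S \<in> finite_gsets G" and x: "x \<in> gpts S" and g: "g \<in> carrier G" "h \<in> carrier G"
  shows "gact S x g = gact S x h \<longleftrightarrow> g \<otimes> inv h \<in> stab S x"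
proof
  assume eq: "gact S x g = gact S x h"
  have "gact S x (g \<otimes> inv h) = gact S (gact S x g) (inv h)" using gsetD(4)[OF S x g(1)] g by simp
  also have "\<dots> = gact S x (h \<otimes> inv h)" unfolding eq using gsetD(4)[OF S x g(2) inv_closed[OF g(2)]] by simp
  also have "\<dots> = x" using gsetD(3)[OF S x] g by simp
  finally show "g \<otimes> inv h \<in> stab S x" using g by (simp add: stab_def)
next
  assume st: "g \<otimes> inv h \<in> stab S x"
  have "gact S x g = gact S x ((g \<otimes> inv h) \<otimes> h)" using g by (simp add: m_assoc)
  also have "\<dots> = gact S (gact S x (g \<otimes> inv h)) h" using gsetD(4)[OF S x, of "g \<otimes> inv h" h] g by simp
  finally show "gact S x g = gact S x h" using st by (simp add: stab_def)
qed

lemma orbit_subset: "S \<in> finite_gsets G \<Longrightarrow> x \<in> gpts S \<Longrightarrow> orbit S x \<subseteq> gpts S"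
  using gsetD(2)[of S] by (auto simp: orbit_def)

lemma orbit_act:
  assumes S: "S \<in> finite_gsets G" and x: "x \<in> gpts S" and z: "z \<in> gpts S" and g: "g \<in> carrier G"
  shows "gact S z g \<in> orbit S x \<longleftrightarrow> z \<in> orbit S x"
proof
  assume "z \<in> orbit S x"
  then obtain h where "h \<in> carrier G" "z = gact S x h" by (auto simp: orbit_def)
  then show "gact S z g \<in> orbit S x" using gsetD(4)[OF S x _ g] g by (auto simp: orbit_def intro!: image_eqI[of _ _ "h \<otimes> g"])
next
  assume "gact S z g \<in> orbit S x"
  then obtain h where h: "h \<in> carrier G" "gact S z g = gact S x h" by (auto simp: orbit_def)
  have "z = gact S z (g \<otimes> inv g)" using gsetD(3)[OF S z] g by simp
  also have "\<dots> = gact S (gact S x h) (inv g)" unfolding h(2)[symmetric] using gsetD(4)[OF S z g inv_closed[OF g]] by simp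
  also have "\<dots> = gact S x (h \<otimes> inv g)" using gsetD(4)[OF S x h(1)] g by simp
  finally show "z \<in> orbit S x" using h g by (auto simp: orbit_def intro!: image_eqI[of _ _ "h \<otimes> inv g"])
qed

lemma restrict_in:
  assumes "S \<in> finite_gsets G" "O' \<subseteq> gpts S" "\<And>x g. x \<in> O' \<Longrightarrow> g \<in> carrier G \<Longrightarrow> gact S x g \<in> O'"
  shows "S\<lparr>gpts := O'\<rparr> \<in> finite_gsets G"
  using assms gsetD[OF assms(1)] by (auto simp: finite_gsets_def intro: finite_subset)

lemma mark_split:
  assumes "S \<in> finite_gsets G" "O' \<subseteq> gpts S"
  shows "mark S H = mark (S\<lparr>gpts := O'\<rparr>) H + mark (S\<lparr>gpts := gpts S - O'\<rparr>) H"
proof -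
  have "fixed S H = fixed (S\<lparr>gpts := O'\<rparr>) H \<union> fixed (S\<lparr>gpts := gpts S - O'\<rparr>) H"
    "fixed (S\<lparr>gpts := O'\<rparr>) H \<inter> fixed (S\<lparr>gpts := gpts S - O'\<rparr>) H = {}"
    using assms(2) by (auto simp: fixed_def)
  then show ?thesis
    unfolding mark_def using finite_fixed[OF assms(1), of H] by (simp add: card_Un_disjoint)
qed

text \<open>Both orbits are the coset space of the common stabilizer; the isomorphism sends the
  translate of \<open>x\<close> by \<open>g\<close> to that of \<open>y\<close> by
  \<open>g\<close>.\<close>

lemma orbit_iso:
  assumes S: "S \<in> finite_gsets G" "x \<in> gpts S" and T: "T \<in> finite_gsets G" "y \<in> gpts T" and st: "stab S x = stab T y"
  shows "gset_iso G (S\<lparr>gpts := orbit S x\<rparr>) (T\<lparr>gpts := orbit T y\<rparr>)"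
proof -
  have eq: "gact S x g = gact S x h \<longleftrightarrow> gact T y g = gact T y h" if "g \<in> carrier G" "h \<in> carrier G" for g h
    using gact_eq_iff[OF S that] gact_eq_iff[OF T that] st by simp
  define f where "f = (\<lambda>z. gact T y (SOME g. g \<in> carrier G \<and> gact S x g = z))"
  have f: "f (gact S x g) = gact T y g" if "g \<in> carrier G" for g
  proof -
    have "(SOME h. h \<in> carrier G \<and> gact S x h = gact S x g) \<in> carrier G \<and>
        gact S x (SOME h. h \<in> carrier G \<and> gact S x h = gact S x g) = gact S x g"
      by (rule someI[of "\<lambda>h. h \<in> carrier G \<and> gact S x h = gact S x g" g]) (use that in simp)
    then show ?thesis unfolding f_def using eq that by blast
  qed
  have "bij_betw f (orbit S x) (orbit T y)"
    unfolding bij_betw_def orbit_def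
  proof
    show "inj_on f (gact S x ` carrier G)" using f eq by (auto simp: inj_on_def)
    show "f ` gact S x ` carrier G = gact T y ` carrier G" using f by (auto simp: image_image)
  qed
  moreover have "f (gact S z g) = gact T (f z) g" if z: "z \<in> orbit S x" and g: "g \<in> carrier G" for z g
  proof -
    obtain h where h: "h \<in> carrier G" "z = gact S x h" using z by (auto simp: orbit_def)
    have "f (gact S z g) = f (gact S x (h \<otimes> g))" using gsetD(4)[OF S h(1) g] h(2) by simp
    also have "\<dots> = gact T (gact T y h) g" using f[of "h \<otimes> g"] gsetD(4)[OF T h(1) g] h g by simp
    finally show ?thesis using f[OF h(1)] h(2) by simp
  qed
  ultimately show ?thesis by (auto simp: gset_iso_def)
qed

text \<open>Split off the orbit of a point \<open>x\<close> with the largest stabilizer. Its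
  stabilizer fixes some \<open>y\<close> in \<open>T\<close>, and that of \<open>y\<close> fixes
  some \<open>z\<close> in \<open>S\<close>, because nonzero marks agree. The stabilizers of
  \<open>x\<close>, \<open>y\<close>, \<open>z\<close> thus increase, and maximality makes them
  equal, not just conjugate. The complements of the two orbits again have equal marks.\<close>

theorem marks_iso:
  assumes "S \<in> finite_gsets G" "T \<in> finite_gsets G" "\<And>H. mark S H = mark T H"
  shows "gset_iso G S T"
  using assms
proof (induction "card (gpts S)" arbitrary: S T rule: less_induct)
  case less
  note S = less.prems(1) and T = less.prems(2) and marks = less.prems(3)
  show ?case
  proof (cases "gpts S = {}")
    case True
    then have "card (gpts T) = 0" using marks[of "{}"] by (simp add: mark_def fixed_def)
    then have "gpts T = {}" using gsetD(1)[OF T] by simp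
    with True show ?thesis by (simp add: gset_iso_def bij_betw_def)
  next
    case False
    let ?c = "\<lambda>z. card (stab S z)"
    have fin: "finite (?c ` gpts S)" using gsetD(1)[OF S] by simp
    then have "Max (?c ` gpts S) \<in> ?c ` gpts S" using False by (intro Max_in) auto
    then obtain x where xS: "x \<in> gpts S" and "?c x = Max (?c ` gpts S)" by auto
    then have x: "?c z \<le> ?c x" if "z \<in> gpts S" for z using Max_ge[OF fin] that by simp
    have fixed_iff: "z \<in> fixed U (stab V w) \<longleftrightarrow> z \<in> gpts U \<and> stab V w \<subseteq> stab U z" for U V :: "('a, nat) gset" and z w
      by (auto simp: fixed_def stab_def)
    have pos: "fixed S H \<noteq> {} \<longleftrightarrow> fixed T H \<noteq> {}" for H
      using marks[of H] finite_fixed[OF S, of H] finite_fixed[OF T, of H] by (auto simp: mark_def card_eq_0_iff)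
    have "x \<in> fixed S (stab S x)" using xS by (simp add: fixed_iff)
    then obtain y where y: "y \<in> gpts T" "stab S x \<subseteq> stab T y" using pos fixed_iff by blast
    then have "y \<in> fixed T (stab T y)" by (simp add: fixed_iff)
    then obtain z where z: "z \<in> gpts S" "stab T y \<subseteq> stab S z" using pos fixed_iff by blast
    have fins: "finite (stab S z)" using finite_carrier by (simp add: stab_def)
    have "stab S x = stab S z"
      using y(2) z(2) x[OF z(1)] by (intro card_seteq[OF fins]) auto
    then have st: "stab S x = stab T y" using y(2) z(2) by auto
    let ?S1 = "S\<lparr>gpts := orbit S x\<rparr>" and ?S2 = "S\<lparr>gpts := gpts S - orbit S x\<rparr>"
    let ?T1 = "T\<lparr>gpts := orbit T y\<rparr>" and ?T2 = "T\<lparr>gpts := gpts T - orbit T y\<rparr>"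
    have sub: "orbit S x \<subseteq> gpts S" "orbit T y \<subseteq> gpts T" using orbit_subset S T xS y by auto
    have S2: "?S2 \<in> finite_gsets G" and T2: "?T2 \<in> finite_gsets G"
      using orbit_act[OF S xS] orbit_act[OF T y(1)] gsetD(2)[OF S] gsetD(2)[OF T]
      by (auto intro!: restrict_in S T)
    have iso1: "gset_iso G ?S1 ?T1" by (rule orbit_iso[OF S xS T y(1) st])
    have "mark ?S1 H = mark ?T1 H" for H
      using sub orbit_act[OF S xS] by (intro mark_iso[OF iso1]) auto
    then have "mark ?S2 H = mark ?T2 H" for H
      using mark_split[OF S sub(1), of H] mark_split[OF T sub(2), of H] marks[of H] by simp
    moreover have "card (gpts ?S2) < card (gpts S)"
    proof (rule psubset_card_mono[OF gsetD(1)[OF S]])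
      have "x \<in> orbit S x" using gsetD(3)[OF S xS] by (auto simp: orbit_def intro!: image_eqI[of _ _ \<one>])
      then show "gpts ?S2 \<subset> gpts S" using xS by auto
    qed
    ultimately have iso2: "gset_iso G ?S2 ?T2" using less.hyps S2 T2 by blast
    obtain f1 where f1: "bij_betw f1 (orbit S x) (orbit T y)"
      "\<And>z g. z \<in> orbit S x \<Longrightarrow> g \<in> carrier G \<Longrightarrow> f1 (gact S z g) = gact T (f1 z) g"
      using iso1 by (auto simp: gset_iso_def)
    obtain f2 where f2: "bij_betw f2 (gpts S - orbit S x) (gpts T - orbit T y)"
      "\<And>z g. z \<in> gpts S - orbit S x \<Longrightarrow> g \<in> carrier G \<Longrightarrow> f2 (gact S z g) = gact T (f2 z) g"
      using iso2 by (auto simp: gset_iso_def)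
    let ?f = "\<lambda>z. if z \<in> orbit S x then f1 z else f2 z"
    have "bij_betw ?f (orbit S x \<union> (gpts S - orbit S x)) (orbit T y \<union> (gpts T - orbit T y))"
    proof (rule bij_betw_combine)
      show "bij_betw ?f (orbit S x) (orbit T y)" using f1(1) by (subst bij_betw_cong[where g = f1]) auto
      show "bij_betw ?f (gpts S - orbit S x) (gpts T - orbit T y)" using f2(1) by (subst bij_betw_cong[where g = f2]) auto
    qed auto
    then have "bij_betw ?f (gpts S) (gpts T)" using sub by (simp add: Un_absorb1)
    moreover have "?f (gact S z g) = gact T (?f z) g" if "z \<in> gpts S" "g \<in> carrier G" for z g
      using f1(2) f2(2) that orbit_act[OF S xS that] by auto
    ultimately show ?thesis unfolding gset_iso_def by blast
  qed
qed

lemma gset_class_eq: "S \<in> finite_gsets G \<Longrightarrow> gset_class G S = {T \<in> finite_gsets G. mark S = mark T}"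
  unfolding gset_class_def using marks_iso[of S] mark_iso[of S] gsetD(2)[of S] by (auto simp: fun_eq_iff)

lemma gset_class_eq_iff:
  assumes "S \<in> finite_gsets G" "T \<in> finite_gsets G"
  shows "gset_class G S = gset_class G T \<longleftrightarrow> mark S = mark T"
  using assms by (auto simp: gset_class_eq)

end

section \<open>Rings of functions\<close>

text \<open>A ring record has no field for negatives, so only the existence of an element with
  negated values is asked.\<close>

lemma cring_pointwiseI:
  fixes R :: "('a, 'r) ring_scheme" and \<nu> :: "'a \<Rightarrow> 'i \<Rightarrow> int"
  assumes closed: "\<zero>\<^bsub>R\<^esub> \<in> carrier R" "\<one>\<^bsub>R\<^esub> \<in> carrier R"
      "\<And>x y. x \<in> carrier R \<Longrightarrow> y \<in> carrier R \<Longrightarrow> x \<oplus>\<^bsub>R\<^esub> y \<in> carrier R"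
      "\<And>x y. x \<in> carrier R \<Longrightarrow> y \<in> carrier R \<Longrightarrow> x \<otimes>\<^bsub>R\<^esub> y \<in> carrier R"
    and neg: "\<And>x. x \<in> carrier R \<Longrightarrow> \<exists>y \<in> carrier R. \<nu> y = (\<lambda>i. - \<nu> x i)"
    and \<nu>: "\<nu> \<zero>\<^bsub>R\<^esub> = (\<lambda>i. 0)" "\<nu> \<one>\<^bsub>R\<^esub> = (\<lambda>i. 1)"
      "\<And>x y. x \<in> carrier R \<Longrightarrow> y \<in> carrier R \<Longrightarrow> \<nu> (x \<oplus>\<^bsub>R\<^esub> y) = (\<lambda>i. \<nu> x i + \<nu> y i)"
      "\<And>x y. x \<in> carrier R \<Longrightarrow> y \<in> carrier R \<Longrightarrow> \<nu> (x \<otimes>\<^bsub>R\<^esub> y) = (\<lambda>i. \<nu> x i * \<nu> y i)"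
    and inj: "inj_on \<nu> (carrier R)"
  shows "cring R"
proof (rule cringI)
  note eqI = inj_onD[OF inj]
  show "abelian_group R"
  proof (rule abelian_groupI)
    fix x assume x: "x \<in> carrier R"
    then obtain y where "y \<in> carrier R" "\<nu> y = (\<lambda>i. - \<nu> x i)" using neg by blast
    with x show "\<exists>y\<in>carrier R. y \<oplus>\<^bsub>R\<^esub> x = \<zero>\<^bsub>R\<^esub>"
      by (intro bexI[of _ y] eqI) (simp_all add: closed \<nu>)
  qed (auto intro!: eqI simp: closed \<nu> algebra_simps)
  show "comm_monoid R"
    by (rule comm_monoidI) (auto intro!: eqI simp: closed \<nu> algebra_simps)
qed (auto intro!: inj_onD[OF inj] simp: closed \<nu> algebra_simps)

locale semiring_of_functions =
  fixes R :: "('a, 'r) ring_scheme" and m :: "'a \<Rightarrow> 'i \<Rightarrow> int"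
  assumes closed: "\<zero>\<^bsub>R\<^esub> \<in> carrier R" "\<one>\<^bsub>R\<^esub> \<in> carrier R"
      "\<And>x y. x \<in> carrier R \<Longrightarrow> y \<in> carrier R \<Longrightarrow> x \<oplus>\<^bsub>R\<^esub> y \<in> carrier R"
      "\<And>x y. x \<in> carrier R \<Longrightarrow> y \<in> carrier R \<Longrightarrow> x \<otimes>\<^bsub>R\<^esub> y \<in> carrier R"
    and m: "m \<zero>\<^bsub>R\<^esub> = (\<lambda>i. 0)" "m \<one>\<^bsub>R\<^esub> = (\<lambda>i. 1)"
      "\<And>x y. x \<in> carrier R \<Longrightarrow> y \<in> carrier R \<Longrightarrow> m (x \<oplus>\<^bsub>R\<^esub> y) = (\<lambda>i. m x i + m y i)"
      "\<And>x y. x \<in> carrier R \<Longrightarrow> y \<in> carrier R \<Longrightarrow> m (x \<otimes>\<^bsub>R\<^esub> y) = (\<lambda>i. m x i * m y i)"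
    and inj: "inj_on m (carrier R)"
begin

abbreviation "A \<equiv> grothendieck_ring R"

text \<open>Since \<open>m\<close> is injective with values in a group, addition in \<open>R\<close>
  is cancellative. The classes are therefore the fibres of the difference of values, with
  \<open>k\<close> taken to be zero.\<close>

lemma diff_class_eq:
  assumes "a \<in> carrier R" "b \<in> carrier R"
  shows "diff_class R a b = {(c, d). c \<in> carrier R \<and> d \<in> carrier R \<and> (\<forall>i. m a i - m b i = m c i - m d i)}"
proof -
  have "(\<exists>k\<in>carrier R. a \<oplus>\<^bsub>R\<^esub> d \<oplus>\<^bsub>R\<^esub> k = c \<oplus>\<^bsub>R\<^esub> b \<oplus>\<^bsub>R\<^esub> k) \<longleftrightarrow> (\<forall>i. m a i - m b i = m c i - m d i)"
    if cd: "c \<in> carrier R" "d \<in> carrier R" for c d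
  proof
    assume "\<exists>k\<in>carrier R. a \<oplus>\<^bsub>R\<^esub> d \<oplus>\<^bsub>R\<^esub> k = c \<oplus>\<^bsub>R\<^esub> b \<oplus>\<^bsub>R\<^esub> k"
    then obtain k where k: "k \<in> carrier R" "m (a \<oplus>\<^bsub>R\<^esub> d \<oplus>\<^bsub>R\<^esub> k) = m (c \<oplus>\<^bsub>R\<^esub> b \<oplus>\<^bsub>R\<^esub> k)" by metis
    then have "m a i + m d i + m k i = m c i + m b i + m k i" for i
      using assms cd by (simp add: m closed fun_eq_iff)
    then show "\<forall>i. m a i - m b i = m c i - m d i" by (smt (verit))
  next
    assume *: "\<forall>i. m a i - m b i = m c i - m d i"
    have "m a i + m d i = m c i + m b i" for i using *[rule_format, of i] by linarith
    then have "a \<oplus>\<^bsub>R\<^esub> d = c \<oplus>\<^bsub>R\<^esub> b"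
      using assms cd by (intro inj_onD[OF inj]) (simp_all add: m closed)
    then show "\<exists>k\<in>carrier R. a \<oplus>\<^bsub>R\<^esub> d \<oplus>\<^bsub>R\<^esub> k = c \<oplus>\<^bsub>R\<^esub> b \<oplus>\<^bsub>R\<^esub> k" using closed(1) by auto
  qed
  then show ?thesis unfolding diff_class_def by auto
qed

definition value_at :: "('a \<times> 'a) set \<Rightarrow> 'i \<Rightarrow> int" where
  "value_at D i = (case SOME p. p \<in> D of (a, b) \<Rightarrow> m a i - m b i)"

lemma value_at_diff_class:
  assumes "a \<in> carrier R" "b \<in> carrier R"
  shows "value_at (diff_class R a b) = (\<lambda>i. m a i - m b i)"
proof -
  have "(a, b) \<in> diff_class R a b" using assms by (simp add: diff_class_eq)
  then have "(SOME p. p \<in> diff_class R a b) \<in> diff_class R a b" by (rule someI[of "\<lambda>p. p \<in> diff_class R a b"])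
  then show ?thesis unfolding value_at_def using assms by (auto simp: diff_class_eq fun_eq_iff split: prod.splits)
qed

lemma diff_class_cong:
  assumes "a \<in> carrier R" "b \<in> carrier R" "c \<in> carrier R" "d \<in> carrier R" "\<And>i. m a i - m b i = m c i - m d i"
  shows "diff_class R a b = diff_class R c d"
  using assms by (simp add: diff_class_eq)

lemma grothendieck_carrier: "carrier A = {diff_class R a b | a b. a \<in> carrier R \<and> b \<in> carrier R}"
  and grothendieck_zero: "\<zero>\<^bsub>A\<^esub> = diff_class R \<zero>\<^bsub>R\<^esub> \<zero>\<^bsub>R\<^esub>"
  and grothendieck_one: "\<one>\<^bsub>A\<^esub> = diff_class R \<one>\<^bsub>R\<^esub> \<zero>\<^bsub>R\<^esub>"
  by (simp_all add: grothendieck_ring_def)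

text \<open>The operations of the Grothendieck ring are unions over representatives; independence of
  the choice collapses each union to a single class.\<close>

lemma diff_class_Union:
  assumes cl: "a \<in> carrier R" "b \<in> carrier R" "c \<in> carrier R" "d \<in> carrier R"
    and F: "\<And>a' b' c' d'. a' \<in> carrier R \<Longrightarrow> b' \<in> carrier R \<Longrightarrow> c' \<in> carrier R \<Longrightarrow> d' \<in> carrier R \<Longrightarrow>
       (\<And>i. m a i - m b i = m a' i - m b' i) \<Longrightarrow> (\<And>i. m c i - m d i = m c' i - m d' i) \<Longrightarrow> F a' b' c' d' = F a b c d"
  shows "(\<Union>(a', b') \<in> diff_class R a b. \<Union>(c', d') \<in> diff_class R c d. F a' b' c' d') = F a b c d"
proof -
  have in1: "(a, b) \<in> diff_class R a b" "(c, d) \<in> diff_class R c d" using cl by (simp_all add: diff_class_eq)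
  have "F (fst p) (snd p) (fst q) (snd q) = F a b c d" if "p \<in> diff_class R a b" "q \<in> diff_class R c d" for p q
    using that cl by (intro F) (auto simp: diff_class_eq)
  then have "(\<Union>p \<in> diff_class R a b. \<Union>q \<in> diff_class R c d. F (fst p) (snd p) (fst q) (snd q)) = F a b c d"
    using in1 by blast
  then show ?thesis by (simp add: case_prod_unfold)
qed

lemma grothendieck_add:
  assumes "a \<in> carrier R" "b \<in> carrier R" "c \<in> carrier R" "d \<in> carrier R"
  shows "diff_class R a b \<oplus>\<^bsub>A\<^esub> diff_class R c d = diff_class R (a \<oplus>\<^bsub>R\<^esub> c) (b \<oplus>\<^bsub>R\<^esub> d)"
proof -
  have "(\<Union>(a', b') \<in> diff_class R a b. \<Union>(c', d') \<in> diff_class R c d. diff_class R (a' \<oplus>\<^bsub>R\<^esub> c') (b' \<oplus>\<^bsub>R\<^esub> d')) =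
      diff_class R (a \<oplus>\<^bsub>R\<^esub> c) (b \<oplus>\<^bsub>R\<^esub> d)"
  proof (rule diff_class_Union[OF assms], rule diff_class_cong)
    fix a' b' c' d' i
    assume "a' \<in> carrier R" "b' \<in> carrier R" "c' \<in> carrier R" "d' \<in> carrier R"
      "\<And>i. m a i - m b i = m a' i - m b' i" "\<And>i. m c i - m d i = m c' i - m d' i"
    then show "m (a' \<oplus>\<^bsub>R\<^esub> c') i - m (b' \<oplus>\<^bsub>R\<^esub> d') i = m (a \<oplus>\<^bsub>R\<^esub> c) i - m (b \<oplus>\<^bsub>R\<^esub> d) i"
      using assms by (simp add: m) (smt (verit))
  qed (use assms in \<open>auto simp: closed\<close>)
  then show ?thesis by (simp add: grothendieck_ring_def)
qed

lemma grothendieck_mult: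
  assumes "a \<in> carrier R" "b \<in> carrier R" "c \<in> carrier R" "d \<in> carrier R"
  shows "diff_class R a b \<otimes>\<^bsub>A\<^esub> diff_class R c d =
     diff_class R (a \<otimes>\<^bsub>R\<^esub> c \<oplus>\<^bsub>R\<^esub> b \<otimes>\<^bsub>R\<^esub> d) (a \<otimes>\<^bsub>R\<^esub> d \<oplus>\<^bsub>R\<^esub> b \<otimes>\<^bsub>R\<^esub> c)"
proof -
  have "(\<Union>(a', b') \<in> diff_class R a b. \<Union>(c', d') \<in> diff_class R c d.
      diff_class R (a' \<otimes>\<^bsub>R\<^esub> c' \<oplus>\<^bsub>R\<^esub> b' \<otimes>\<^bsub>R\<^esub> d') (a' \<otimes>\<^bsub>R\<^esub> d' \<oplus>\<^bsub>R\<^esub> b' \<otimes>\<^bsub>R\<^esub> c')) =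
      diff_class R (a \<otimes>\<^bsub>R\<^esub> c \<oplus>\<^bsub>R\<^esub> b \<otimes>\<^bsub>R\<^esub> d) (a \<otimes>\<^bsub>R\<^esub> d \<oplus>\<^bsub>R\<^esub> b \<otimes>\<^bsub>R\<^esub> c)"
  proof (rule diff_class_Union[OF assms], rule diff_class_cong)
    fix a' b' c' d' i
    assume *: "a' \<in> carrier R" "b' \<in> carrier R" "c' \<in> carrier R" "d' \<in> carrier R"
      "\<And>i. m a i - m b i = m a' i - m b' i" "\<And>i. m c i - m d i = m c' i - m d' i"
    have "(m a' i * m c' i + m b' i * m d' i) - (m a' i * m d' i + m b' i * m c' i) = (m a' i - m b' i) * (m c' i - m d' i)"
      by (simp add: algebra_simps)
    also have "\<dots> = (m a i - m b i) * (m c i - m d i)" using *(5)[of i] *(6)[of i] by simp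
    finally show "m (a' \<otimes>\<^bsub>R\<^esub> c' \<oplus>\<^bsub>R\<^esub> b' \<otimes>\<^bsub>R\<^esub> d') i - m (a' \<otimes>\<^bsub>R\<^esub> d' \<oplus>\<^bsub>R\<^esub> b' \<otimes>\<^bsub>R\<^esub> c') i =
        m (a \<otimes>\<^bsub>R\<^esub> c \<oplus>\<^bsub>R\<^esub> b \<otimes>\<^bsub>R\<^esub> d) i - m (a \<otimes>\<^bsub>R\<^esub> d \<oplus>\<^bsub>R\<^esub> b \<otimes>\<^bsub>R\<^esub> c) i"
      using assms *(1-4) by (simp add: m closed algebra_simps)
  qed (use assms in \<open>auto simp: closed\<close>)
  then show ?thesis by (simp add: grothendieck_ring_def)
qed

lemma grothendieck_values:
  "X \<in> carrier A \<Longrightarrow> Y \<in> carrier A \<Longrightarrow> value_at (X \<oplus>\<^bsub>A\<^esub> Y) = (\<lambda>i. value_at X i + value_at Y i)"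
  "X \<in> carrier A \<Longrightarrow> Y \<in> carrier A \<Longrightarrow> value_at (X \<otimes>\<^bsub>A\<^esub> Y) = (\<lambda>i. value_at X i * value_at Y i)"
  "value_at \<zero>\<^bsub>A\<^esub> = (\<lambda>i. 0)" "value_at \<one>\<^bsub>A\<^esub> = (\<lambda>i. 1)" "inj_on value_at (carrier A)"
proof -
  show "value_at (X \<oplus>\<^bsub>A\<^esub> Y) = (\<lambda>i. value_at X i + value_at Y i)" if "X \<in> carrier A" "Y \<in> carrier A"
    using that by (auto simp: grothendieck_carrier grothendieck_add value_at_diff_class closed m)
  show "value_at (X \<otimes>\<^bsub>A\<^esub> Y) = (\<lambda>i. value_at X i * value_at Y i)" if "X \<in> carrier A" "Y \<in> carrier A"
    using that by (auto simp: grothendieck_carrier grothendieck_mult value_at_diff_class closed m algebra_simps)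
  show "value_at \<zero>\<^bsub>A\<^esub> = (\<lambda>i. 0)" "value_at \<one>\<^bsub>A\<^esub> = (\<lambda>i. 1)"
    by (simp_all add: grothendieck_zero grothendieck_one value_at_diff_class closed m)
  show "inj_on value_at (carrier A)"
  proof (rule inj_onI)
    fix X Y assume "X \<in> carrier A" "Y \<in> carrier A" and v: "value_at X = value_at Y"
    then obtain a b c d where *: "a \<in> carrier R" "b \<in> carrier R" "X = diff_class R a b"
      "c \<in> carrier R" "d \<in> carrier R" "Y = diff_class R c d"
      by (auto simp: grothendieck_carrier)
    have "m a i - m b i = m c i - m d i" for i
      using fun_cong[OF v, of i] * by (simp add: value_at_diff_class)
    then show "X = Y" unfolding *(3,6) using * by (intro diff_class_cong)
  qed
qed

lemma value_at_image: "value_at ` carrier A = {\<lambda>i. m a i - m b i | a b. a \<in> carrier R \<and> b \<in> carrier R}"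
  by (force simp: grothendieck_carrier value_at_diff_class image_iff)

lemma diff_class_in: "a \<in> carrier R \<Longrightarrow> b \<in> carrier R \<Longrightarrow> diff_class R a b \<in> carrier A"
  unfolding grothendieck_carrier by blast

lemma grothendieck_closed:
  assumes "X \<in> carrier A" "Y \<in> carrier A"
  shows "X \<oplus>\<^bsub>A\<^esub> Y \<in> carrier A" "X \<otimes>\<^bsub>A\<^esub> Y \<in> carrier A"
proof -
  obtain a b c d where "a \<in> carrier R" "b \<in> carrier R" "X = diff_class R a b"
      "c \<in> carrier R" "d \<in> carrier R" "Y = diff_class R c d"
    using assms by (auto simp: grothendieck_carrier)
  then show "X \<oplus>\<^bsub>A\<^esub> Y \<in> carrier A" "X \<otimes>\<^bsub>A\<^esub> Y \<in> carrier A"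
    by (simp_all add: grothendieck_add grothendieck_mult diff_class_in closed)
qed

lemma cring_grothendieck: "cring A"
proof (rule cring_pointwiseI[where \<nu> = value_at])
  fix X assume "X \<in> carrier A"
  then obtain a b where "a \<in> carrier R" "b \<in> carrier R" "X = diff_class R a b" by (auto simp: grothendieck_carrier)
  then show "\<exists>Y\<in>carrier A. value_at Y = (\<lambda>i. - value_at X i)"
    by (intro bexI[of _ "diff_class R b a"]) (auto simp: diff_class_in value_at_diff_class)
next
  show "\<zero>\<^bsub>A\<^esub> \<in> carrier A" "\<one>\<^bsub>A\<^esub> \<in> carrier A"
    by (simp_all add: grothendieck_zero grothendieck_one diff_class_in closed)
qed (simp_all add: grothendieck_values grothendieck_closed)

end

section \<open>The isomorphism\<close>

context finite_group
begin

section \<open>Marks of isomorphism classes and the semiring of finite \<open>G\<close>-sets\<close>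

definition class_mark :: "('a, nat) gset set \<Rightarrow> 'a set \<Rightarrow> int" where
  "class_mark X H = int (mark (SOME S. S \<in> X) H)"

lemma gset_class_self: "S \<in> finite_gsets G \<Longrightarrow> S \<in> gset_class G S"
  by (simp add: gset_class_eq)

lemma class_mark: "S \<in> finite_gsets G \<Longrightarrow> class_mark (gset_class G S) H = int (mark S H)"
proof -
  assume S: "S \<in> finite_gsets G"
  have "(SOME T. T \<in> gset_class G S) \<in> gset_class G S"
    using gset_class_self[OF S] by (rule someI[of "\<lambda>T. T \<in> gset_class G S"])
  then show ?thesis using S by (simp add: class_mark_def gset_class_eq)
qed

lemma gset_class_Union:
  assumes S: "S \<in> finite_gsets G" and T: "T \<in> finite_gsets G"
    and F: "\<And>S' T'. S' \<in> finite_gsets G \<Longrightarrow> T' \<in> finite_gsets G \<Longrightarrow> mark S = mark S' \<Longrightarrow> mark T = mark T' \<Longrightarrow>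
      gset_class G (F S' T') = gset_class G (F S T)"
  shows "(\<Union>S' \<in> gset_class G S. \<Union>T' \<in> gset_class G T. gset_class G (F S' T')) = gset_class G (F S T)"
proof -
  have "gset_class G (F S' T') = gset_class G (F S T)" if "S' \<in> gset_class G S" "T' \<in> gset_class G T" for S' T'
    using that by (intro F) (simp_all add: gset_class_eq S T)
  then show ?thesis using gset_class_self[OF S] gset_class_self[OF T] by blast
qed

lemma gset_semiring_add:
  assumes "S \<in> finite_gsets G" "T \<in> finite_gsets G"
  shows "gset_class G S \<oplus>\<^bsub>gset_semiring G\<^esub> gset_class G T = gset_class G (gset_union S T)"
proof -
  have "(\<Union>S' \<in> gset_class G S. \<Union>T' \<in> gset_class G T. gset_class G (gset_union S' T')) = gset_class G (gset_union S T)"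
    by (rule gset_class_Union[OF assms])
      (simp add: gset_class_eq_iff gset_union_in assms mark_union fun_eq_iff)
  then show ?thesis by (simp add: gset_semiring_def)
qed

lemma gset_semiring_mult:
  assumes "S \<in> finite_gsets G" "T \<in> finite_gsets G"
  shows "gset_class G S \<otimes>\<^bsub>gset_semiring G\<^esub> gset_class G T = gset_class G (gset_prod S T)"
proof -
  have "(\<Union>S' \<in> gset_class G S. \<Union>T' \<in> gset_class G T. gset_class G (gset_prod S' T')) = gset_class G (gset_prod S T)"
    by (rule gset_class_Union[OF assms])
      (simp add: gset_class_eq_iff gset_prod_in assms mark_prod fun_eq_iff)
  then show ?thesis by (simp add: gset_semiring_def)
qed

lemma gset_semiring_sel:
  "carrier (gset_semiring G) = gset_class G ` finite_gsets G"
  "\<zero>\<^bsub>gset_semiring G\<^esub> = gset_class G gset_empty" "\<one>\<^bsub>gset_semiring G\<^esub> = gset_class G gset_point"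
  by (simp_all add: gset_semiring_def)

lemma semiring_of_marks: "semiring_of_functions (gset_semiring G) class_mark"
proof
  show "inj_on class_mark (carrier (gset_semiring G))"
    by (auto simp: inj_on_def gset_semiring_sel gset_class_eq_iff class_mark fun_eq_iff)
qed (auto simp: gset_semiring_sel gset_semiring_add gset_semiring_mult class_mark mark_union mark_prod
    mark_empty mark_point gset_union_in gset_prod_in gset_empty_in gset_point_in fun_eq_iff)

definition mark_differences :: "('a set \<Rightarrow> int) set" where
  "mark_differences = {\<lambda>H. int (mark S H) - int (mark T H) | S T :: ('a, nat) gset. S \<in> finite_gsets G \<and> T \<in> finite_gsets G}"

lemma mark_differences_mult:
  assumes "u \<in> mark_differences" "v \<in> mark_differences"
  shows "(\<lambda>H. u H * v H) \<in> mark_differences"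
proof -
  obtain S T S' T' :: "('a, nat) gset" where *: "S \<in> finite_gsets G" "T \<in> finite_gsets G" "S' \<in> finite_gsets G" "T' \<in> finite_gsets G"
    and uv: "u = (\<lambda>H. int (mark S H) - int (mark T H))" "v = (\<lambda>H. int (mark S' H) - int (mark T' H))"
    using assms by (auto simp: mark_differences_def)
  let ?P = "gset_union (gset_prod S S') (gset_prod T T')" and ?N = "gset_union (gset_prod S T') (gset_prod T S')"
  have PN: "?P \<in> finite_gsets G" "?N \<in> finite_gsets G" using * by (simp_all add: gset_union_in gset_prod_in)
  have "(\<lambda>H. u H * v H) = (\<lambda>H. int (mark ?P H) - int (mark ?N H))"
    using * by (simp add: uv mark_union mark_prod gset_prod_in algebra_simps)
  then show ?thesis unfolding mark_differences_def using PN by blast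
qed

lemma K0_embedding:
  obtains \<psi> :: "('a option, nat) pmod_arrow K0_elem \<Rightarrow> 'a set \<Rightarrow> int" where
    "bij_betw \<psi> (carrier K) mark_differences"
    "\<And>x y. x \<in> carrier K \<Longrightarrow> y \<in> carrier K \<Longrightarrow> \<psi> (x \<otimes>\<^bsub>K\<^esub> y) = (\<lambda>H. \<psi> x H + \<psi> y H)"
    "\<And>S. is_fg_module M S \<Longrightarrow> \<psi> (cls S) = (\<lambda>H. int (card (fixed_points H S)) - 1)"
proof -
  interpret K: group K by (rule group_K)
  have "\<forall>H. \<exists>d :: _ \<Rightarrow> complex. (\<forall>x \<in> carrier K. \<forall>y \<in> carrier K. d (x \<otimes>\<^bsub>K\<^esub> y) = d x + d y) \<and>
     (\<forall>S. is_fg_module M S \<longrightarrow> d (cls S) + 1 = of_nat (card (fixed_points H S)))"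
  proof
    fix H
    show "\<exists>d :: _ \<Rightarrow> complex. (\<forall>x \<in> carrier K. \<forall>y \<in> carrier K. d (x \<otimes>\<^bsub>K\<^esub> y) = d x + d y) \<and>
      (\<forall>S. is_fg_module M S \<longrightarrow> d (cls S) + 1 = of_nat (card (fixed_points H S)))"
      by (rule K_mark[of H]) blast
  qed
  from choice[OF this] obtain D :: "'a set \<Rightarrow> _ \<Rightarrow> complex" where
    D: "\<And>H x y. x \<in> carrier K \<Longrightarrow> y \<in> carrier K \<Longrightarrow> D H (x \<otimes>\<^bsub>K\<^esub> y) = D H x + D H y"
      "\<And>H S. is_fg_module M S \<Longrightarrow> D H (cls S) + 1 = of_nat (card (fixed_points H S))"
    by blast
  have clsK: "cls (add_point S) \<in> carrier K" if "S \<in> finite_gsets G" for S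
    using cls_in[OF add_point_fg[OF that]] .
  have Dcls: "D H (cls (add_point S)) = of_nat (mark S H)" if "S \<in> finite_gsets G" for H S
    using D(2)[OF add_point_fg[OF that], of H] card_fixed_points_add_point[OF that, of H] by simp
  have iso_eq: "cls (add_point S) = cls (add_point T)" if "S \<in> finite_gsets G" "T \<in> finite_gsets G" "mark S = mark T" for S T
    using cls_gset_iso[OF that(1,2) marks_iso[OF that(1,2)]] that(3) by simp
  have comm: "gset_iso G (gset_union S T) (gset_union T S)" if "S \<in> finite_gsets G" "T \<in> finite_gsets G" for S T
    using that by (intro marks_iso) (simp_all add: gset_union_in mark_union)
  \<comment> \<open>The values of \<open>D\<close> are integers, because every element is a
    difference of classes of \<open>G\<close>-sets. Floor and real part only move them from the
    complex numbers to the integers.\<close>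
  define \<psi> where "\<psi> = (\<lambda>x H. \<lfloor>Re (D H x)\<rfloor>)"
  have rep: "\<exists>S \<in> finite_gsets G. \<exists>T \<in> finite_gsets G. x \<otimes>\<^bsub>K\<^esub> cls (add_point T) = cls (add_point S)"
    if "x \<in> carrier K" for x
    by (rule K_generated[OF that comm]) blast+
  have DI: "D H x = of_int (int (mark S H) - int (mark T H))"
    if "x \<in> carrier K" "S \<in> finite_gsets G" "T \<in> finite_gsets G" "x \<otimes>\<^bsub>K\<^esub> cls (add_point T) = cls (add_point S)" for x S T H
    using D(1)[OF that(1) clsK[OF that(3)], of H] Dcls[OF that(2), of H] Dcls[OF that(3), of H] that(4) by (simp add: algebra_simps)
  have \<psi>I: "\<psi> x = (\<lambda>H. int (mark S H) - int (mark T H))"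
    if "x \<in> carrier K" "S \<in> finite_gsets G" "T \<in> finite_gsets G" "x \<otimes>\<^bsub>K\<^esub> cls (add_point T) = cls (add_point S)" for x S T
  proof -
    have "\<lfloor>Re (of_int z)\<rfloor> = z" for z :: int by simp
    then show ?thesis unfolding \<psi>_def DI[OF that] by blast
  qed
  have \<psi>D: "of_int (\<psi> x H) = D H x" if x: "x \<in> carrier K" for x H
  proof -
    obtain S T where "S \<in> finite_gsets G" "T \<in> finite_gsets G" "x \<otimes>\<^bsub>K\<^esub> cls (add_point T) = cls (add_point S)"
      using rep[OF x] by blast
    from DI[OF x this, of H] fun_cong[OF \<psi>I[OF x this], of H] show ?thesis by simp
  qed
  show thesis
  proof (rule that[of \<psi>])
    show add: "\<psi> (x \<otimes>\<^bsub>K\<^esub> y) = (\<lambda>H. \<psi> x H + \<psi> y H)" if "x \<in> carrier K" "y \<in> carrier K" for x y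
    proof
      fix H
      have "(of_int (\<psi> (x \<otimes>\<^bsub>K\<^esub> y) H) :: complex) = of_int (\<psi> x H + \<psi> y H)"
        using that by (simp add: \<psi>D D)
      then show "\<psi> (x \<otimes>\<^bsub>K\<^esub> y) H = \<psi> x H + \<psi> y H" by (simp only: of_int_eq_iff)
    qed
    show "\<psi> (cls S) = (\<lambda>H. int (card (fixed_points H S)) - 1)" if S: "is_fg_module M S" for S
    proof
      fix H
      have "(of_int (\<psi> (cls S) H + 1) :: complex) = of_int (int (card (fixed_points H S)))"
        using D(2)[OF S, of H] by (simp add: \<psi>D[OF cls_in[OF S]])
      then have "\<psi> (cls S) H + 1 = int (card (fixed_points H S))" by (simp only: of_int_eq_iff)
      then show "\<psi> (cls S) H = int (card (fixed_points H S)) - 1" by simp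
    qed
    show "bij_betw \<psi> (carrier K) mark_differences"
      unfolding bij_betw_def
    proof
      show "inj_on \<psi> (carrier K)"
      proof (rule inj_onI)
        fix x y assume xy: "x \<in> carrier K" "y \<in> carrier K" "\<psi> x = \<psi> y"
        obtain S T where ST: "S \<in> finite_gsets G" "T \<in> finite_gsets G" "x \<otimes>\<^bsub>K\<^esub> cls (add_point T) = cls (add_point S)"
          using rep[OF xy(1)] by blast
        obtain S' T' where ST': "S' \<in> finite_gsets G" "T' \<in> finite_gsets G" "y \<otimes>\<^bsub>K\<^esub> cls (add_point T') = cls (add_point S')"
          using rep[OF xy(2)] by blast
        have "int (mark S H) - int (mark T H) = int (mark S' H) - int (mark T' H)" for H
          using fun_cong[OF xy(3), of H] \<psi>I[OF xy(1) ST] \<psi>I[OF xy(2) ST'] by simp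
        then have m: "mark S H + mark T' H = mark S' H + mark T H" for H
          by (smt (verit) of_nat_add of_nat_eq_iff)
        \<comment> \<open>With \<open>x\<close> the difference of \<open>S\<close> and
          \<open>T\<close>, and \<open>y\<close> that of \<open>S'\<close> and \<open>T'\<close>,
          equal marks make the union of \<open>S\<close> and \<open>T'\<close> isomorphic to that of
          \<open>S'\<close> and \<open>T\<close>. Both elements are brought over the union of
          \<open>T\<close> and \<open>T'\<close>, which then cancels.\<close>
        have "x \<otimes>\<^bsub>K\<^esub> cls (add_point (gset_union T T')) = cls (add_point (gset_union S T'))"
          using ST ST' xy clsK by (simp add: cls_gset_union flip: K.m_assoc)
        also have "\<dots> = cls (add_point (gset_union S' T))"
          using ST ST' m by (intro iso_eq) (simp_all add: gset_union_in mark_union fun_eq_iff)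
        also have "\<dots> = y \<otimes>\<^bsub>K\<^esub> cls (add_point (gset_union T' T))"
          using ST ST' xy clsK by (simp add: cls_gset_union flip: K.m_assoc)
        also have "cls (add_point (gset_union T' T)) = cls (add_point (gset_union T T'))"
          using ST ST' by (intro iso_eq) (simp_all add: gset_union_in mark_union fun_eq_iff)
        finally show "x = y"
          using K.right_cancel[OF clsK[OF gset_union_in[OF ST(2) ST'(2)]] xy(1,2)] by (simp only:)
      qed
      show "\<psi> ` carrier K = mark_differences"
      proof
        show "\<psi> ` carrier K \<subseteq> mark_differences"
        proof
          fix u assume "u \<in> \<psi> ` carrier K"
          then obtain x where x: "x \<in> carrier K" "u = \<psi> x" by blast
          obtain S T where "S \<in> finite_gsets G" "T \<in> finite_gsets G" "x \<otimes>\<^bsub>K\<^esub> cls (add_point T) = cls (add_point S)"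
            using rep[OF x(1)] by blast
          then show "u \<in> mark_differences"
            using \<psi>I[OF x(1)] x(2) unfolding mark_differences_def by blast
        qed
        show "mark_differences \<subseteq> \<psi> ` carrier K"
        proof
          fix u assume "u \<in> mark_differences"
          then obtain S T where ST: "S \<in> finite_gsets G" "T \<in> finite_gsets G" "u = (\<lambda>H. int (mark S H) - int (mark T H))"
            by (auto simp: mark_differences_def)
          let ?x = "cls (add_point S) \<otimes>\<^bsub>K\<^esub> inv\<^bsub>K\<^esub> cls (add_point T)"
          have x: "?x \<in> carrier K" "?x \<otimes>\<^bsub>K\<^esub> cls (add_point T) = cls (add_point S)"
            using clsK ST by (simp_all add: K.m_assoc)
          show "u \<in> \<psi> ` carrier K"
            unfolding ST(3) \<psi>I[OF x(1) ST(1,2) x(2), symmetric] by (rule imageI[OF x(1)])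
        qed
      qed
    qed
  qed
qed

text \<open>Off the base point the smash product is the product of the two complements, with the
  diagonal action; an element of \<open>G\<close> never sends such a pair to the base point. So the
  reduced numbers of fixed points multiply.\<close>

lemma smash_fg:
  assumes A: "is_fg_module M A" and B: "is_fg_module M B"
  shows "is_fg_module M (smash A B)"
    "card (fixed_points H (smash A B)) - 1 = (card (fixed_points H A) - 1) * (card (fixed_points H B) - 1)"
proof -
  let ?b = "prod_encode (mbase A, mbase B)"
  let ?N = "prod_encode ` ((mpts A - {mbase A}) \<times> (mpts B - {mbase B}))"
  note a = fg_moduleD[OF A] and b = fg_moduleD[OF B]
  have pts: "mpts (smash A B) = insert ?b ?N"
  proof
    show "mpts (smash A B) \<subseteq> insert ?b ?N" by (auto simp: smash_def smash_pair_def)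
    have "?b \<in> mpts (smash A B)" using a(2) b(2) by (auto simp: smash_def smash_pair_def)
    moreover have "?N \<subseteq> mpts (smash A B)"
    proof
      fix z assume "z \<in> ?N"
      then obtain x y where "x \<in> mpts A" "y \<in> mpts B" "x \<noteq> mbase A" "y \<noteq> mbase B" "z = prod_encode (x, y)" by auto
      then have "z = smash_pair A B x y" "x \<in> mpts A" "y \<in> mpts B" by (simp_all add: smash_pair_def)
      then show "z \<in> mpts (smash A B)" by (auto simp: smash_def)
    qed
    ultimately show "insert ?b ?N \<subseteq> mpts (smash A B)" by simp
  qed
  have base: "mbase (smash A B) = ?b" by (simp add: smash_def)
  have act: "mact (smash A B) (prod_encode (x, y)) m = smash_pair A B (mact A x m) (mact B y m)" for x y m
    by (simp add: smash_def)
  have act_N: "mact (smash A B) (prod_encode (x, y)) (Some g) = prod_encode (mact A x (Some g), mact B y (Some g))"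
    if "x \<in> mpts A" "y \<in> mpts B" "x \<noteq> mbase A" "y \<noteq> mbase B" "g \<in> carrier G" for x y g
    using that mact_eq_base_iff[OF A] mact_eq_base_iff[OF B] by (simp add: act smash_pair_def)
  have act_b: "mact (smash A B) ?b (Some g) = ?b" if "g \<in> carrier G" for g
    using that a(4) b(4) by (simp add: act smash_pair_def)
  show fg: "is_fg_module M (smash A B)"
    unfolding fg_module_iff pts base
  proof (intro conjI ballI)
    show "finite (insert ?b ?N)" using a(1) b(1) by simp
    fix g assume g: "g \<in> carrier G"
    show "mact (smash A B) ?b (Some g) = ?b" by (rule act_b[OF g])
  next
    fix s g assume s: "s \<in> insert ?b ?N" and g: "g \<in> carrier G"
    have in_N: "prod_encode (mact A x (Some g), mact B y (Some g)) \<in> ?N"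
      if "x \<in> mpts A" "y \<in> mpts B" "x \<noteq> mbase A" "y \<noteq> mbase B" for x y
      using that g mact_eq_base_iff[OF A _ g] mact_eq_base_iff[OF B _ g] a(3) b(3) by auto
    consider "s = ?b" | x y where "x \<in> mpts A" "y \<in> mpts B" "x \<noteq> mbase A" "y \<noteq> mbase B" "s = prod_encode (x, y)"
      using s by auto
    note cs = this
    show "mact (smash A B) s (Some g) \<in> insert ?b ?N"
      using cs
    proof cases
      case 2
      show ?thesis unfolding 2(5) act_N[OF 2(1-4) g] by (rule insertI2[OF in_N[OF 2(1-4)]])
    qed (simp add: act_b g)
    fix h assume h: "h \<in> carrier G"
    show "mact (smash A B) s (Some (g \<otimes> h)) = mact (smash A B) (mact (smash A B) s (Some g)) (Some h)"
      using cs
    proof cases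
      case 2
      have "mact A x (Some g) \<noteq> mbase A" "mact B y (Some g) \<noteq> mbase B"
        using 2 mact_eq_base_iff[OF A _ g] mact_eq_base_iff[OF B _ g] by simp_all
      then show ?thesis using 2 g h a(3,6) b(3,6) by (simp add: act_N)
    qed (simp add: act_b g h)
  next
    fix s assume s: "s \<in> insert ?b ?N"
    consider "s = ?b" | x y where "x \<in> mpts A" "y \<in> mpts B" "x \<noteq> mbase A" "y \<noteq> mbase B" "s = prod_encode (x, y)"
      using s by auto
    then show "mact (smash A B) s (Some \<one>) = s"
      by cases (simp_all add: act_b act_N a(5) b(5))
    show "mact (smash A B) s None = ?b" using s a(2,7) b(2,7) by (auto simp: act smash_pair_def)
  qed simp
  have "fixed_points H (smash A B) - {?b} =
      prod_encode ` ((fixed_points H A - {mbase A}) \<times> (fixed_points H B - {mbase B}))"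
    unfolding fixed_points_def pts by (auto simp: act_N)
  then have "card (fixed_points H (smash A B) - {?b}) =
      card (fixed_points H A - {mbase A}) * card (fixed_points H B - {mbase B})"
    by (simp only: card_image[OF inj_prod_encode] card_cartesian_product)
  then show "card (fixed_points H (smash A B)) - 1 = (card (fixed_points H A) - 1) * (card (fixed_points H B) - 1)"
    using fixed_points_base[OF fg, of H] fixed_points_base[OF A, of H] fixed_points_base[OF B, of H] base
    by (simp add: card_Diff_singleton)
qed

theorem burnside_ring_iso:
  "cring (burnside_ring G) \<and> (\<exists>!\<mu>. induced_by_smash G \<mu>) \<and> cring (G0_ring G) \<and>
   (\<exists>\<phi>. \<phi> \<in> ring_iso (burnside_ring G) (G0_ring G) \<and>
      (\<forall>S \<in> finite_gsets G. \<phi> (burnside_class G S) = G0_class G (add_point S)))"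
proof -
  interpret K: group K by (rule group_K)
  interpret B: semiring_of_functions "gset_semiring G" class_mark by (rule semiring_of_marks)
  let ?V = "mark_differences"
  obtain \<psi> :: "('a option, nat) pmod_arrow K0_elem \<Rightarrow> 'a set \<Rightarrow> int" where bij: "bij_betw \<psi> (carrier K) ?V"
    and add: "\<And>x y. x \<in> carrier K \<Longrightarrow> y \<in> carrier K \<Longrightarrow> \<psi> (x \<otimes>\<^bsub>K\<^esub> y) = (\<lambda>H. \<psi> x H + \<psi> y H)"
    and cls: "\<And>S. is_fg_module M S \<Longrightarrow> \<psi> (cls S) = (\<lambda>H. int (card (fixed_points H S)) - 1)"
    by (rule K0_embedding) blast
  have inj: "inj_on \<psi> (carrier K)" and img: "\<psi> ` carrier K = ?V" using bij by (auto simp: bij_betw_def)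
  have eqI: "x = y" if "\<psi> x = \<psi> y" "x \<in> carrier K" "y \<in> carrier K" for x y using inj_onD[OF inj that] .
  have one: "\<psi> \<one>\<^bsub>K\<^esub> = (\<lambda>H. 0)"
  proof
    fix H
    have "\<psi> \<one>\<^bsub>K\<^esub> H = \<psi> \<one>\<^bsub>K\<^esub> H + \<psi> \<one>\<^bsub>K\<^esub> H"
      using fun_cong[OF add[OF K.one_closed K.one_closed], of H] by simp
    then show "\<psi> \<one>\<^bsub>K\<^esub> H = 0" by simp
  qed
  have inv: "\<psi> (inv\<^bsub>K\<^esub> x) = (\<lambda>H. - \<psi> x H)" if "x \<in> carrier K" for x
  proof
    fix H
    have "\<psi> (inv\<^bsub>K\<^esub> x) H + \<psi> x H = 0"
      using fun_cong[OF add[OF K.inv_closed[OF that] that], of H] that one by simp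
    then show "\<psi> (inv\<^bsub>K\<^esub> x) H = - \<psi> x H" by simp
  qed
  have mark_cls: "\<psi> (cls (add_point S)) = (\<lambda>H. int (mark S H))" if "S \<in> finite_gsets G" for S
    using cls[OF add_point_fg[OF that]] card_fixed_points_add_point[OF that] by simp
  have clsK: "cls (add_point S) \<in> carrier K" if "S \<in> finite_gsets G" for S
    using cls_in[OF add_point_fg[OF that]] .
  have decomp: "\<exists>S \<in> finite_gsets G. \<exists>T \<in> finite_gsets G. x \<otimes>\<^bsub>K\<^esub> cls (add_point T) = cls (add_point S)"
    if x: "x \<in> carrier K" for x
  proof -
    have "\<psi> x \<in> ?V" using img x by blast
    then obtain S T where ST: "S \<in> finite_gsets G" "T \<in> finite_gsets G" "\<psi> x = (\<lambda>H. int (mark S H) - int (mark T H))"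
      by (auto simp: mark_differences_def)
    then have "x \<otimes>\<^bsub>K\<^esub> cls (add_point T) = cls (add_point S)"
      using clsK x by (intro eqI) (simp_all add: add mark_cls)
    with ST show ?thesis by blast
  qed
  have inv\<psi>: "inv_into (carrier K) \<psi> u \<in> carrier K" "\<psi> (inv_into (carrier K) \<psi> u) = u" if "u \<in> ?V" for u
    using that img by (auto intro: inv_into_into f_inv_into_f)
  have inV: "\<psi> x \<in> ?V" if "x \<in> carrier K" for x using img that by blast
  \<comment> \<open>The pointwise product of marks, transported back along \<psi>. The value
    \<open>undefined\<close> off the carrier is the one prescribed by
    \<open>induced_by_smash\<close>, which is what makes \<mu> unique as a function.\<close>
  define \<mu>0 where "\<mu>0 = (\<lambda>x y. if x \<in> carrier K \<and> y \<in> carrier K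
     then inv_into (carrier K) \<psi> (\<lambda>H. \<psi> x H * \<psi> y H) else undefined)"
  have \<mu>0: "\<mu>0 x y \<in> carrier K" "\<psi> (\<mu>0 x y) = (\<lambda>H. \<psi> x H * \<psi> y H)" if "x \<in> carrier K" "y \<in> carrier K" for x y
    using inv\<psi>[OF mark_differences_mult[OF inV[OF that(1)] inV[OF that(2)]]] that by (simp_all add: \<mu>0_def)
  have smash: "\<psi> (cls (smash S T)) = (\<lambda>H. \<psi> (cls S) H * \<psi> (cls T) H)"
    if "is_fg_module M S" "is_fg_module M T" for S T :: "('a option, nat) pmod"
  proof
    fix H
    have *: "int (card (fixed_points H A)) - 1 = int (card (fixed_points H A) - 1)" if "is_fg_module M A" for A :: "('a option, nat) pmod"
      using card_fixed_points_pos[OF that, of H] by simp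
    show "\<psi> (cls (smash S T)) H = \<psi> (cls S) H * \<psi> (cls T) H"
      using that smash_fg(1)[OF that] smash_fg(2)[OF that, of H] by (simp add: cls *)
  qed
  have induced: "induced_by_smash G \<mu>0"
    unfolding induced_by_smash_def Let_def G0_class_def FG_simps
  proof (intro conjI ballI allI impI)
    fix x y assume "x \<notin> carrier K \<or> y \<notin> carrier K"
    then show "\<mu>0 x y = undefined" by (auto simp: \<mu>0_def)
  next
    fix S T :: "('a option, nat) pmod" assume "S \<in> {S. is_fg_module M S}" "T \<in> {S. is_fg_module M S}"
    then show "\<mu>0 (cls S) (cls T) = cls (smash S T)"
      using smash_fg(1)[of S T] by (intro eqI) (simp_all add: \<mu>0 cls_in smash)
  next
    fix x y z assume "x \<in> carrier K" "y \<in> carrier K" "z \<in> carrier K"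
    then show "\<mu>0 (x \<otimes>\<^bsub>K\<^esub> y) z = \<mu>0 x z \<otimes>\<^bsub>K\<^esub> \<mu>0 y z" "\<mu>0 z (x \<otimes>\<^bsub>K\<^esub> y) = \<mu>0 z x \<otimes>\<^bsub>K\<^esub> \<mu>0 z y"
      by (intro eqI; simp add: \<mu>0 add algebra_simps)+
  qed (rule \<mu>0(1))
  have unique: "\<mu> = \<mu>0" if \<mu>: "induced_by_smash G \<mu>" for \<mu>
  proof (intro ext)
    fix x y
    have \<mu>D: "\<And>x y. x \<in> carrier K \<Longrightarrow> y \<in> carrier K \<Longrightarrow> \<mu> x y \<in> carrier K"
      "\<And>x y. x \<notin> carrier K \<or> y \<notin> carrier K \<Longrightarrow> \<mu> x y = undefined"
      "\<And>x y z. x \<in> carrier K \<Longrightarrow> y \<in> carrier K \<Longrightarrow> z \<in> carrier K \<Longrightarrow> \<mu> (x \<otimes>\<^bsub>K\<^esub> y) z = \<mu> x z \<otimes>\<^bsub>K\<^esub> \<mu> y z"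
      "\<And>x y z. x \<in> carrier K \<Longrightarrow> y \<in> carrier K \<Longrightarrow> z \<in> carrier K \<Longrightarrow> \<mu> z (x \<otimes>\<^bsub>K\<^esub> y) = \<mu> z x \<otimes>\<^bsub>K\<^esub> \<mu> z y"
      "\<And>S T. is_fg_module M S \<Longrightarrow> is_fg_module M T \<Longrightarrow> \<mu> (cls S) (cls T) = cls (smash S T)"
      using \<mu> unfolding induced_by_smash_def Let_def G0_class_def FG_simps by blast+
    have gen: "\<psi> (\<mu> (cls (add_point S)) (cls (add_point T))) H = \<psi> (cls (add_point S)) H * \<psi> (cls (add_point T)) H"
      if "S \<in> finite_gsets G" "T \<in> finite_gsets G" for S T H
      using \<mu>D(5)[OF add_point_fg[OF that(1)] add_point_fg[OF that(2)]] smash[OF add_point_fg[OF that(1)] add_point_fg[OF that(2)]]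
      by simp
    \<comment> \<open>Biadditivity is used one argument at a time: here the first argument is a
      difference of classes and the second a class, then the second argument is resolved in the same
      way.\<close>
    have left: "\<psi> (\<mu> x (cls (add_point T))) H = \<psi> x H * \<psi> (cls (add_point T)) H"
      if x: "x \<in> carrier K" and T: "T \<in> finite_gsets G" for x T H
    proof -
      obtain S S' where S: "S \<in> finite_gsets G" "S' \<in> finite_gsets G" "x \<otimes>\<^bsub>K\<^esub> cls (add_point S') = cls (add_point S)"
        using decomp[OF x] by blast
      have "\<psi> (\<mu> x (cls (add_point T)) \<otimes>\<^bsub>K\<^esub> \<mu> (cls (add_point S')) (cls (add_point T))) H = \<psi> (cls (add_point S)) H * \<psi> (cls (add_point T)) H"
        using \<mu>D(3)[OF x clsK[OF S(2)] clsK[OF T]] gen[OF S(1) T, of H] S(3) by simp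
      then have "\<psi> (\<mu> x (cls (add_point T))) H + \<psi> (cls (add_point S')) H * \<psi> (cls (add_point T)) H =
          \<psi> (cls (add_point S)) H * \<psi> (cls (add_point T)) H"
        using add[OF \<mu>D(1)[OF x clsK[OF T]] \<mu>D(1)[OF clsK[OF S(2)] clsK[OF T]]] gen[OF S(2) T, of H] by simp
      moreover have "\<psi> (cls (add_point S)) H = \<psi> x H + \<psi> (cls (add_point S')) H"
        using add[OF x clsK[OF S(2)]] S(3) by simp
      ultimately show ?thesis by (simp add: algebra_simps)
    qed
    show "\<mu> x y = \<mu>0 x y"
    proof (cases "x \<in> carrier K \<and> y \<in> carrier K")
      case True
      then have xy: "x \<in> carrier K" "y \<in> carrier K" by auto
      obtain T T' where T: "T \<in> finite_gsets G" "T' \<in> finite_gsets G" "y \<otimes>\<^bsub>K\<^esub> cls (add_point T') = cls (add_point T)"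
        using decomp[OF xy(2)] by blast
      have "\<psi> (\<mu> x y) H = \<psi> x H * \<psi> y H" for H
      proof -
        have "\<psi> (\<mu> x y \<otimes>\<^bsub>K\<^esub> \<mu> x (cls (add_point T'))) H = \<psi> x H * \<psi> (cls (add_point T)) H"
          using \<mu>D(4)[OF xy(2) clsK[OF T(2)] xy(1)] left[OF xy(1) T(1), of H] T(3) by simp
        then have "\<psi> (\<mu> x y) H + \<psi> x H * \<psi> (cls (add_point T')) H = \<psi> x H * \<psi> (cls (add_point T)) H"
          using add[OF \<mu>D(1)[OF xy] \<mu>D(1)[OF xy(1) clsK[OF T(2)]]] left[OF xy(1) T(2), of H] by simp
        moreover have "\<psi> (cls (add_point T)) H = \<psi> y H + \<psi> (cls (add_point T')) H"
          using add[OF xy(2) clsK[OF T(2)]] T(3) by simp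
        ultimately show ?thesis by (simp add: algebra_simps)
      qed
      then show ?thesis using xy \<mu>D(1)[OF xy] by (intro eqI) (simp_all add: \<mu>0 fun_eq_iff)
    qed (auto simp: \<mu>D(2) \<mu>0_def)
  qed
  have THE: "(THE \<mu>. induced_by_smash G \<mu>) = \<mu>0"
    using induced unique by (rule the_equality)
  have G0: "carrier (G0_ring G) = carrier K" "mult (G0_ring G) = \<mu>0" "\<one>\<^bsub>G0_ring G\<^esub> = cls (add_point gset_point)"
    "\<zero>\<^bsub>G0_ring G\<^esub> = \<one>\<^bsub>K\<^esub>" "add (G0_ring G) = mult K"
    by (simp_all add: G0_ring_def Let_def THE G0_class_def)
  have \<psi>1: "\<psi> (cls (add_point gset_point)) = (\<lambda>H. 1)"
    using mark_cls[OF gset_point_in] by (simp add: mark_point)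
  have cringK: "cring (G0_ring G)"
  proof (rule cring_pointwiseI[where \<nu> = \<psi>])
    fix x assume "x \<in> carrier (G0_ring G)"
    then show "\<exists>y \<in> carrier (G0_ring G). \<psi> y = (\<lambda>i. - \<psi> x i)"
      using inv by (intro bexI[of _ "inv\<^bsub>K\<^esub> x"]) (auto simp: G0)
  qed (use inj in \<open>auto simp: G0 \<mu>0 add one \<psi>1 clsK[OF gset_point_in]\<close>)
  let ?A = "burnside_ring G"
  have A: "?A = B.A" by (simp add: burnside_ring_def)
  have imgA: "B.value_at ` carrier ?A = ?V"
  proof -
    have "{\<lambda>i. class_mark a i - class_mark b i | a b. a \<in> carrier (gset_semiring G) \<and> b \<in> carrier (gset_semiring G)} = ?V"
    proof (intro equalityI subsetI)
      fix u assume "u \<in> {\<lambda>i. class_mark a i - class_mark b i | a b. a \<in> carrier (gset_semiring G) \<and> b \<in> carrier (gset_semiring G)}"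
      then obtain S T where "S \<in> finite_gsets G" "T \<in> finite_gsets G"
        "u = (\<lambda>i. class_mark (gset_class G S) i - class_mark (gset_class G T) i)"
        by (auto simp: gset_semiring_sel)
      then show "u \<in> ?V" unfolding mark_differences_def by (auto simp: class_mark)
    next
      fix u assume "u \<in> ?V"
      then obtain S T where "S \<in> finite_gsets G" "T \<in> finite_gsets G"
        "u = (\<lambda>i. class_mark (gset_class G S) i - class_mark (gset_class G T) i)"
        by (auto simp: mark_differences_def class_mark)
      then show "u \<in> {\<lambda>i. class_mark a i - class_mark b i | a b. a \<in> carrier (gset_semiring G) \<and> b \<in> carrier (gset_semiring G)}"
        unfolding gset_semiring_sel by blast
    qed
    then show ?thesis using B.value_at_image A by simp
  qed
  \<comment> \<open>Both rings embed onto \<open>mark_differences\<close>, and \<phi> matches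
    elements with equal values. Each ring identity is then checked on values.\<close>
  define \<phi> where "\<phi> = (\<lambda>X. inv_into (carrier K) \<psi> (B.value_at X))"
  have \<phi>: "\<phi> X \<in> carrier K" "\<psi> (\<phi> X) = B.value_at X" if "X \<in> carrier ?A" for X
    using inv\<psi>[of "B.value_at X"] imgA that by (auto simp: \<phi>_def)
  have closed: "X \<oplus>\<^bsub>?A\<^esub> Y \<in> carrier ?A" "X \<otimes>\<^bsub>?A\<^esub> Y \<in> carrier ?A" if "X \<in> carrier ?A" "Y \<in> carrier ?A" for X Y
    using B.grothendieck_closed that by (simp_all add: A)
  have one_in: "\<one>\<^bsub>?A\<^esub> \<in> carrier ?A"
    unfolding A B.grothendieck_one using B.closed by (intro B.diff_class_in)
  note vals = B.grothendieck_values[folded A]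
  have "\<phi> \<in> ring_iso ?A (G0_ring G)"
  proof (rule ring_iso_memI)
    show "bij_betw \<phi> (carrier ?A) (carrier (G0_ring G))"
    proof -
      have "bij_betw B.value_at (carrier ?A) ?V" using vals(5) imgA by (simp add: bij_betw_def)
      from bij_betw_trans[OF this bij_betw_inv_into[OF bij]] show ?thesis
        by (simp add: G0 \<phi>_def comp_def)
    qed
    show "\<phi> \<one>\<^bsub>?A\<^esub> = \<one>\<^bsub>G0_ring G\<^esub>"
      using one_in by (intro eqI) (simp_all add: G0 \<phi> vals \<psi>1 clsK gset_point_in)
    show "\<phi> (X \<otimes>\<^bsub>?A\<^esub> Y) = \<phi> X \<otimes>\<^bsub>G0_ring G\<^esub> \<phi> Y" if "X \<in> carrier ?A" "Y \<in> carrier ?A" for X Y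
      using that by (intro eqI) (simp_all add: G0 \<phi> closed \<mu>0 vals)
    show "\<phi> (X \<oplus>\<^bsub>?A\<^esub> Y) = \<phi> X \<oplus>\<^bsub>G0_ring G\<^esub> \<phi> Y" if "X \<in> carrier ?A" "Y \<in> carrier ?A" for X Y
      using that by (intro eqI) (simp_all add: G0 \<phi> closed add vals)
  qed (simp add: \<phi> G0)
  moreover have "\<phi> (burnside_class G S) = G0_class G (add_point S)" if S: "S \<in> finite_gsets G" for S
  proof -
    have "gset_class G S \<in> carrier (gset_semiring G)" "\<zero>\<^bsub>gset_semiring G\<^esub> \<in> carrier (gset_semiring G)"
      using S B.closed by (simp_all add: gset_semiring_sel)
    then have "burnside_class G S \<in> carrier ?A" "B.value_at (burnside_class G S) = (\<lambda>H. int (mark S H))"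
      using S by (simp_all add: burnside_class_def A B.diff_class_in B.value_at_diff_class B.m class_mark)
    then show ?thesis
      unfolding G0_class_def using S clsK by (intro eqI) (simp_all add: \<phi> mark_cls)
  qed
  moreover have "cring ?A" unfolding A by (rule B.cring_grothendieck)
  ultimately show ?thesis using induced unique cringK by blast
qed

end

theorem mainTheorem5:
  fixes G :: "('g, 'b) monoid_scheme"
  assumes "group G" and "finite (carrier G)"
  shows "cring (burnside_ring G) \<and>
         (\<exists>!\<mu>. induced_by_smash G \<mu>) \<and>
         cring (G0_ring G) \<and>
         (\<exists>\<phi>. \<phi> \<in> ring_iso (burnside_ring G) (G0_ring G) \<and>
              (\<forall>S \<in> finite_gsets G. \<phi> (burnside_class G S) = G0_class G (add_point S)))"
proof -
  interpret finite_group G using assms by (intro finite_group.intro finite_group_axioms.intro)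
  show ?thesis by (rule burnside_ring_iso)
qed

end
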